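(* Let $E$ be an elliptic curve defined over $\mathbb{R}$ and let $\mathbf{P}=(P_1,\ldots,P_n)$ be an $n$-tuple of $\mathbb{Z}$-linearly independent points of $E(\mathbb{R})$. Let $q$ and $u_1,\ldots,u_n$ be attached to $E$ and $\mathbf{P}$ as in the context, and suppose that there is an integer $k$ with $0\le k\le n$ such that $u_1,\ldots,u_k<0$ and $u_{k+1},\ldots,u_n>0$ (the case $k=0$ meaning all $u_i>0$). Define $\beta_i=\log_q|u_i|$ if $q>0$ and $\beta_i=\tfrac12\log_{|q|}u_i$ if $q<0$ ($1\le i\le n$). Then $\beta_1,\ldots,\beta_n$ are irrational and linearly independent over $\mathbb{Q}$. Moreover, setting $N(\mathbf{v})=\sum_{i=1}^n v_i^2-\sum_{1\le i<j\le n}v_iv_j-1$, there is a choice $\Phi_{\mathbf{v}}=\Psi_{\mathbf{v}}(\mathbf{P};E)$ for all $\mathbf{v}$, or $\Phi_{\mathbf{v}}=(-1)^{N(\mathbf{v})}\Psi_{\mathbf{v}}(\mathbf{P};E)$ for all $\mathbf{v}$, such that for every nonzero $\mathbf{v}=(v_1,\ldots,v_n)\in\mathbb{Z}^n$: if $\sum_{i=1}^k v_i$ is even, $$\mathrm{Parity}[\Phi_{\mathbf{v}}]\equiv \sum_{1\le i<j\le k}\lfloor\beta_i+\beta_j\rfloor v_iv_j+\sum_{k+1\le i<j\le n}\lfloor\beta_i+\beta_j\rfloor v_iv_j+\Big\lfloor\sum_{i=1}^n v_i\beta_i\Big\rfloor+\sum_{i=1}^k\Big\lfloor\frac{v_i}{2}\Big\rfloor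 \pmod 2,$$ and if $\sum_{i=1}^k v_i$ is odd, $$\mathrm{Parity}[\Phi_{\mathbf{v}}]\equiv \sum_{1\le i<j\le k}\lfloor\beta_i+\beta_j\rfloor v_iv_j+\sum_{k+1\le i<j\le n}\lfloor\beta_i+\beta_j\rfloor v_iv_j+\sum_{i=1}^k\Big\lfloor\frac{v_i}{2}\Big\rfloor \pmod 2.$$ (In particular, when all $u_i>0$: $\mathrm{Parity}[\Phi_{\mathbf{v}}]\equiv\lfloor\sum_i v_i\beta_i\rfloor+\sum_{1\le i<j\le n}\lfloor\beta_i+\beta_j\rfloor v_iv_j \pmod 2$.)
   Context: For a nonzero real number $x$, $\mathrm{Parity}[x]\in\mathbb{Z}/2\mathbb{Z}$ is defined by $x/|x|=(-1)^{\mathrm{Parity}[x]}$. Let $\Lambda\subset\mathbb{C}$ be the period lattice of $E$, with the complex uniformization $\mathbb{C}/\Lambda\cong E(\mathbb{C})$, and let $\sigma(z;\Lambda)=z\prod_{0\ne\omega\in\Lambda}(1-z/\omega)e^{z/\omega+\frac12(z/\omega)^2}$ be the Weierstrass sigma function. For $\mathbf{P}=(P_1,\ldots,P_n)$ choose $z_i\in\mathbb{C}$ corresponding to $P_i$ and, for $\mathbf{v}\in\mathbb{Z}^n$, define the net polynomial value $$\Psi_{\mathbf{v}}(\mathbf{P};E)=(-1)^{\sum_i v_i^2-\sum_{i<j}v_iv_j-1}\frac{\sigma(v_1z_1+\cdots+v_nz_n;\Lambda)}{\prod_{i=1}^n\sigma(z_i;\Lambda)^{2v_i^2-\sum_{j=1}^n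 v_iv_j}\prod_{1\le i<j\le n}\sigma(z_i+z_j;\Lambda)^{v_iv_j}}.$$ When $E$ is defined over $\mathbb{R}$ and $P_i\in E(\mathbb{R})$ these are real numbers, nonzero for $\mathbf{v}\ne\mathbf{0}$ if the $P_i$ are linearly independent. Tate parametrization over $\mathbb{R}$: there is a unique real $q$ with $0<|q|<1$ such that $E$ is $\mathbb{R}$-isomorphic to the Tate curve $E_q$, and composing Tate's analytic isomorphism $\mathbb{C}^*/q^{\mathbb{Z}}\to E_q(\mathbb{C})$ with this isomorphism gives an isomorphism $\psi:\mathbb{C}^*/q^{\mathbb{Z}}\to E(\mathbb{C})$ commuting with complex conjugation, which restricts to an $\mathbb{R}$-analytic group isomorphism $\mathbb{R}^*/q^{\mathbb{Z}}\to E(\mathbb{R})$. For $P_i\ne\mathcal{O}$, $u_i\in\mathbb{R}^*$ denotes the representative of $\psi^{-1}(P_i)$ normalized so that $q<|u_i|<1$ if $q>0$, and $q^2<u_i<1$ if $q<0$ (so all $u_i>0$ when $q<0$). *)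

theory Defs
  imports "HOL-Analysis.Analysis"
begin

record 'a wcurve =
  A1 :: 'a
  A2 :: 'a
  A3 :: 'a
  A4 :: 'a
  A6 :: 'a

datatype 'a ecpt = Inf | Pt 'a 'a

definition weq :: "'a::field wcurve \<Rightarrow> 'a \<Rightarrow> 'a \<Rightarrow> 'a" where
  "weq E x y = y^2 + A1 E * x * y + A3 E * y - x^3 - A2 E * x^2 - A4 E * x - A6 E"

fun on_curve :: "'a::field wcurve \<Rightarrow> 'a ecpt \<Rightarrow> bool" where
  "on_curve E Inf = True"
| "on_curve E (Pt x y) = (weq E x y = 0)"

definition b2 :: "'a::field wcurve \<Rightarrow> 'a" where "b2 E = A1 E ^ 2 + 4 * A2 E"
definition b4 :: "'a::field wcurve \<Rightarrow> 'a" where "b4 E = 2 * A4 E + A1 E * A3 E"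
definition b6 :: "'a::field wcurve \<Rightarrow> 'a" where "b6 E = A3 E ^ 2 + 4 * A6 E"
definition b8 :: "'a::field wcurve \<Rightarrow> 'a" where
  "b8 E = A1 E ^ 2 * A6 E + 4 * A2 E * A6 E - A1 E * A3 E * A4 E + A2 E * A3 E ^ 2 - A4 E ^ 2"
definition c4 :: "'a::field wcurve \<Rightarrow> 'a" where "c4 E = b2 E ^ 2 - 24 * b4 E"
definition c6 :: "'a::field wcurve \<Rightarrow> 'a" where
  "c6 E = - (b2 E ^ 3) + 36 * b2 E * b4 E - 216 * b6 E"
definition disc :: "'a::field wcurve \<Rightarrow> 'a" where
  "disc E = - (b2 E ^ 2 * b8 E) - 8 * b4 E ^ 3 - 27 * b6 E ^ 2 + 9 * b2 E * b4 E * b6 E"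

definition elliptic :: "'a::field wcurve \<Rightarrow> bool" where
  "elliptic E \<longleftrightarrow> disc E \<noteq> 0"

fun ec_neg :: "'a::field wcurve \<Rightarrow> 'a ecpt \<Rightarrow> 'a ecpt" where
  "ec_neg E Inf = Inf"
| "ec_neg E (Pt x y) = Pt x (- y - A1 E * x - A3 E)"

fun ec_add :: "'a::field wcurve \<Rightarrow> 'a ecpt \<Rightarrow> 'a ecpt \<Rightarrow> 'a ecpt" where
  "ec_add E Inf Q = Q"
| "ec_add E (Pt x1 y1) Inf = Pt x1 y1"
| "ec_add E (Pt x1 y1) (Pt x2 y2) =
     (if x1 = x2 \<and> y1 + y2 + A1 E * x2 + A3 E = 0 then Inf
      else
        (let l = (if x1 = x2
                  then (3 * x1^2 + 2 * A2 E * x1 + A4 E - A1 E * y1) / (2 * y1 + A1 E * x1 + A3 E)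
                  else (y2 - y1) / (x2 - x1));
             nu = y1 - l * x1;
             x3 = l^2 + A1 E * l - A2 E - x1 - x2
         in Pt x3 (- (l + A1 E) * x3 - nu - A3 E)))"

fun ec_nmult :: "'a::field wcurve \<Rightarrow> nat \<Rightarrow> 'a ecpt \<Rightarrow> 'a ecpt" where
  "ec_nmult E 0 P = Inf"
| "ec_nmult E (Suc m) P = ec_add E P (ec_nmult E m P)"

definition ec_imult :: "'a::field wcurve \<Rightarrow> int \<Rightarrow> 'a ecpt \<Rightarrow> 'a ecpt" where
  "ec_imult E m P = (if 0 \<le> m then ec_nmult E (nat m) P else ec_neg E (ec_nmult E (nat (- m)) P))"

definition ec_lincomb :: "'a::field wcurve \<Rightarrow> nat \<Rightarrow> (nat \<Rightarrow> int) \<Rightarrow> (nat \<Rightarrow> 'a ecpt) \<Rightarrow> 'a ecpt" where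
  "ec_lincomb E n v P = foldr (\<lambda>i acc. ec_add E (ec_imult E (v i) (P i)) acc) [0..<n] Inf"

definition Z_lin_indep :: "'a::field wcurve \<Rightarrow> nat \<Rightarrow> (nat \<Rightarrow> 'a ecpt) \<Rightarrow> bool" where
  "Z_lin_indep E n P \<longleftrightarrow> (\<forall>v. ec_lincomb E n v P = Inf \<longrightarrow> (\<forall>i<n. v i = 0))"

fun map_pt :: "('a \<Rightarrow> 'b) \<Rightarrow> 'a ecpt \<Rightarrow> 'b ecpt" where
  "map_pt f Inf = Inf"
| "map_pt f (Pt x y) = Pt (f x) (f y)"

definition wiso :: "real wcurve \<Rightarrow> real wcurve \<Rightarrow> real \<Rightarrow> real \<Rightarrow> real \<Rightarrow> real \<Rightarrow> bool" where
  "wiso E E' mu r s t \<longleftrightarrow> mu \<noteq> 0 \<and>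
     (\<forall>x y. weq E (mu^2 * x + r) (mu^3 * y + s * mu^2 * x + t) = mu^6 * weq E' x y)"

fun chvar :: "real \<Rightarrow> real \<Rightarrow> real \<Rightarrow> real \<Rightarrow> complex ecpt \<Rightarrow> complex ecpt" where
  "chvar mu r s t Inf = Inf"
| "chvar mu r s t (Pt x y) =
     Pt (of_real mu ^ 2 * x + of_real r) (of_real mu ^ 3 * y + of_real s * of_real mu ^ 2 * x + of_real t)"

definition lattice :: "complex set \<Rightarrow> bool" where
  "lattice L \<longleftrightarrow> (\<exists>w1 w2. Im (w2 / w1) \<noteq> 0 \<and>
      L = {of_int m * w1 + of_int n * w2 | m n. True})"

definition wp :: "complex set \<Rightarrow> complex \<Rightarrow> complex" where
  "wp L z = 1 / z^2 + infsum (\<lambda>w. 1 / (z - w)^2 - 1 / w^2) (L - {0})"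

definition wp_deriv :: "complex set \<Rightarrow> complex \<Rightarrow> complex" where
  "wp_deriv L z = - 2 * infsum (\<lambda>w. 1 / (z - w)^3) L"

definition g2 :: "complex set \<Rightarrow> complex" where
  "g2 L = 60 * infsum (\<lambda>w. 1 / w^4) (L - {0})"

definition g3 :: "complex set \<Rightarrow> complex" where
  "g3 L = 140 * infsum (\<lambda>w. 1 / w^6) (L - {0})"

text \<open>Weierstrass sigma function; the product converges absolutely, so it is
  taken along an arbitrary enumeration of the nonzero lattice points.\<close>
definition wsigma :: "complex set \<Rightarrow> complex \<Rightarrow> complex" where
  "wsigma L z = z * (\<Prod>m. (let w = from_nat_into (L - {0}) m
                             in (1 - z / w) * exp (z / w + (z / w)^2 / 2)))"

definition period_lattice :: "real wcurve \<Rightarrow> complex set \<Rightarrow> bool" where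
  "period_lattice E L \<longleftrightarrow> lattice L \<and>
     g2 L = of_real (c4 E / 12) \<and> g3 L = of_real (c6 E / 216)"

definition unif :: "real wcurve \<Rightarrow> complex set \<Rightarrow> complex \<Rightarrow> complex ecpt" where
  "unif E L z = (if z \<in> L then Inf else
     (let x = wp L z - of_real (b2 E / 12)
      in Pt x ((wp_deriv L z - of_real (A1 E) * x - of_real (A3 E)) / 2)))"

definition tate_s :: "nat \<Rightarrow> real \<Rightarrow> real" where
  "tate_s k q = (\<Sum>m. real (Suc m) ^ k * q ^ Suc m / (1 - q ^ Suc m))"

definition tate_curve :: "real \<Rightarrow> real wcurve" where
  "tate_curve q = \<lparr>A1 = 1, A2 = 0, A3 = 0, A4 = - 5 * tate_s 3 q,
                   A6 = - (5 * tate_s 3 q + 7 * tate_s 5 q) / 12\<rparr>"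

definition tate_map :: "real \<Rightarrow> complex \<Rightarrow> complex ecpt" where
  "tate_map q u = (if \<exists>m::int. u = of_real q powi m then Inf else
     Pt (infsum (\<lambda>n::int. of_real q powi n * u / (1 - of_real q powi n * u)^2) UNIV
           - 2 * of_real (tate_s 1 q))
        (infsum (\<lambda>n::int. of_real q powi (2 * n) * u^2 / (1 - of_real q powi n * u)^3) UNIV
           + of_real (tate_s 1 q)))"

definition tate_psi :: "real \<Rightarrow> real \<Rightarrow> real \<Rightarrow> real \<Rightarrow> real \<Rightarrow> complex \<Rightarrow> complex ecpt" where
  "tate_psi q mu r s t u = chvar mu r s t (tate_map q u)"

definition Nq :: "nat \<Rightarrow> (nat \<Rightarrow> int) \<Rightarrow> int" where
  "Nq n v = (\<Sum>i<n. v i ^ 2) - (\<Sum>i<n. \<Sum>j\<in>{i<..<n}. v i * v j) - 1"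

definition netPsi :: "complex set \<Rightarrow> nat \<Rightarrow> (nat \<Rightarrow> complex) \<Rightarrow> (nat \<Rightarrow> int) \<Rightarrow> complex" where
  "netPsi L n z v =
     (-1) powi (Nq n v) * wsigma L (\<Sum>i<n. of_int (v i) * z i) /
     ((\<Prod>i<n. wsigma L (z i) powi (2 * v i ^ 2 - (\<Sum>j<n. v i * v j))) *
      (\<Prod>i<n. \<Prod>j\<in>{i<..<n}. wsigma L (z i + z j) powi (v i * v j)))"

text \<open>Parity[x] in Z/2, represented by 0 or 1: x/|x| = (-1)^Parity[x] for x nonzero.\<close>
definition Parity :: "real \<Rightarrow> int" where
  "Parity x = (if x < 0 then 1 else 0)"

end

theory Submission
  imports Defs "HOL-Complex_Analysis.Complex_Analysis"
begin

text \<open>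
  Write \<open>T z = - e\<^sup>-\<^sup>z\<^sup>/\<^sup>2 \<Prod>\<^sub>n\<^sub>\<ge>\<^sub>0 (1 - q\<^sup>n e\<^sup>z) (1 - q\<^sup>n\<^sup>+\<^sup>1 e\<^sup>-\<^sup>z)\<close>. The \<open>x\<close>-coordinate of the Tate parametrization, seen as a
  function of \<open>z\<close> with \<open>u = e\<^sup>z\<close>, satisfies the same differential equation as the Weierstrass
  function of the period lattice after scaling by \<open>mu\<close>, and a solution with a double pole at \<open>0\<close> is
  unique. Hence \<open>mu L = 2 \<pi> i \<int> + log q \<int>\<close>, and comparing second logarithmic derivatives shows that
  \<open>\<sigma>(z)\<close> is \<open>T (mu z)\<close> times a Gaussian, divided by \<open>mu \<Prod>\<^sub>n\<^sub>\<ge>\<^sub>1 (1 - q\<^sup>n)\<^sup>2\<close>.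

  The quotient defining the net polynomial is multiplicative in \<open>\<sigma>\<close>, trivial on exponentials of
  quadratic forms in \<open>v\<close>, and turns a constant \<open>c\<close> into \<open>c\<close> to the power \<open>- N(v)\<close>; so the Gaussian factors disappear,
  and the sign of \<open>mu\<close> decides which of the two choices of \<open>\<Phi>\<close> is needed. What remains is the
  sign of the theta product at \<open>\<plusminus> q\<^sup>b\<close>: for the plus sign the functional equation gives parity \<open>\<lfloor>b\<rfloor>\<close>, for the
  minus sign all factors are positive, and the half-integral powers of \<open>-1\<close> from \<open>e\<^sup>-\<^sup>z\<^sup>/\<^sup>2\<close> contribute
  \<open>\<Sum> (v\<^sub>i - v\<^sub>i\<^sup>2) / 2\<close>, congruent to \<open>\<Sum> \<lfloor>v\<^sub>i / 2\<rfloor>\<close>. The independence of the \<open>\<beta>\<^sub>i\<close> follows from the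
  addition theorem: an integral relation would force a relation among the points.
\<close>

section \<open>Lattices in the complex plane\<close>

text \<open>The hypotheses link \<open>L\<close> to \<open>q\<close> only through the two numbers
  \<open>g2 L\<close> and \<open>g3 L\<close>, so the lattice has to be recovered from its
  invariants. The differential equation with these coefficients determines the function, and the
  poles of the function are the lattice. That equation is singular at the pole, so the usual
  uniqueness theorem does not apply there; orders of vanishing are compared instead. Independence is
  stated with the algebraic group law of the real curve, while the exponents are analytic. Hence
  addition and duplication formulas are needed, including the degenerate cases of the chord
  construction. The logarithms \<open>z i\<close> are known only modulo \<open>L\<close>. Replacing
  them by the principal logarithms of \<open>u i\<close> costs a factor of automorphy of the theta
  product, whose exponent is quadratic in \<open>v\<close> and whose sign has an exponent linear in
  \<open>v\<close>. The net quotient removes the former, and it turns the latter into a combination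
  of the even numbers \<open>v i - v i ^ 2\<close>.\<close>

locale cplx_lattice =
  fixes w1 w2 :: complex and L :: "complex set"
  assumes indep: "Im (w2 / w1) \<noteq> 0"
    and L_eq: "L = {of_int m * w1 + of_int n * w2 | m n. True}"
begin

lemma L_memI: "of_int m * w1 + of_int n * w2 \<in> L"
  by (auto simp: L_eq)

lemma L_memE:
  assumes "w \<in> L"
  obtains m n where "w = of_int m * w1 + of_int n * w2"
  using assms by (auto simp: L_eq)

lemma zero_mem [simp]: "0 \<in> L"
  using L_memI[of 0 0] by simp

lemma add_mem: "a \<in> L \<Longrightarrow> b \<in> L \<Longrightarrow> a + b \<in> L"
proof -
  assume "a \<in> L" "b \<in> L"
  then obtain m n m' n' where "a = of_int m * w1 + of_int n * w2" "b = of_int m' * w1 + of_int n' * w2"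
    by (metis L_memE)
  hence "a + b = of_int (m + m') * w1 + of_int (n + n') * w2"
    by (simp add: algebra_simps)
  thus ?thesis by (metis L_memI)
qed

lemma uminus_mem: "a \<in> L \<Longrightarrow> - a \<in> L"
proof -
  assume "a \<in> L"
  then obtain m n where "a = of_int m * w1 + of_int n * w2"
    by (metis L_memE)
  hence "- a = of_int (- m) * w1 + of_int (- n) * w2"
    by (simp add: algebra_simps)
  thus ?thesis by (metis L_memI)
qed

lemma uminus_mem_iff [simp]: "- a \<in> L \<longleftrightarrow> a \<in> L"
  using uminus_mem[of a] uminus_mem[of "-a"] by auto

lemma diff_mem: "a \<in> L \<Longrightarrow> b \<in> L \<Longrightarrow> a - b \<in> L"
  using add_mem[of a "-b"] by simp

lemma add_mem_iff [simp]: "a \<in> L \<Longrightarrow> z + a \<in> L \<longleftrightarrow> z \<in> L"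
  by (metis add_mem add_diff_cancel_right' diff_mem)

lemma diff_mem_iff [simp]: "a \<in> L \<Longrightarrow> z - a \<in> L \<longleftrightarrow> z \<in> L"
  using add_mem_iff[of "-a" z] by simp

lemma w1_mem [simp]: "w1 \<in> L" using L_memI[of 1 0] by simp
lemma w1_nz: "w1 \<noteq> 0" and w2_nz: "w2 \<noteq> 0"
  using indep by auto

lemma indep': "Im (w1 / w2) \<noteq> 0"
proof -
  have "Im (inverse (w2 / w1)) \<noteq> 0"
    using indep w1_nz w2_nz by (simp del: inverse_divide)
  thus ?thesis by simp
qed

text \<open>Division by \<open>w2\<close> leaves \<open>m\<close> times the fixed nonzero number
  \<open>Im (w1 / w2)\<close> as imaginary part, and division by \<open>w1\<close> does the same for
  \<open>n\<close>. Injectivity of the coordinates, discreteness and convergence of lattice sums all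
  come from these two bounds.\<close>

lemma norm_lower_bound:
  obtains \<delta> where "\<delta> > 0" "\<And>m n. \<delta> * real_of_int \<bar>m\<bar> \<le> norm (of_int m * w1 + of_int n * w2)"
    "\<And>m n. \<delta> * real_of_int \<bar>n\<bar> \<le> norm (of_int m * w1 + of_int n * w2)"
proof -
  define d1 where "d1 = norm w2 * \<bar>Im (w1 / w2)\<bar>"
  define d2 where "d2 = norm w1 * \<bar>Im (w2 / w1)\<bar>"
  have pos: "d1 > 0" "d2 > 0"
    using indep indep' w1_nz w2_nz by (auto simp: d1_def d2_def)
  have 1: "d1 * real_of_int \<bar>m\<bar> \<le> norm (of_int m * w1 + of_int n * w2)" for m n
  proof -
    have "Im ((of_int m * w1 + of_int n * w2) / w2) = of_int m * Im (w1 / w2)"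
      using w2_nz by (simp add: add_divide_distrib flip: times_divide_eq_right)
    hence "\<bar>of_int m * Im (w1 / w2)\<bar> \<le> norm ((of_int m * w1 + of_int n * w2) / w2)"
      by (metis abs_Im_le_cmod)
    thus ?thesis
      using w2_nz by (simp add: d1_def norm_divide field_simps abs_mult)
  qed
  have 2: "d2 * real_of_int \<bar>n\<bar> \<le> norm (of_int m * w1 + of_int n * w2)" for m n
  proof -
    have "Im ((of_int m * w1 + of_int n * w2) / w1) = of_int n * Im (w2 / w1)"
      using w1_nz by (simp add: add_divide_distrib flip: times_divide_eq_right)
    hence "\<bar>of_int n * Im (w2 / w1)\<bar> \<le> norm ((of_int m * w1 + of_int n * w2) / w1)"
      by (metis abs_Im_le_cmod)
    thus ?thesis
      using w1_nz by (simp add: d2_def norm_divide field_simps abs_mult)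
  qed
  show ?thesis
  proof (rule that[of "min d1 d2"])
    show "min d1 d2 * real_of_int \<bar>m\<bar> \<le> norm (of_int m * w1 + of_int n * w2)" for m n
      by (rule order_trans[OF mult_right_mono 1]) auto
    show "min d1 d2 * real_of_int \<bar>n\<bar> \<le> norm (of_int m * w1 + of_int n * w2)" for m n
      by (rule order_trans[OF mult_right_mono 2]) auto
  qed (use pos in auto)
qed

lemma coeffs_eq_0:
  assumes "of_int m * w1 + of_int n * w2 = 0"
  shows "m = 0" "n = 0"
proof -
  obtain \<delta> where \<delta>: "\<delta> > 0" "\<And>m n. \<delta> * real_of_int \<bar>m\<bar> \<le> norm (of_int m * w1 + of_int n * w2)"
    "\<And>m n. \<delta> * real_of_int \<bar>n\<bar> \<le> norm (of_int m * w1 + of_int n * w2)"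
    using norm_lower_bound by blast
  show "m = 0" "n = 0"
    using \<delta>(1) \<delta>(2)[of m n] \<delta>(3)[of n m] assms by (auto simp: mult_le_0_iff)
qed

lemma inj_coords: "inj (\<lambda>(m, n). of_int m * w1 + of_int n * w2)"
proof (rule injI, clarify)
  fix m n m' n' :: int
  assume "of_int m * w1 + of_int n * w2 = of_int m' * w1 + of_int n' * w2"
  hence "of_int (m - m') * w1 + of_int (n - n') * w2 = 0"
    by (simp add: algebra_simps)
  from coeffs_eq_0[OF this] show "m = m' \<and> n = n'" by simp
qed

text \<open>Half periods serve as base points off the poles, and they make the periodicity of
  \<open>wp\<close> provable by reflection.\<close>

lemma half_period_notin: "w1 / 2 \<notin> L" "w2 / 2 \<notin> L"
proof -
  show "w1 / 2 \<notin> L"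
  proof
    assume "w1 / 2 \<in> L"
    then obtain m n where "w1 / 2 = of_int m * w1 + of_int n * w2" by (metis L_memE)
    hence "of_int (2 * m - 1) * w1 + of_int (2 * n) * w2 = 0" by (simp add: field_simps)
    from coeffs_eq_0(1)[OF this] show False by presburger
  qed
  show "w2 / 2 \<notin> L"
  proof
    assume "w2 / 2 \<in> L"
    then obtain m n where "w2 / 2 = of_int m * w1 + of_int n * w2" by (metis L_memE)
    hence "of_int (2 * m) * w1 + of_int (2 * n - 1) * w2 = 0" by (simp add: field_simps)
    from coeffs_eq_0(2)[OF this] show False by presburger
  qed
qed

section \<open>Discreteness of the lattice and convergence of lattice sums\<close>

lemma countable_L: "countable L"
proof -
  have "L = (\<lambda>(m, n). of_int m * w1 + of_int n * w2) ` UNIV"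
    by (auto simp: L_eq)
  thus ?thesis by simp
qed

lemma infinite_L: "infinite L"
proof -
  have "L = (\<lambda>(m, n). of_int m * w1 + of_int n * w2) ` UNIV"
    by (auto simp: L_eq)
  thus ?thesis
    using inj_coords by (simp add: finite_image_iff finite_prod infinite_UNIV_int)
qed

lemma finite_bounded_L: "finite {w \<in> L. norm w \<le> R}"
proof -
  obtain \<delta> where \<delta>: "\<delta> > 0" "\<And>m n. \<delta> * real_of_int \<bar>m\<bar> \<le> norm (of_int m * w1 + of_int n * w2)"
    "\<And>m n. \<delta> * real_of_int \<bar>n\<bar> \<le> norm (of_int m * w1 + of_int n * w2)"
    using norm_lower_bound by blast
  define K where "K = \<lceil>R / \<delta>\<rceil>"
  have "{w \<in> L. norm w \<le> R} \<subseteq> (\<lambda>(m, n). of_int m * w1 + of_int n * w2) ` ({-K..K} \<times> {-K..K})"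
  proof clarify
    fix w assume w: "w \<in> L" "norm w \<le> R"
    obtain m n where mn: "w = of_int m * w1 + of_int n * w2"
      using w by (metis L_memE)
    have "real_of_int \<bar>m\<bar> \<le> R / \<delta>" "real_of_int \<bar>n\<bar> \<le> R / \<delta>"
      using \<delta>(1) \<delta>(2)[of m n] \<delta>(3)[of n m] w(2) mn by (auto simp: field_simps)
    hence "\<bar>m\<bar> \<le> K" "\<bar>n\<bar> \<le> K"
      by (auto simp: K_def le_ceiling_iff)
    thus "w \<in> (\<lambda>(m, n). of_int m * w1 + of_int n * w2) ` ({-K..K} \<times> {-K..K})"
      using mn by (intro image_eqI[of _ _ "(m, n)"]) auto
  qed
  thus ?thesis
    by (rule finite_subset) auto
qed

text \<open>Distinct lattice points are at least \<open>\<delta>\<close> apart, so no set of them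
  accumulates. Arbitrary subsets are covered because the complements of \<open>L\<close>,
  \<open>L - {0}\<close> and \<open>L - {z}\<close> all have to be open.\<close>

lemma closed_subset_L:
  assumes "A \<subseteq> L"
  shows "closed A"
proof -
  obtain \<delta> where \<delta>: "\<delta> > 0" "\<And>m n. \<delta> * real_of_int \<bar>m\<bar> \<le> norm (of_int m * w1 + of_int n * w2)"
    "\<And>m n. \<delta> * real_of_int \<bar>n\<bar> \<le> norm (of_int m * w1 + of_int n * w2)"
    using norm_lower_bound by blast
  have "\<forall>x\<in>A. \<forall>y\<in>A. dist y x < \<delta> \<longrightarrow> y = x"
  proof safe
    fix x y assume "x \<in> A" "y \<in> A" "dist y x < \<delta>"
    hence "y - x \<in> L" using assms diff_mem by blast
    then obtain m n where mn: "y - x = of_int m * w1 + of_int n * w2"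
      by (metis L_memE)
    have "norm (y - x) < \<delta>" using \<open>dist y x < \<delta>\<close> by (simp add: dist_norm)
    hence "\<delta> * real_of_int \<bar>m\<bar> < \<delta> * 1" "\<delta> * real_of_int \<bar>n\<bar> < \<delta> * 1"
      using \<delta>(2)[of m n] \<delta>(3)[of n m] mn by auto
    hence "m = 0" "n = 0" using \<delta>(1) by auto
    thus "y = x" using mn by simp
  qed
  thus ?thesis
    using discrete_imp_closed[OF \<delta>(1)] by blast
qed

text \<open>With \<open>M\<close> the maximum of the absolute coordinates,
  \<open>(2 * M) ^ 2\<close> bounds the product of \<open>1 + |m|\<close> and
  \<open>1 + |n|\<close>. The exponent 3 thus splits into 3/2 for each coordinate, and the double
  series is dominated by a product of two convergent simple series.\<close>

lemma summable_norm_cube: "(\<lambda>w. 1 / norm w ^ 3) summable_on (L - {0})"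
proof -
  obtain \<delta> where \<delta>: "\<delta> > 0" "\<And>m n. \<delta> * real_of_int \<bar>m\<bar> \<le> norm (of_int m * w1 + of_int n * w2)"
    "\<And>m n. \<delta> * real_of_int \<bar>n\<bar> \<le> norm (of_int m * w1 + of_int n * w2)"
    using norm_lower_bound by blast
  define a :: "int \<Rightarrow> real" where "a = (\<lambda>m. (1 + \<bar>of_int m\<bar>) powr (-3/2))"
  have nat: "(\<lambda>n::nat. a (int n)) summable_on UNIV"
  proof -
    have "summable (\<lambda>n. real n powr (-3/2))"
      by (subst summable_real_powr_iff) auto
    hence "summable (\<lambda>n. real (Suc n) powr (-3/2))"
      by (subst summable_Suc_iff)
    thus ?thesis
      by (subst summable_on_UNIV_nonneg_real_iff) (auto simp: a_def add_ac)
  qed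
  have a1: "a summable_on (range int)"
    using nat by (subst summable_on_reindex) (auto simp: o_def)
  have "a summable_on (range (\<lambda>n. - int n))"
    using nat by (subst summable_on_reindex) (auto simp: o_def inj_on_def a_def)
  hence "a summable_on (range int \<union> range (\<lambda>n. - int n))"
    using a1 by (intro summable_on_union)
  also have "range int \<union> range (\<lambda>n. - int n) = UNIV"
    by (auto simp: image_iff) (metis int_cases2)
  finally have a: "a summable_on UNIV" .
  have "(\<lambda>(m, n). a m * a n) summable_on (UNIV \<times> UNIV)"
  proof (rule summable_on_SigmaI[where g = "\<lambda>m. a m * infsum a UNIV"])
    show "((\<lambda>n. case (m, n) of (m, n) \<Rightarrow> a m * a n) has_sum a m * infsum a UNIV) UNIV" for m
      using a by (auto intro!: has_sum_cmult_right)
    show "(\<lambda>m. a m * infsum a UNIV) summable_on UNIV"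
      using a by (intro summable_on_cmult_left)
  qed (auto simp: a_def)
  hence "(\<lambda>p. 8 / \<delta> ^ 3 * (case p of (m, n) \<Rightarrow> a m * a n)) summable_on (UNIV - {(0, 0)})"
    by (intro summable_on_cmult_right) (auto intro: summable_on_subset)
  hence "(\<lambda>p. 1 / norm (case p of (m, n) \<Rightarrow> of_int m * w1 + of_int n * w2) ^ 3) summable_on (UNIV - {(0, 0)})"
  proof (rule summable_on_comparison_test)
    fix p :: "int \<times> int"
    assume p: "p \<in> UNIV - {(0, 0)}"
    obtain m n where [simp]: "p = (m, n)" by (cases p)
    define M where "M = max (real_of_int \<bar>m\<bar>) (real_of_int \<bar>n\<bar>)"
    have M: "M \<ge> 1" using p by (auto simp: M_def)
    have "\<delta> * M \<le> norm (of_int m * w1 + of_int n * w2)"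
      using \<delta>(2)[of m n] \<delta>(3)[of n m] by (auto simp: M_def max_def)
    hence "(\<delta> * M) ^ 3 \<le> norm (of_int m * w1 + of_int n * w2) ^ 3"
      using M \<delta>(1) by (intro power_mono) auto
    hence "1 / norm (of_int m * w1 + of_int n * w2) ^ 3 \<le> 1 / (\<delta> * M) ^ 3"
      using M \<delta>(1) by (intro frac_le) auto
    also have "\<dots> = 8 / \<delta> ^ 3 * ((2 * M) ^ 2) powr (-3/2)"
    proof -
      have "((2 * M) ^ 2) powr (-3/2) = ((2 * M) powr 2) powr (-3/2)"
        using M by (subst powr_numeral) auto
      also have "\<dots> = (2 * M) powr (-3)"
        by (simp add: powr_powr)
      also have "\<dots> = 1 / (2 * M) ^ 3"
        using M by (simp add: powr_minus_divide)
      finally show ?thesis by (simp add: power_mult_distrib)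
    qed
    also have "((2 * M) ^ 2) powr (-3/2) \<le> ((1 + \<bar>of_int m\<bar>) * (1 + \<bar>of_int n\<bar>)) powr (-3/2)"
    proof (rule powr_mono2')
      have "(1 + \<bar>of_int m\<bar>) * (1 + \<bar>of_int n\<bar>) \<le> (2 * M) * (2 * M)"
        using M by (intro mult_mono) (auto simp: M_def)
      thus "(1 + \<bar>of_int m\<bar>) * (1 + \<bar>of_int n\<bar>) \<le> (2 * M) ^ 2" by (simp add: power2_eq_square)
    qed (auto intro!: mult_pos_pos)
    also have "\<dots> = a m * a n" by (simp add: a_def powr_mult)
    finally show "1 / norm (case p of (m, n) \<Rightarrow> of_int m * w1 + of_int n * w2) ^ 3
        \<le> 8 / \<delta> ^ 3 * (case p of (m, n) \<Rightarrow> a m * a n)"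
      using \<delta>(1) by (simp add: divide_right_mono)
  qed auto
  also have "(\<lambda>p. 1 / norm (case p of (m, n) \<Rightarrow> of_int m * w1 + of_int n * w2) ^ 3) =
     (\<lambda>w. 1 / norm w ^ 3) \<circ> (\<lambda>(m, n). of_int m * w1 + of_int n * w2)"
    by (auto simp: fun_eq_iff)
  also have "\<dots> summable_on (UNIV - {(0,0)}) \<longleftrightarrow>
     (\<lambda>w. 1 / norm w ^ 3) summable_on ((\<lambda>(m, n). of_int m * w1 + of_int n * w2) ` (UNIV - {(0, 0)}))"
    by (rule summable_on_reindex[symmetric]) (rule inj_on_subset[OF inj_coords], auto)
  also have "(\<lambda>(m, n). of_int m * w1 + of_int n * w2) ` (UNIV - {(0, 0)}) = L - {0}"
    using coeffs_eq_0 by (fastforce simp: L_eq)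
  finally show ?thesis .
qed

section \<open>Liouville's theorem for doubly periodic functions\<close>

lemma fundamental_repr:
  obtains w a b where "w \<in> L" "a \<in> {0..1}" "b \<in> {0..1}" "z = w + of_real a * w1 + of_real b * w2"
proof -
  define b where "b = Im (z / w1) / Im (w2 / w1)"
  define a where "a = Re (z / w1) - b * Re (w2 / w1)"
  have "z / w1 = of_real a + of_real b * (w2 / w1)"
    using indep by (intro complex_eqI) (simp_all add: a_def b_def del: times_divide_eq_right)
  hence z: "z = of_real a * w1 + of_real b * w2"
    using w1_nz by (simp add: field_simps)
  show ?thesis
  proof (rule that[of "of_int \<lfloor>a\<rfloor> * w1 + of_int \<lfloor>b\<rfloor> * w2" "frac a" "frac b"])
    show "z = of_int \<lfloor>a\<rfloor> * w1 + of_int \<lfloor>b\<rfloor> * w2 + complex_of_real (frac a) * w1 + complex_of_real (frac b) * w2"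
      by (simp add: z frac_def algebra_simps)
  qed (auto intro: L_memI simp: frac_lt_1 less_imp_le)
qed

text \<open>Giving the value \<open>c\<close> to all lattice points removes the singularity at 0,
  and translation carries differentiability from there to every other lattice point. The resulting
  entire function takes all its values on a compact period parallelogram.\<close>

theorem liouville_periodic:
  assumes hol: "f holomorphic_on - L"
    and per: "\<And>z w. z \<notin> L \<Longrightarrow> w \<in> L \<Longrightarrow> f (z + w) = f z"
    and lim: "(f \<longlongrightarrow> c) (at 0)"
    and z: "z \<notin> L"
  shows "f z = c"
proof -
  define g where "g = (\<lambda>z. if z \<in> L then c else f z)"
  have gper: "g (z + w) = g z" if "w \<in> L" for z w
    using per[of z w] that by (auto simp: g_def)
  have op: "open (- (L - {0}))"
    using closed_subset_L[of "L - {0}"] by (simp only: open_Compl Diff_subset)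
  have g0: "g holomorphic_on - (L - {0})"
  proof (rule no_isolated_singularity')
    show "(g \<longlongrightarrow> g z) (at z within - (L - {0}))" if "z \<in> {0}" for z
    proof -
      have "\<forall>\<^sub>F x in at 0. x \<in> - (L - {0}) - {0}"
        using op by (intro eventually_at_in_open) auto
      hence "\<forall>\<^sub>F x in at 0. f x = g x"
        by eventually_elim (auto simp: g_def)
      hence "(g \<longlongrightarrow> c) (at 0)"
        using lim by (rule Lim_transform_eventually[rotated])
      thus ?thesis using that by (auto simp: g_def intro: tendsto_within_subset)
    qed
    have "f holomorphic_on - (L - {0}) - {0}"
      using hol by (rule holomorphic_on_subset) auto
    thus "g holomorphic_on - (L - {0}) - {0}"
      by (rule holomorphic_transform) (auto simp: g_def)
  qed (use op in auto)
  have "g field_differentiable at z" for z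
  proof (cases "z \<in> L")
    case True
    have "(\<lambda>x. g (x - z)) field_differentiable at z"
    proof -
      have "g field_differentiable at (z - z)"
        using g0 op by (simp add: holomorphic_on_open field_differentiable_def)
      hence "(g \<circ> (\<lambda>x. x - z)) field_differentiable at z"
        by (intro field_differentiable_compose field_differentiable_diff) auto
      thus ?thesis by (simp add: o_def)
    qed
    also have "(\<lambda>x. g (x - z)) = g"
      using gper[of "-z"] True by (auto simp: fun_eq_iff)
    finally show ?thesis .
  next
    case False
    thus ?thesis
      using g0 op by (auto simp: holomorphic_on_open field_differentiable_def)
  qed
  hence ghol: "g holomorphic_on UNIV"
    by (simp add: holomorphic_on_def)
  define K where "K = (\<lambda>(a, b). complex_of_real a * w1 + complex_of_real b * w2) ` ({0..1} \<times> {0..1})"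
  have "compact K"
    unfolding K_def by (intro compact_continuous_image compact_Times)
      (auto intro!: continuous_intros simp: case_prod_unfold)
  hence "compact (g ` K)"
    using ghol by (intro compact_continuous_image) (auto intro: holomorphic_on_imp_continuous_on holomorphic_on_subset)
  moreover have "range g \<subseteq> g ` K"
  proof clarify
    fix z
    obtain w a b where w: "w \<in> L" "a \<in> {0..1}" "b \<in> {0..1}" "z = w + of_real a * w1 + of_real b * w2"
      by (rule fundamental_repr)
    have "g z = g (of_real a * w1 + of_real b * w2)"
      using gper[OF w(1), of "of_real a * w1 + of_real b * w2"] w(4) by (simp add: add_ac)
    thus "g z \<in> g ` K"
      using w(2,3) by (auto simp: K_def intro!: imageI image_eqI[of _ _ "(a, b)"])
  qed
  ultimately have "bounded (range g)"
    using compact_imp_bounded bounded_subset by blast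
  hence "g constant_on UNIV"
    using Liouville_theorem ghol by blast
  hence "g z = g 0" by (auto simp: constant_on_def)
  thus ?thesis using z by (simp add: g_def)
qed

end

section \<open>Local expansions at a double pole\<close>

lemma holomorphic_ball_factor_zero:
  assumes hol: "h holomorphic_on ball 0 r" and r: "r > 0" and h0: "h (0::complex) = 0"
  obtains g where "g holomorphic_on ball 0 r" "\<And>z. z \<in> ball 0 r \<Longrightarrow> h z = z * g z"
proof -
  define g where "g = (\<lambda>z. if z = 0 then deriv h 0 else h z / z)"
  have "(h has_field_derivative deriv h 0) (at 0)"
    using hol r by (intro holomorphic_derivI[of h "ball 0 r"]) auto
  hence "((\<lambda>z. h z / z) \<longlongrightarrow> deriv h 0) (at 0)"
    using h0 by (simp add: has_field_derivative_iff)
  hence "g holomorphic_on ball 0 r"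
    unfolding g_def using hol
    by (intro removable_singularity) (auto intro!: holomorphic_intros holomorphic_on_subset[OF hol])
  moreover have "h z = z * g z" for z
    using h0 by (simp add: g_def)
  ultimately show ?thesis using that by blast
qed

text \<open>The first quotient by \<open>z\<close> is odd, hence vanishes at 0 and can be divided by
  \<open>z\<close> again. Evenness of \<open>g\<close> belongs to the conclusion so that the
  extraction can be iterated.\<close>

lemma holomorphic_ball_even_factor:
  assumes hol: "h holomorphic_on ball 0 r" and r: "r > 0"
    and even: "\<And>z. z \<in> ball (0::complex) r \<Longrightarrow> h (- z) = h z"
  obtains g where "g holomorphic_on ball 0 r"
    "\<And>z. z \<in> ball 0 r \<Longrightarrow> h z = h 0 + z ^ 2 * g z"
    "\<And>z. z \<in> ball 0 r \<Longrightarrow> g (- z) = g z"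
proof -
  have "(\<lambda>z. h z - h 0) holomorphic_on ball 0 r"
    by (intro holomorphic_intros hol)
  then obtain g1 where g1: "g1 holomorphic_on ball 0 r"
    "\<And>z. z \<in> ball 0 r \<Longrightarrow> h z - h 0 = z * g1 z"
    using holomorphic_ball_factor_zero[of "\<lambda>z. h z - h 0" r] r by auto
  have odd: "g1 (- z) = - g1 z" if "z \<in> ball 0 r" "z \<noteq> 0" for z
  proof -
    have "z * g1 z = h z - h 0" using g1(2) that by simp
    also have "\<dots> = h (- z) - h 0" using even that by simp
    also have "\<dots> = - z * g1 (- z)" using g1(2)[of "- z"] that by simp
    finally have "z * g1 z = z * (- g1 (- z))" by simp
    hence "g1 z = - g1 (- z)" by (rule mult_left_cancel[OF that(2), THEN iffD1])
    thus ?thesis by simp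
  qed
  have "g1 0 = 0"
  proof -
    have cont: "isCont g1 0"
      using holomorphic_on_imp_continuous_on[OF g1(1)] r
      by (simp add: continuous_on_eq_continuous_at[OF open_ball])
    have 1: "(g1 \<longlongrightarrow> g1 0) (at 0)" using cont by (simp add: isCont_def)
    have "isCont (\<lambda>z. g1 (- z)) 0"
      by (rule isCont_o2[where g = g1 and f = uminus]) (use cont in auto)
    hence 2: "((\<lambda>z. g1 (- z)) \<longlongrightarrow> g1 0) (at 0)" by (simp add: isCont_def)
    have "eventually (\<lambda>z. z \<in> ball 0 r - {0}) (at (0::complex))"
      using r by (intro eventually_at_in_open) auto
    hence "eventually (\<lambda>z. g1 (- z) = - g1 z) (at 0)"
      by eventually_elim (use odd in auto)
    hence "((\<lambda>z. - g1 z) \<longlongrightarrow> g1 0) (at 0)"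
      using 2 by (rule Lim_transform_eventually[rotated])
    moreover have "((\<lambda>z. - g1 z) \<longlongrightarrow> - g1 0) (at 0)"
      using 1 by (rule tendsto_minus)
    ultimately have "g1 0 = - g1 0"
      by (rule LIM_unique)
    thus ?thesis by simp
  qed
  then obtain g2 where g2: "g2 holomorphic_on ball 0 r"
    "\<And>z. z \<in> ball 0 r \<Longrightarrow> g1 z = z * g2 z"
    using holomorphic_ball_factor_zero[OF g1(1)] r by auto
  show ?thesis
  proof (rule that[OF g2(1)])
    show "h z = h 0 + z ^ 2 * g2 z" if "z \<in> ball 0 r" for z
      using g1(2)[OF that] g2(2)[OF that] by (simp add: power2_eq_square algebra_simps)
    show "g2 (- z) = g2 z" if "z \<in> ball 0 r" for z
      using g2(2)[OF that] g2(2)[of "- z"] odd[OF that] that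
      by (cases "z = 0") auto
  qed
qed

text \<open>\<open>z ^ 2 * f z\<close> extends to an even function, which has no linear term; so
  there is no residue, and \<open>k\<close> is regular.\<close>

lemma even_double_pole:
  assumes hol: "f holomorphic_on ball 0 r - {0}" and r: "r > 0"
    and even: "\<And>z. z \<in> ball (0::complex) r - {0} \<Longrightarrow> f (- z) = f z"
    and lim: "((\<lambda>z. z ^ 2 * f z) \<longlongrightarrow> c) (at 0)"
  obtains k where "k holomorphic_on ball 0 r"
    "\<And>z. z \<in> ball 0 r - {0} \<Longrightarrow> f z = c / z ^ 2 + k z"
    "\<And>z. z \<in> ball 0 r \<Longrightarrow> k (- z) = k z"
proof -
  define A where "A = (\<lambda>z. if z = 0 then c else z ^ 2 * f z)"
  have "A holomorphic_on ball 0 r"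
    unfolding A_def by (intro removable_singularity holomorphic_intros hol lim) auto
  moreover have "A (- z) = A z" if "z \<in> ball 0 r" for z
    using even[of z] that by (auto simp: A_def)
  ultimately obtain k where k: "k holomorphic_on ball 0 r"
    "\<And>z. z \<in> ball 0 r \<Longrightarrow> A z = A 0 + z ^ 2 * k z"
    "\<And>z. z \<in> ball 0 r \<Longrightarrow> k (- z) = k z"
    using holomorphic_ball_even_factor[of A r] r by blast
  show ?thesis
  proof (rule that[OF k(1) _ k(3)])
    fix z :: complex assume z: "z \<in> ball 0 r - {0}"
    have "z ^ 2 * f z = c + z ^ 2 * k z"
      using k(2)[of z] z by (simp add: A_def)
    thus "f z = c / z ^ 2 + k z" using z by (simp add: field_simps)
  qed
qed

text \<open>The derivatives are passed as a tower \<open>D\<close> because the applications know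
  them as explicit series whose values at 0 can be computed one by one.\<close>

lemma taylor_zero_factor:
  fixes D :: "nat \<Rightarrow> complex \<Rightarrow> complex"
  assumes r: "r > 0" and hol: "D 0 holomorphic_on ball 0 r"
    and der: "\<And>i z. i < m \<Longrightarrow> z \<in> ball 0 r \<Longrightarrow> (D i has_field_derivative D (Suc i) z) (at z)"
    and zero: "\<And>i. i < m \<Longrightarrow> D i 0 = 0"
  obtains h where "h holomorphic_on ball 0 r" "\<And>z. z \<in> ball 0 r \<Longrightarrow> D 0 z = z ^ m * h z"
proof -
  have D: "(deriv ^^ i) (D 0) z = D i z" if "i \<le> m" "z \<in> ball 0 r" for i z
    using that
  proof (induction i arbitrary: z)
    case (Suc i)
    have "(deriv ^^ Suc i) (D 0) z = deriv ((deriv ^^ i) (D 0)) z" by simp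
    also have "\<dots> = deriv (D i) z"
      by (rule deriv_cong_ev)
         (use Suc in \<open>auto intro!: eventually_nhds_in_open eventually_mono[OF eventually_nhds_in_open[of "ball 0 r"]]\<close>)
    also have "\<dots> = D (Suc i) z"
      by (rule DERIV_imp_deriv, rule der) (use Suc in auto)
    finally show ?case .
  qed auto
  define c where "c = (\<lambda>n. (deriv ^^ n) (D 0) 0 / fact n)"
  have sums: "(\<lambda>n. c n * z ^ n) sums D 0 z" if "z \<in> ball 0 r" for z
    using holomorphic_power_series[OF hol that] by (simp add: c_def)
  have c0: "c i = 0" if "i < m" for i
    using D[of i 0] zero[of i] that r by (simp add: c_def)
  have sums': "(\<lambda>n. c (n + m) * z ^ (n + m)) sums D 0 z" if "z \<in> ball 0 r" for z
    using sums_split_initial_segment[OF sums[OF that], of m] c0 by simp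
  have summ: "summable (\<lambda>n. c (n + m) * z ^ n)" if "z \<in> ball 0 r" for z
  proof (cases "z = 0")
    case True
    show ?thesis unfolding True by (rule summable_finite[of "{0}"]) (auto simp: power_0_left)
  next
    case False
    have "summable (\<lambda>n. inverse (z ^ m) * (c (n + m) * z ^ (n + m)))"
      using sums'[OF that] by (intro summable_mult) (rule sums_summable)
    thus ?thesis using False by (simp add: power_add field_simps)
  qed
  define h where "h = (\<lambda>z. \<Sum>n. c (n + m) * z ^ n)"
  have "h holomorphic_on ball 0 r"
    by (rule power_series_holomorphic[where a = "\<lambda>n. c (n + m)"]) (use summ in \<open>auto simp: h_def summable_sums\<close>)
  moreover have "D 0 z = z ^ m * h z" if "z \<in> ball 0 r" for z
  proof -
    have "(\<lambda>n. z ^ m * (c (n + m) * z ^ n)) sums (z ^ m * h z)"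
      unfolding h_def by (intro sums_mult summable_sums summ that)
    hence "(\<lambda>n. c (n + m) * z ^ (n + m)) sums (z ^ m * h z)"
      by (simp add: power_add mult_ac)
    thus ?thesis using sums'[OF that] sums_unique2 by blast
  qed
  ultimately show ?thesis using that by blast
qed

text \<open>Liouville's theorem turns this limit into the Weierstrass equation, both for the lattice series and for the
  Tate series; the coefficients are \<open>g\<^sub>2 = 20 a\<close> and \<open>g\<^sub>3 = 28 b\<close>.\<close>
lemma weierstrass_ode_limit:
  fixes f f' h :: "complex \<Rightarrow> complex"
  assumes r: "r > 0" and h: "h holomorphic_on ball 0 r"
    and f: "\<And>z. z \<in> ball 0 r - {0} \<Longrightarrow> f z = 1 / z ^ 2 + a * z ^ 2 + b * z ^ 4 + z ^ 6 * h z"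
    and f': "\<And>z. z \<in> ball 0 r - {0} \<Longrightarrow> (f has_field_derivative f' z) (at z)"
  shows "((\<lambda>z. f' z ^ 2 - 4 * f z ^ 3 + 20 * a * f z + 28 * b) \<longlongrightarrow> 0) (at 0)"
proof -
  define h' where "h' = deriv h"
  have h': "(h has_field_derivative h' z) (at z)" if "z \<in> ball 0 r" for z
    unfolding h'_def using h that by (intro holomorphic_derivI) auto
  have f'_eq: "f' z = - 2 / z ^ 3 + 2 * a * z + 4 * b * z ^ 3 + 6 * z ^ 5 * h z + z ^ 6 * h' z"
    if z: "z \<in> ball 0 r - {0}" for z
  proof -
    have "((\<lambda>z. 1 / z ^ 2 + a * z ^ 2 + b * z ^ 4 + z ^ 6 * h z) has_field_derivative
       (- 2 / z ^ 3 + 2 * a * z + 4 * b * z ^ 3 + 6 * z ^ 5 * h z + z ^ 6 * h' z)) (at z)"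
      using z by (auto intro!: derivative_eq_intros h' simp: field_simps eval_nat_numeral)
    hence "(f has_field_derivative
       (- 2 / z ^ 3 + 2 * a * z + 4 * b * z ^ 3 + 6 * z ^ 5 * h z + z ^ 6 * h' z)) (at z)"
      by (rule has_field_derivative_transform_within_open[where S = "ball 0 r - {0}"]) (use z f in auto)
    thus ?thesis using DERIV_unique f'[OF z] by blast
  qed
  \<comment> \<open>The poles of order 6 cancel, and the terms in \<open>1 / z ^ 2\<close> and the
    constants add up to \<open>- 8 * a - 12 * a + 20 * a\<close> and
    \<open>- 16 * b - 12 * b + 28 * b\<close>; this is the origin of 20 and 28. What is left is
    \<open>E\<close>, which vanishes at 0.\<close>
  define E where "E = (\<lambda>z. (2 * a * z + 4 * b * z ^ 3 + 6 * z ^ 5 * h z + z ^ 6 * h' z) ^ 2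
      - 24 * z ^ 2 * h z - 4 * z ^ 3 * h' z - 12 * z ^ 2 * h z - 12 * (a * z + b * z ^ 3 + z ^ 5 * h z) ^ 2
      - 4 * (a * z ^ 2 + b * z ^ 4 + z ^ 6 * h z) ^ 3 + 20 * a * (a * z ^ 2 + b * z ^ 4 + z ^ 6 * h z))"
  have eq: "f' z ^ 2 - 4 * f z ^ 3 + 20 * a * f z + 28 * b = E z" if z: "z \<in> ball 0 r - {0}" for z
  proof -
    define x where "x = inverse z"
    have x: "x * z = 1" using z by (simp add: x_def)
    have 1: "f z = x ^ 2 + a * z ^ 2 + b * z ^ 4 + z ^ 6 * h z"
      using f[OF z] by (simp add: x_def field_simps)
    have 2: "f' z = - 2 * x ^ 3 + 2 * a * z + 4 * b * z ^ 3 + 6 * z ^ 5 * h z + z ^ 6 * h' z"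
      using f'_eq[OF z] by (simp add: x_def field_simps)
    show ?thesis
      unfolding 1 2 E_def using x by algebra
  qed
  have "isCont h 0" "isCont h' 0"
    using h r holomorphic_deriv[OF h] unfolding h'_def
    by (auto intro!: continuous_on_interior holomorphic_on_imp_continuous_on simp: interior_ball)
  hence "isCont E 0"
    unfolding E_def by (intro continuous_intros) auto
  hence "(E \<longlongrightarrow> 0) (at 0)" by (simp add: isCont_def E_def)
  moreover have "eventually (\<lambda>z. z \<in> ball 0 r - {0}) (at (0::complex))"
    using r by (intro eventually_at_in_open) auto
  hence "eventually (\<lambda>z. E z = f' z ^ 2 - 4 * f z ^ 3 + 20 * a * f z + 28 * b) (at 0)"
    by eventually_elim (use eq in auto)
  ultimately show ?thesis by (rule Lim_transform_eventually)
qed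

section \<open>Weierstrass zeta and elliptic functions\<close>

text \<open>Replaces integration: two functions with the same derivative off the poles are compared
  at one convenient point.\<close>

lemma connected_deriv_zero_eq:
  fixes f :: "complex \<Rightarrow> complex"
  assumes "connected S" "open S" "\<And>x. x \<in> S \<Longrightarrow> (f has_field_derivative 0) (at x)" "a \<in> S" "b \<in> S"
  shows "f a = f b"
proof -
  have "continuous_on S f"
    using assms(3) by (meson DERIV_isCont continuous_at_imp_continuous_on)
  then obtain c where "\<And>x. x \<in> S \<Longrightarrow> f x = c"
    using DERIV_zero_connected_constant[of S "{}" f] assms by blast
  thus ?thesis using assms(4,5) by simp
qed

section \<open>Lattice series along an enumeration and their termwise derivatives\<close>

context cplx_lattice
begin

text \<open>The enumeration that occurs in \<open>wsigma\<close>, so that the product needs no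
  rearrangement.\<close>

definition lat :: "nat \<Rightarrow> complex" where
  "lat n = from_nat_into (L - {0}) n"

lemma bij_lat: "bij_betw lat UNIV (L - {0})"
  using bij_betw_from_nat_into[of "L - {0}"] countable_L infinite_L unfolding lat_def by simp

lemma lat_mem: "lat n \<in> L" "lat n \<noteq> 0"
  using bij_lat by (auto simp: bij_betw_def)

lemma summable_lat: "summable (\<lambda>n. 1 / norm (lat n) ^ 3)"
proof -
  have "(\<lambda>n. 1 / norm (lat n) ^ 3) summable_on UNIV"
    using summable_norm_cube summable_on_reindex_bij_betw[OF bij_lat, of "\<lambda>w. 1 / norm w ^ 3"] by simp
  thus ?thesis by (rule summable_on_imp_summable)
qed

lemma eventually_lat_ge: "eventually (\<lambda>n. R \<le> norm (lat n)) sequentially"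
proof -
  have "finite (lat -` {w \<in> L. norm w \<le> R})"
    using bij_lat by (intro finite_vimageI finite_bounded_L) (auto simp: bij_betw_def)
  hence "finite {n. \<not> R \<le> norm (lat n)}"
    by (rule finite_subset[rotated]) (use lat_mem in auto)
  thus ?thesis
    by (simp add: MOST_iff_cofinite flip: cofinite_eq_sequentially)
qed

lemma filterlim_lat: "filterlim lat at_infinity sequentially"
  unfolding filterlim_at_infinity[OF order_refl]
  using eventually_lat_ge by blast

text \<open>Absolute convergence identifies the unordered sums in the definitions over the lattice
  with series, to which termwise differentiation applies.\<close>

lemma infsum_lat:
  fixes g :: "complex \<Rightarrow> complex"
  assumes "summable (\<lambda>n. norm (g (lat n)))"
  shows "g summable_on (L - {0})" "infsum g (L - {0}) = (\<Sum>n. g (lat n))"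
proof -
  have "((\<lambda>n. g (lat n)) has_sum (\<Sum>n. g (lat n))) UNIV"
    by (rule norm_summable_imp_has_sum[OF assms summable_sums[OF summable_norm_cancel[OF assms]]])
  hence "(g has_sum (\<Sum>n. g (lat n))) (L - {0})"
    using has_sum_reindex_bij_betw[OF bij_lat, of g] by simp
  thus "g summable_on (L - {0})" "infsum g (L - {0}) = (\<Sum>n. g (lat n))"
    by (auto simp: has_sum_iff)
qed

lemma open_regular: "open (- (L - {0}))" and open_punctured: "open (- L)"
  using closed_subset_L[of "L - {0}"] closed_subset_L[of L] by (simp_all only: open_Compl Diff_subset)

lemma eventually_notin_L: "eventually (\<lambda>x. x \<notin> L) (at z)"
proof -
  have "open (- (L - {z}))"
    using closed_subset_L[of "L - {z}"] by (simp only: open_Compl Diff_subset)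
  hence "eventually (\<lambda>x. x \<in> - (L - {z}) - {z}) (at z)"
    by (intro eventually_at_in_open) auto
  thus ?thesis by eventually_elim auto
qed

text \<open>Domination by \<open>C / |w|\<^sup>3\<close> uniformly on discs, for all but finitely many terms: the tail condition that makes
  all series over the lattice differentiable term by term.\<close>
definition cube_dominated :: "(nat \<Rightarrow> complex \<Rightarrow> complex) \<Rightarrow> bool" where
  "cube_dominated f \<longleftrightarrow> (\<forall>R>0. \<exists>C. \<forall>\<^sub>F n in sequentially. \<forall>y. norm y \<le> R \<longrightarrow>
     norm (f n y) \<le> C * (1 / norm (lat n) ^ 3))"

lemma cube_dominated_summable:
  assumes "cube_dominated f"
  shows "summable (\<lambda>n. norm (f n y))"
proof -
  obtain C where C: "\<forall>\<^sub>F n in sequentially. \<forall>x. norm x \<le> norm y + 1 \<longrightarrow>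
     norm (f n x) \<le> C * (1 / norm (lat n) ^ 3)"
    using assms unfolding cube_dominated_def by (meson add_nonneg_pos norm_ge_zero zero_less_one)
  have "\<forall>\<^sub>F n in sequentially. norm (norm (f n y)) \<le> C * (1 / norm (lat n) ^ 3)"
    using C by eventually_elim auto
  thus ?thesis
    by (rule summable_comparison_test_ev) (intro summable_mult summable_lat)
qed

text \<open>For holomorphic terms, locally uniform convergence passes to the derivatives, so only
  the terms themselves need a bound. The origin lies in the domain because the lattice point 0 is
  not enumerated by \<open>lat\<close>.\<close>

lemma cube_dominated_deriv:
  assumes dom: "cube_dominated f"
    and der: "\<And>n x. x \<in> - (L - {0}) \<Longrightarrow> (f n has_field_derivative f' n x) (at x)"
    and x: "x \<in> - (L - {0})"
  shows "((\<lambda>x. \<Sum>n. f n x) has_field_derivative (\<Sum>n. f' n x)) (at x)"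
proof -
  have "\<exists>g g'. \<forall>x \<in> - (L - {0}). ((\<lambda>n. f n x) sums g x) \<and> ((\<lambda>n. f' n x) sums g' x) \<and>
      (g has_field_derivative g' x) (at x)"
  proof (rule series_and_derivative_comparison_local[OF open_regular der])
    fix x :: complex
    obtain C where C: "\<forall>\<^sub>F n in sequentially. \<forall>y. norm y \<le> norm x + 1 \<longrightarrow>
       norm (f n y) \<le> C * (1 / norm (lat n) ^ 3)"
      using dom unfolding cube_dominated_def by (meson add_nonneg_pos norm_ge_zero zero_less_one)
    have "\<forall>\<^sub>F n in sequentially. \<forall>y\<in>ball x 1 \<inter> - (L - {0}). norm (f n y) \<le> C * (1 / norm (lat n) ^ 3)"
      using C
    proof eventually_elim
      case (elim n)
      have "norm y \<le> norm x + 1" if "y \<in> ball x 1" for y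
        using that norm_triangle_ineq2[of y x] by (simp add: dist_norm norm_minus_commute)
      thus ?case using elim by auto
    qed
    thus "\<exists>d h. 0 < d \<and> summable h \<and> (\<forall>\<^sub>F n in sequentially. \<forall>y\<in>ball x d \<inter> - (L - {0}). norm (f n y) \<le> h n)"
      by (intro exI[of _ 1] exI[of _ "\<lambda>n. C * (1 / norm (lat n) ^ 3)"] conjI summable_mult summable_lat) auto
  qed auto
  then obtain g g' where g: "\<And>x. x \<in> - (L - {0}) \<Longrightarrow> ((\<lambda>n. f n x) sums g x) \<and> ((\<lambda>n. f' n x) sums g' x) \<and>
      (g has_field_derivative g' x) (at x)"
    by blast
  have "((\<lambda>x. \<Sum>n. f n x) has_field_derivative g' x) (at x)"
    by (rule has_field_derivative_transform_within_open[where S = "- (L - {0})" and f = g])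
       (use g x open_regular in \<open>auto simp: sums_iff\<close>)
  thus ?thesis using g[OF x] by (simp add: sums_iff)
qed

lemma norm_diff_lat_ge:
  assumes "norm y \<le> R" "2 * R \<le> norm (w::complex)"
  shows "norm w / 2 \<le> norm (y - w)"
  using assms norm_triangle_ineq2[of w y] by (simp add: norm_minus_commute)

lemma cube_dominated_zeta: "cube_dominated (\<lambda>n z. 1 / (z - lat n) + 1 / lat n + z / lat n ^ 2)"
  unfolding cube_dominated_def
proof (intro allI impI)
  fix R :: real assume R: "R > 0"
  have "\<forall>\<^sub>F n in sequentially. \<forall>y. norm y \<le> R \<longrightarrow>
     norm (1 / (y - lat n) + 1 / lat n + y / lat n ^ 2) \<le> (2 * R ^ 2) * (1 / norm (lat n) ^ 3)"
    using eventually_lat_ge[of "2 * R"]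
  proof eventually_elim
    case (elim n)
    show ?case
    proof clarify
      fix y :: complex assume y: "norm y \<le> R"
      define w where "w = lat n"
      have w: "w \<noteq> 0" "norm w > 0" using lat_mem by (auto simp: w_def)
      have ge: "norm w / 2 \<le> norm (y - w)"
        using norm_diff_lat_ge[OF y] elim by (simp add: w_def)
      hence ne: "y - w \<noteq> 0" using w by auto
      \<comment> \<open>The two correction terms cancel the expansion of \<open>1 / (y - w)\<close>
        up to first order in \<open>y\<close>, which leaves cubic decay in \<open>w\<close>.\<close>
      have "1 / (y - w) + 1 / w + y / w ^ 2 = y ^ 2 / (w ^ 2 * (y - w))"
        using w ne by (simp add: divide_simps) (simp add: algebra_simps power2_eq_square)
      hence "norm (1 / (y - w) + 1 / w + y / w ^ 2) = norm y ^ 2 / (norm w ^ 2 * norm (y - w))"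
        by (simp add: norm_divide norm_mult norm_power)
      also have "\<dots> \<le> R ^ 2 / (norm w ^ 2 * (norm w / 2))"
        using ge y w by (intro frac_le power_mono mult_left_mono) auto
      also have "\<dots> = (2 * R ^ 2) * (1 / norm w ^ 3)"
        by (simp add: field_simps eval_nat_numeral)
      finally show "norm (1 / (y - lat n) + 1 / lat n + y / lat n ^ 2) \<le> (2 * R ^ 2) * (1 / norm (lat n) ^ 3)"
        by (simp add: w_def)
    qed
  qed
  thus "\<exists>C. \<forall>\<^sub>F n in sequentially. \<forall>y. norm y \<le> R \<longrightarrow>
     norm (1 / (y - lat n) + 1 / lat n + y / lat n ^ 2) \<le> C * (1 / norm (lat n) ^ 3)" by blast
qed

lemma cube_dominated_wp: "cube_dominated (\<lambda>n z. 1 / (z - lat n) ^ 2 - 1 / lat n ^ 2)"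
  unfolding cube_dominated_def
proof (intro allI impI)
  fix R :: real assume R: "R > 0"
  have "\<forall>\<^sub>F n in sequentially. \<forall>y. norm y \<le> R \<longrightarrow>
     norm (1 / (y - lat n) ^ 2 - 1 / lat n ^ 2) \<le> (12 * R) * (1 / norm (lat n) ^ 3)"
    using eventually_lat_ge[of "2 * R"]
  proof eventually_elim
    case (elim n)
    show ?case
    proof clarify
      fix y :: complex assume y: "norm y \<le> R"
      define w where "w = lat n"
      have w: "w \<noteq> 0" "norm w > 0" using lat_mem by (auto simp: w_def)
      have ge: "norm w / 2 \<le> norm (y - w)"
        using norm_diff_lat_ge[OF y] elim by (simp add: w_def)
      hence ne: "y - w \<noteq> 0" using w by auto
      have "1 / (y - w) ^ 2 - 1 / w ^ 2 = y * (2 * w - y) / (w ^ 2 * (y - w) ^ 2)"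
        using w ne by (simp add: divide_simps) (simp add: algebra_simps power2_eq_square)
      hence "norm (1 / (y - w) ^ 2 - 1 / w ^ 2) = norm y * norm (2 * w - y) / (norm w ^ 2 * norm (y - w) ^ 2)"
        by (simp add: norm_divide norm_mult norm_power)
      also have "\<dots> \<le> R * (3 * norm w) / (norm w ^ 2 * (norm w / 2) ^ 2)"
      proof (intro frac_le mult_mono power_mono)
        have "norm (2 * w - y) \<le> norm (2 * w) + norm y" by (rule norm_triangle_ineq4)
        also have "\<dots> \<le> 3 * norm w" using elim R y by (simp add: norm_mult w_def)
        finally show "norm (2 * w - y) \<le> 3 * norm w" .
      qed (use ge y w R in auto)
      also have "\<dots> = (12 * R) * (1 / norm w ^ 3)"
        using w by (simp add: field_simps eval_nat_numeral)
      finally show "norm (1 / (y - lat n) ^ 2 - 1 / lat n ^ 2) \<le> (12 * R) * (1 / norm (lat n) ^ 3)"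
        by (simp add: w_def)
    qed
  qed
  thus "\<exists>C. \<forall>\<^sub>F n in sequentially. \<forall>y. norm y \<le> R \<longrightarrow>
     norm (1 / (y - lat n) ^ 2 - 1 / lat n ^ 2) \<le> C * (1 / norm (lat n) ^ 3)" by blast
qed

lemma cube_dominated_power:
  assumes "j \<ge> 3"
  shows "cube_dominated (\<lambda>n z. c / (z - lat n) ^ j)"
  unfolding cube_dominated_def
proof (intro allI impI)
  fix R :: real assume R: "R > 0"
  have "\<forall>\<^sub>F n in sequentially. \<forall>y. norm y \<le> R \<longrightarrow>
     norm (c / (y - lat n) ^ j) \<le> (norm c * 2 ^ j) * (1 / norm (lat n) ^ 3)"
    using eventually_lat_ge[of "2 * R"] eventually_lat_ge[of 1]
  proof eventually_elim
    case (elim n)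
    show ?case
    proof clarify
      fix y :: complex assume y: "norm y \<le> R"
      define w where "w = lat n"
      have w: "w \<noteq> 0" "norm w > 0" using lat_mem by (auto simp: w_def)
      have ge: "norm w / 2 \<le> norm (y - w)"
        using norm_diff_lat_ge[OF y] elim by (simp add: w_def)
      have "norm (c / (y - w) ^ j) = norm c / norm (y - w) ^ j"
        by (simp add: norm_divide norm_power)
      also have "\<dots> \<le> norm c / (norm w / 2) ^ j"
        using ge w by (intro frac_le power_mono) auto
      also have "\<dots> = (norm c * 2 ^ j) * (1 / norm w ^ j)"
        by (simp add: power_divide)
      also have "\<dots> \<le> (norm c * 2 ^ j) * (1 / norm w ^ 3)"
        using elim assms w by (intro mult_left_mono frac_le power_increasing) (auto simp: w_def)
      finally show "norm (c / (y - lat n) ^ j) \<le> (norm c * 2 ^ j) * (1 / norm (lat n) ^ 3)"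
        by (simp add: w_def)
    qed
  qed
  thus "\<exists>C. \<forall>\<^sub>F n in sequentially. \<forall>y. norm y \<le> R \<longrightarrow>
     norm (c / (y - lat n) ^ j) \<le> C * (1 / norm (lat n) ^ 3)" by blast
qed

section \<open>Regular parts at the origin and their derivatives\<close>

definition zeta_reg :: "complex \<Rightarrow> complex" where
  "zeta_reg z = (\<Sum>n. 1 / (z - lat n) + 1 / lat n + z / lat n ^ 2)"

definition zeta :: "complex \<Rightarrow> complex" where
  "zeta z = 1 / z + zeta_reg z"

definition wp_reg :: "complex \<Rightarrow> complex" where
  "wp_reg z = (\<Sum>n. 1 / (z - lat n) ^ 2 - 1 / lat n ^ 2)"

text \<open>The case \<open>i = 0\<close> is separate because only the undifferentiated series
  carries the convergence terms \<open>1 / lat n ^ 2\<close>.\<close>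

definition wp_reg_deriv :: "nat \<Rightarrow> complex \<Rightarrow> complex" where
  "wp_reg_deriv i z = (if i = 0 then wp_reg z else (\<Sum>n. (-1) ^ i * fact (Suc i) / (z - lat n) ^ (i + 2)))"

lemma regular_lat_neq: "x \<in> - (L - {0}) \<Longrightarrow> x \<noteq> lat n"
  using lat_mem by auto

lemma zeta_reg_deriv:
  assumes "z \<in> - (L - {0})"
  shows "(zeta_reg has_field_derivative - wp_reg z) (at z)"
proof -
  have "((\<lambda>z. \<Sum>n. 1 / (z - lat n) + 1 / lat n + z / lat n ^ 2) has_field_derivative
     (\<Sum>n. - (1 / (z - lat n) ^ 2 - 1 / lat n ^ 2))) (at z)"
    by (rule cube_dominated_deriv[OF cube_dominated_zeta _ assms])
       (use regular_lat_neq lat_mem in \<open>auto intro!: derivative_eq_intros simp: power2_eq_square\<close>)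
  also have "(\<Sum>n. - (1 / (z - lat n) ^ 2 - 1 / lat n ^ 2)) = - wp_reg z"
    unfolding wp_reg_def
    by (rule suminf_minus[OF summable_norm_cancel[OF cube_dominated_summable[OF cube_dominated_wp]]])
  finally show ?thesis by (simp add: zeta_reg_def[abs_def])
qed

lemma wp_reg_has_deriv:
  assumes "z \<in> - (L - {0})"
  shows "(wp_reg_deriv i has_field_derivative wp_reg_deriv (Suc i) z) (at z)"
proof (cases "i = 0")
  case True
  have "((\<lambda>z. \<Sum>n. 1 / (z - lat n) ^ 2 - 1 / lat n ^ 2) has_field_derivative
     (\<Sum>n. (-1) ^ Suc 0 * fact (Suc (Suc 0)) / (z - lat n) ^ (Suc 0 + 2))) (at z)"
  proof (rule cube_dominated_deriv[OF cube_dominated_wp _ assms])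
    fix n x assume x: "x \<in> - (L - {0})"
    define y where "y = x - lat n"
    have y: "y \<noteq> 0" using regular_lat_neq[OF x] by (simp add: y_def)
    have "((\<lambda>x. 1 / (x - lat n) ^ 2 - 1 / lat n ^ 2) has_field_derivative - (2 * y) / (y ^ 2 * y ^ 2)) (at x)"
      using y by (auto intro!: derivative_eq_intros simp: y_def)
    also have "- (2 * y) / (y ^ 2 * y ^ 2) = (-1) ^ Suc 0 * fact (Suc (Suc 0)) / y ^ (Suc 0 + 2)"
      using y by (simp add: field_simps eval_nat_numeral)
    finally show "((\<lambda>x. 1 / (x - lat n) ^ 2 - 1 / lat n ^ 2) has_field_derivative
       (-1) ^ Suc 0 * fact (Suc (Suc 0)) / (x - lat n) ^ (Suc 0 + 2)) (at x)" by (simp only: y_def)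
  qed
  thus ?thesis using True by (simp add: wp_reg_deriv_def[abs_def] wp_reg_def[abs_def])
next
  case False
  define c where "c = ((-1) ^ i * fact (Suc i) :: complex)"
  have "((\<lambda>z. \<Sum>n. c / (z - lat n) ^ (i + 2)) has_field_derivative
     (\<Sum>n. (-1) ^ Suc i * fact (Suc (Suc i)) / (z - lat n) ^ (Suc i + 2))) (at z)"
  proof (rule cube_dominated_deriv[OF cube_dominated_power _ assms])
    fix n x assume x: "x \<in> - (L - {0})"
    have ne: "x - lat n \<noteq> 0" using regular_lat_neq[OF x] by simp
    have 1: "((\<lambda>z. (z - lat n) ^ (i + 2)) has_field_derivative of_nat (i + 2) * (x - lat n) ^ (i + 1)) (at x)"
      by (rule DERIV_cong[OF DERIV_power[OF DERIV_diff[OF DERIV_ident DERIV_const]]]) simp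
    have "((\<lambda>z. c / (z - lat n) ^ (i + 2)) has_field_derivative
       (0 * (x - lat n) ^ (i + 2) - c * (of_nat (i + 2) * (x - lat n) ^ (i + 1))) / ((x - lat n) ^ (i + 2) * (x - lat n) ^ (i + 2))) (at x)"
      using ne by (intro DERIV_divide 1 DERIV_const) auto
    also have "(0 * (x - lat n) ^ (i + 2) - c * (of_nat (i + 2) * (x - lat n) ^ (i + 1))) / ((x - lat n) ^ (i + 2) * (x - lat n) ^ (i + 2))
       = (-1) ^ Suc i * fact (Suc (Suc i)) / (x - lat n) ^ (Suc i + 2)"
    proof -
      have "fact (Suc (Suc i)) = of_nat (i + 2) * (fact (Suc i) :: complex)"
        by (subst fact_Suc) simp
      thus ?thesis
        using ne by (simp add: c_def divide_simps del: fact_Suc of_nat_add)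
    qed
    finally show "((\<lambda>z. c / (z - lat n) ^ (i + 2)) has_field_derivative
       (-1) ^ Suc i * fact (Suc (Suc i)) / (x - lat n) ^ (Suc i + 2)) (at x)" .
  qed (use False in auto)
  thus ?thesis
    using False unfolding c_def wp_reg_deriv_def[abs_def] by (simp only: if_False nat.distinct)
qed

lemma wp_eq: "wp L z = 1 / z ^ 2 + wp_reg z"
  using infsum_lat(2)[OF cube_dominated_summable[OF cube_dominated_wp, of z]]
  by (simp add: wp_def wp_reg_def)

lemma wp_deriv_eq:
  assumes "z \<notin> L"
  shows "wp_deriv L z = - 2 / z ^ 3 + wp_reg_deriv 1 z"
proof -
  note dom = cube_dominated_power[of 3 1]
  note sm = infsum_lat[OF cube_dominated_summable[OF dom, of z, simplified]]
  have "infsum (\<lambda>w. 1 / (z - w) ^ 3) L = infsum (\<lambda>w. 1 / (z - w) ^ 3) (insert 0 (L - {0}))"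
    by (simp add: insert_absorb)
  also have "\<dots> = 1 / z ^ 3 + infsum (\<lambda>w. 1 / (z - w) ^ 3) (L - {0})"
    by (subst infsum_insert) (use sm in auto)
  also have "infsum (\<lambda>w. 1 / (z - w) ^ 3) (L - {0}) = (\<Sum>n. 1 / (z - lat n) ^ 3)"
    by (rule sm)
  finally have "wp_deriv L z = - 2 / z ^ 3 + (-2) * (\<Sum>n. 1 / (z - lat n) ^ 3)"
    by (simp add: wp_deriv_def algebra_simps)
  also have "(-2) * (\<Sum>n. 1 / (z - lat n) ^ 3) = (\<Sum>n. (-2) * (1 / (z - lat n) ^ 3))"
    by (rule suminf_mult[symmetric])
       (rule summable_norm_cancel, use cube_dominated_summable[OF dom, of z] in simp)
  finally show ?thesis by (simp add: wp_reg_deriv_def eval_nat_numeral)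
qed

lemma wp_has_deriv:
  assumes "z \<notin> L"
  shows "(wp L has_field_derivative wp_deriv L z) (at z)"
proof -
  have z: "z \<in> - (L - {0})" "z \<noteq> 0" using assms by auto
  have [derivative_intros]: "(wp_reg has_field_derivative wp_reg_deriv 1 z) (at z)"
    using wp_reg_has_deriv[OF z(1), of 0] by (simp add: wp_reg_deriv_def[of 0, abs_def])
  have "((\<lambda>z. 1 / z ^ 2 + wp_reg z) has_field_derivative - 2 / z ^ 3 + wp_reg_deriv 1 z) (at z)"
    using z by (auto intro!: derivative_eq_intros simp: field_simps eval_nat_numeral)
  thus ?thesis
    using assms by (simp add: wp_eq[abs_def] wp_deriv_eq)
qed

lemma wp_holomorphic: "wp L holomorphic_on - L"
  using wp_has_deriv open_punctured by (auto simp: holomorphic_on_open)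

lemma zeta_has_deriv:
  assumes "z \<notin> L"
  shows "(zeta has_field_derivative - wp L z) (at z)"
proof -
  have z: "z \<in> - (L - {0})" "z \<noteq> 0" using assms by auto
  note [derivative_intros] = zeta_reg_deriv[OF z(1)]
  show ?thesis
    unfolding zeta_def[abs_def] wp_eq
    using z by (auto intro!: derivative_eq_intros simp: power2_eq_square)
qed

section \<open>Parity and periodicity\<close>

lemma wp_even: "wp L (- z) = wp L z"
proof -
  have "infsum (\<lambda>w. 1 / (- z - w) ^ 2 - 1 / w ^ 2) (L - {0}) = infsum (\<lambda>w. 1 / (z - w) ^ 2 - 1 / w ^ 2) (L - {0})"
    by (rule infsum_reindex_bij_witness[of _ uminus uminus]) (auto simp: power2_eq_square algebra_simps)
  thus ?thesis by (simp add: wp_def)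
qed

lemma wp_deriv_odd: "wp_deriv L (- z) = - wp_deriv L z"
proof -
  have "infsum (\<lambda>w. 1 / (- z - w) ^ 3) L = infsum (\<lambda>w. - (1 / (z - w) ^ 3)) L"
  proof (rule infsum_reindex_bij_witness[of _ uminus uminus])
    fix w :: complex
    have "(- z - w) ^ 3 = - ((z - (- w)) ^ 3)" by (simp add: eval_nat_numeral algebra_simps)
    thus "- (1 / (z - - w) ^ 3) = 1 / (- z - w) ^ 3" by simp
  qed auto
  thus ?thesis by (simp add: wp_deriv_def infsum_uminus)
qed

lemma wp_deriv_periodic:
  assumes "w \<in> L"
  shows "wp_deriv L (z + w) = wp_deriv L z"
proof -
  have "infsum (\<lambda>v. 1 / (z + w - v) ^ 3) L = infsum (\<lambda>v. 1 / (z - v) ^ 3) L"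
    by (rule infsum_reindex_bij_witness[of _ "\<lambda>v. v + w" "\<lambda>v. v - w"]) (use assms in \<open>auto simp: algebra_simps\<close>)
  thus ?thesis by (simp add: wp_deriv_def)
qed

lemma connected_punctured: "connected (- L)"
  using connected_open_diff_countable[of UNIV L] countable_L connected_UNIV
  by (simp add: Compl_eq_Diff_UNIV)

text \<open>The derivative is visibly periodic, so \<open>wp L (z + w) - wp L z\<close> is constant
  in \<open>z\<close>; at \<open>z = - w / 2\<close> it vanishes by evenness. This needs
  \<open>w / 2\<close> to lie off the lattice. Otherwise \<open>(w - w1) / 2\<close> does, and the
  translation is made in two steps, by \<open>w1\<close> and by \<open>w - w1\<close>.\<close>

lemma wp_periodic:
  assumes w: "w \<in> L" and z: "z \<notin> L"
  shows "wp L (z + w) = wp L z"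
proof -
  have half: "wp L (z + w) = wp L z" if w: "w \<in> L" "w / 2 \<notin> L" and z: "z \<notin> L" for w z
  proof -
    have "((\<lambda>x. wp L (x + w) - wp L x) has_field_derivative 0) (at x)" if "x \<in> - L" for x
    proof -
      have "x + w \<notin> L" using that w by simp
      hence "((\<lambda>x. wp L (x + w)) has_field_derivative wp_deriv L (x + w)) (at x)"
        by (rule DERIV_shift[THEN iffD1, OF wp_has_deriv])
      hence "((\<lambda>x. wp L (x + w) - wp L x) has_field_derivative wp_deriv L (x + w) - wp_deriv L x) (at x)"
        by (intro DERIV_diff wp_has_deriv) (use that in auto)
      thus ?thesis using wp_deriv_periodic[OF w(1)] by simp
    qed
    hence "wp L (z + w) - wp L z = wp L (- (w / 2) + w) - wp L (- (w / 2))"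
      by (rule connected_deriv_zero_eq[OF connected_punctured open_punctured]) (use w z in auto)
    also have "- (w / 2) + w = w / 2" by simp
    finally show ?thesis by (simp add: wp_even)
  qed
  show ?thesis
  proof (cases "w / 2 \<in> L")
    case True
    have "(w - w1) / 2 \<notin> L"
      using half_period_notin(1) True diff_mem[of "w / 2" "(w - w1) / 2"] by (auto simp: field_simps)
    hence "wp L (z + w1 + (w - w1)) = wp L (z + w1)"
      using w z by (intro half) (auto intro: diff_mem)
    also have "\<dots> = wp L z"
      using half_period_notin(1) z by (intro half) auto
    finally show ?thesis by simp
  qed (use half w z in auto)
qed

end

section \<open>The sigma function and the differential equation\<close>

context cplx_lattice
begin

lemma weierstrass_product_lat: "weierstrass_product lat (\<lambda>_. 2)"
proof
  show "summable (\<lambda>n. (r / norm (lat n)) ^ Suc 2)" for r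
    using summable_mult[OF summable_lat, of "r ^ 3"] by (simp add: power_divide eval_nat_numeral)
qed (use lat_mem filterlim_lat in auto)

interpretation sp: weierstrass_product lat "\<lambda>_. 2"
  by (rule weierstrass_product_lat)

lemma wsigma_eq: "wsigma L z = z * sp.f z"
proof -
  have "(\<Sum>k=1..2. x ^ k / of_nat k) = x + x ^ 2 / 2" for x :: complex
    by (simp add: numeral_2_eq_2)
  thus ?thesis
    by (simp only: wsigma_def sp.f_def weierstrass_factor_def Let_def lat_def)
qed

lemma wsigma_holomorphic [holomorphic_intros]: "wsigma L holomorphic_on A"
  unfolding wsigma_eq[abs_def] by (intro holomorphic_intros sp.holomorphic)

lemma wsigma_zero_iff: "wsigma L z = 0 \<longleftrightarrow> z \<in> L"
  using sp.zero[of z] bij_lat by (auto simp: wsigma_eq bij_betw_def)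

lemma isCont_wsigma: "isCont (wsigma L) z"
  by (meson UNIV_I continuous_on_eq_continuous_at holomorphic_on_imp_continuous_on open_UNIV wsigma_holomorphic)

lemma wsigma_div_lim: "((\<lambda>z. wsigma L z / z) \<longlongrightarrow> 1) (at 0)"
proof -
  have "sp.f 0 = 1" by (simp add: sp.f_def)
  moreover have "isCont sp.f 0"
    using holomorphic_on_imp_continuous_on[OF sp.holomorphic[of UNIV]]
    by (simp add: continuous_on_eq_continuous_at[OF open_UNIV])
  ultimately have "(sp.f \<longlongrightarrow> 1) (at 0)" by (simp add: isCont_def)
  thus ?thesis
    by (rule Lim_transform_eventually) (auto simp: wsigma_eq eventually_at_filter)
qed

text \<open>The partial products converge uniformly on discs, so the logarithmic derivative may be
  taken factor by factor. Each factor contributes one term of \<open>zeta_reg\<close>, and the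
  leading \<open>z\<close> contributes \<open>1 / z\<close>.\<close>

lemma wsigma_has_deriv:
  assumes "z \<notin> L"
  shows "(wsigma L has_field_derivative wsigma L z * zeta z) (at z)"
proof -
  have z: "z \<noteq> 0" "z \<in> - (L - {0})" using assms by auto
  have fnz: "sp.f z \<noteq> 0" using assms wsigma_zero_iff[of z] by (auto simp: wsigma_eq)
  define R where "R = norm z + 1"
  have R: "R > 0" by (simp add: R_def add_nonneg_pos)
  have "(\<lambda>k. deriv (\<lambda>z. weierstrass_factor 2 (z / lat k)) z / weierstrass_factor 2 (z / lat k)) sums (deriv sp.f z / sp.f z)"
  proof (rule logderiv_prodinf_complex_uniform_limit[where A = "ball 0 R"])
    show "uniform_limit (ball 0 R) (\<lambda>n x. \<Prod>k<n. weierstrass_factor 2 (x / lat k)) sp.f sequentially"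
      using sp.uniform_limit[OF R] by (rule uniform_limit_on_subset) auto
  qed (use fnz lat_mem in \<open>auto simp: R_def intro!: holomorphic_intros\<close>)
  also have "(\<lambda>k. deriv (\<lambda>z. weierstrass_factor 2 (z / lat k)) z / weierstrass_factor 2 (z / lat k)) =
     (\<lambda>k. 1 / (z - lat k) + 1 / lat k + z / lat k ^ 2)"
  proof
    fix k
    define w where "w = lat k"
    have w: "w \<noteq> 0" "z - w \<noteq> 0"
      using regular_lat_neq[OF z(2)] lat_mem by (auto simp: w_def)
    have nz: "1 - z / w \<noteq> 0" using w by (auto simp: field_simps)
    have sum2: "(\<Sum>k=1..2. x ^ k / of_nat k) = x + x ^ 2 / 2" for x :: complex
      by (simp add: numeral_2_eq_2)
    have wf: "weierstrass_factor 2 x = (1 - x) * exp (x + x ^ 2 / 2)" for x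
      by (simp only: weierstrass_factor_def sum2)
    have "((\<lambda>z. weierstrass_factor 2 (z / w)) has_field_derivative
        (- (1 / w) * exp (z / w + (z / w) ^ 2 / 2) + (1 - z / w) * (exp (z / w + (z / w) ^ 2 / 2) * (1 / w + (z / w) * (1 / w))))) (at z)"
      unfolding wf using w by (auto intro!: derivative_eq_intros simp: power2_eq_square)
    hence d: "deriv (\<lambda>z. weierstrass_factor 2 (z / w)) z =
       (- (1 / w) * exp (z / w + (z / w) ^ 2 / 2) + (1 - z / w) * (exp (z / w + (z / w) ^ 2 / 2) * (1 / w + (z / w) * (1 / w))))"
      by (rule DERIV_imp_deriv)
    have "deriv (\<lambda>z. weierstrass_factor 2 (z / w)) z / weierstrass_factor 2 (z / w)
       = - (1 / w) / (1 - z / w) + (1 / w + (z / w) * (1 / w))"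
    proof -
      have *: "(c * e + a * (e * b)) / (a * e) = c / a + b" if "a \<noteq> 0" "e \<noteq> 0" for a b c e :: complex
        using that by (simp add: field_simps)
      show ?thesis unfolding d unfolding wf by (rule *) (use nz in auto)
    qed
    also have "- (1 / w) / (1 - z / w) = 1 / (z - w)"
    proof -
      have "1 - z / w = - ((z - w) / w)" using w by (simp add: field_simps)
      thus ?thesis using w by (simp only: divide_minus_right minus_divide_left) (simp add: divide_simps)
    qed
    also have "1 / (z - w) + (1 / w + (z / w) * (1 / w)) = 1 / (z - w) + 1 / w + z / w ^ 2"
      by (simp add: power2_eq_square)
    finally show "deriv (\<lambda>z. weierstrass_factor 2 (z / lat k)) z / weierstrass_factor 2 (z / lat k) =
      1 / (z - lat k) + 1 / lat k + z / lat k ^ 2" by (simp add: w_def)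
  qed
  finally have "deriv sp.f z / sp.f z = zeta_reg z"
    by (simp add: zeta_reg_def sums_iff)
  hence d: "deriv sp.f z = sp.f z * zeta_reg z" using fnz by (simp add: field_simps)
  have "(sp.f has_field_derivative deriv sp.f z) (at z)"
    by (rule holomorphic_derivI[OF sp.holomorphic open_UNIV]) auto
  hence "((\<lambda>z. z * sp.f z) has_field_derivative (1 * sp.f z + deriv sp.f z * z)) (at z)"
    by (intro DERIV_mult DERIV_ident)
  also have "1 * sp.f z + deriv sp.f z * z = wsigma L z * zeta z"
    using z by (simp add: wsigma_eq zeta_def d field_simps)
  finally show ?thesis by (simp add: wsigma_eq[abs_def])
qed

lemma wp_reg_even: "wp_reg (- z) = wp_reg z"
  using wp_even[of z] by (simp add: wp_eq)

lemma connected_regular: "connected (- (L - {0}))"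
  using connected_open_diff_countable[of UNIV "L - {0}"] countable_L connected_UNIV
  by (simp add: Compl_eq_Diff_UNIV)

text \<open>The regular part is used because its domain contains 0, where its value fixes the
  integration constant.\<close>

lemma zeta_reg_odd:
  assumes "z \<in> - (L - {0})"
  shows "zeta_reg (- z) = - zeta_reg z"
proof -
  have "((\<lambda>x. zeta_reg (- x) + zeta_reg x) has_field_derivative 0) (at x)" if x: "x \<in> - (L - {0})" for x
  proof -
    have x': "- x \<in> - (L - {0})" using x by auto
    have "((\<lambda>x. zeta_reg (- x)) has_field_derivative (- wp_reg (- x)) * (-1)) (at x)"
      by (rule DERIV_chain2[where g = uminus, OF zeta_reg_deriv[OF x']]) (auto intro!: derivative_eq_intros)
    hence "((\<lambda>x. zeta_reg (- x) + zeta_reg x) has_field_derivative (- wp_reg (- x)) * (-1) + (- wp_reg x)) (at x)"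
      by (intro DERIV_add zeta_reg_deriv x)
    thus ?thesis by (simp add: wp_reg_even)
  qed
  hence "zeta_reg (- z) + zeta_reg z = zeta_reg (- 0) + zeta_reg 0"
    by (rule connected_deriv_zero_eq[OF connected_regular open_regular]) (use assms in auto)
  moreover have "zeta_reg 0 = 0" by (simp add: zeta_reg_def)
  ultimately show ?thesis by (simp add: eq_neg_iff_add_eq_0)
qed

lemma zeta_odd: "z \<notin> L \<Longrightarrow> zeta (- z) = - zeta z"
  using zeta_reg_odd[of z] by (auto simp: zeta_def)

text \<open>The enumeration behind the product has no symmetry under change of sign. Instead,
  \<open>wsigma L (- z) / wsigma L z\<close> has derivative 0 since \<open>zeta\<close> is odd, and
  its limit at 0 is -1.\<close>

lemma wsigma_odd: "wsigma L (- z) = - wsigma L z"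
proof (cases "z \<in> L")
  case True
  thus ?thesis using wsigma_zero_iff[of z] wsigma_zero_iff[of "- z"] by simp
next
  case False
  have const: "wsigma L (- x) / wsigma L x = wsigma L (- z) / wsigma L z" if "x \<notin> L" for x
  proof -
    have "((\<lambda>x. wsigma L (- x) / wsigma L x) has_field_derivative 0) (at x)" if x: "x \<in> - L" for x
    proof -
      have nz: "wsigma L x \<noteq> 0" using x wsigma_zero_iff by simp
      have x': "- x \<notin> L" using x by simp
      have "((\<lambda>x. wsigma L (- x)) has_field_derivative (wsigma L (- x) * zeta (- x)) * (-1)) (at x)"
        by (rule DERIV_chain2[where g = uminus, OF wsigma_has_deriv[OF x']]) (auto intro!: derivative_eq_intros)
      hence "((\<lambda>x. wsigma L (- x) / wsigma L x) has_field_derivative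
         ((wsigma L (- x) * zeta (- x)) * (-1) * wsigma L x - wsigma L (- x) * (wsigma L x * zeta x)) / (wsigma L x * wsigma L x)) (at x)"
        using nz x by (intro DERIV_divide wsigma_has_deriv) auto
      thus ?thesis using zeta_odd[of x] x by simp
    qed
    thus ?thesis
      by (rule connected_deriv_zero_eq[OF connected_punctured open_punctured]) (use that False in auto)
  qed
  have "((\<lambda>x. - ((wsigma L (- x) / (- x)) / (wsigma L x / x))) \<longlongrightarrow> - (1 / 1)) (at 0)"
  proof (intro tendsto_intros wsigma_div_lim)
    show "((\<lambda>x. wsigma L (- x) / - x) \<longlongrightarrow> 1) (at 0)"
      by (rule filterlim_compose[OF wsigma_div_lim])
         (auto simp: filterlim_at eventually_at_filter intro!: tendsto_eq_intros)
  qed auto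
  moreover have "eventually (\<lambda>x. - ((wsigma L (- x) / (- x)) / (wsigma L x / x)) = wsigma L (- z) / wsigma L z) (at 0)"
    using eventually_notin_L
  proof eventually_elim
    case (elim x)
    hence "x \<noteq> 0" by auto
    hence "- ((wsigma L (- x) / (- x)) / (wsigma L x / x)) = wsigma L (- x) / wsigma L x" by simp
    thus ?case using const[OF elim] by simp
  qed
  ultimately have "((\<lambda>_. wsigma L (- z) / wsigma L z) \<longlongrightarrow> - (1 / 1)) (at (0::complex))"
    by (rule Lim_transform_eventually)
  hence "wsigma L (- z) / wsigma L z = - 1"
    by (simp add: tendsto_const_iff)
  thus ?thesis using False wsigma_zero_iff[of z] by (simp add: field_simps)
qed

text \<open>Periodicity of \<open>wp\<close> makes \<open>zeta (z + w) - zeta z\<close> a constant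
  \<open>\<eta>\<close>, and one more integration gives the exponential factor. The values of
  \<open>C\<close> and \<open>\<eta>\<close> may stay implicit because they cancel in the quotient
  to which this is applied.\<close>

lemma wsigma_quasi_periodic:
  assumes w: "w \<in> L"
  obtains C \<eta> where "C \<noteq> 0" "\<And>z. wsigma L (z + w) = C * exp (\<eta> * z) * wsigma L z"
proof -
  obtain z0 where z0: "z0 \<notin> L" using half_period_notin by blast
  define \<eta> where "\<eta> = zeta (z0 + w) - zeta z0"
  have \<eta>: "zeta (z + w) - zeta z = \<eta>" if "z \<notin> L" for z
  proof -
    have "((\<lambda>x. zeta (x + w) - zeta x) has_field_derivative 0) (at x)" if x: "x \<in> - L" for x
    proof -
      have "((\<lambda>x. zeta (x + w)) has_field_derivative - wp L (x + w)) (at x)"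
        by (rule DERIV_shift[THEN iffD1, OF zeta_has_deriv]) (use w x in auto)
      hence "((\<lambda>x. zeta (x + w) - zeta x) has_field_derivative - wp L (x + w) - (- wp L x)) (at x)"
        by (intro DERIV_diff zeta_has_deriv) (use x in auto)
      thus ?thesis using wp_periodic[OF w, of x] x by simp
    qed
    thus ?thesis unfolding \<eta>_def
      by (rule connected_deriv_zero_eq[OF connected_punctured open_punctured]) (use that z0 in auto)
  qed
  define C where "C = wsigma L (z0 + w) / wsigma L z0 * exp (- \<eta> * z0)"
  have C: "wsigma L (z + w) / wsigma L z * exp (- \<eta> * z) = C" if "z \<notin> L" for z
  proof -
    have "((\<lambda>x. wsigma L (x + w) / wsigma L x * exp (- \<eta> * x)) has_field_derivative 0) (at x)" if x: "x \<in> - L" for x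
    proof -
      have nz: "wsigma L x \<noteq> 0" using x wsigma_zero_iff by simp
      have 1: "((\<lambda>x. wsigma L (x + w)) has_field_derivative wsigma L (x + w) * zeta (x + w)) (at x)"
        by (rule DERIV_shift[THEN iffD1, OF wsigma_has_deriv]) (use w x in auto)
      have 2: "((\<lambda>x. exp (- \<eta> * x)) has_field_derivative exp (- \<eta> * x) * (- \<eta>)) (at x)"
        by (auto intro!: derivative_eq_intros)
      have "((\<lambda>x. wsigma L (x + w) / wsigma L x * exp (- \<eta> * x)) has_field_derivative
         ((wsigma L (x + w) * zeta (x + w)) * wsigma L x - wsigma L (x + w) * (wsigma L x * zeta x)) / (wsigma L x * wsigma L x) * exp (- \<eta> * x)
          + (exp (- \<eta> * x) * (- \<eta>)) * (wsigma L (x + w) / wsigma L x)) (at x)"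
        using nz x by (intro DERIV_mult DERIV_divide wsigma_has_deriv 1 2) auto
      moreover have "zeta (x + w) = zeta x + \<eta>" using \<eta>[of x] x by (simp add: algebra_simps)
      ultimately show ?thesis using nz by (simp add: field_simps)
    qed
    thus ?thesis unfolding C_def
      by (rule connected_deriv_zero_eq[OF connected_punctured open_punctured]) (use that z0 in auto)
  qed
  show ?thesis
  proof (rule that[of C \<eta>])
    show "C \<noteq> 0" using z0 w wsigma_zero_iff by (auto simp: C_def)
    show "wsigma L (z + w) = C * exp (\<eta> * z) * wsigma L z" for z
    proof (cases "z \<in> L")
      case True
      thus ?thesis using w wsigma_zero_iff[of z] wsigma_zero_iff[of "z + w"] by simp
    next
      case False
      thus ?thesis using C[of z] wsigma_zero_iff[of z] by (auto simp: exp_minus field_simps)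
    qed
  qed
qed

section \<open>Laurent expansion at the origin and the Weierstrass equation\<close>

lemma lattice_sum_odd:
  assumes "j \<ge> 3" "odd j"
  shows "(\<Sum>n. c / (0 - lat n) ^ j) = 0"
proof -
  have s: "summable (\<lambda>n. norm (c / (0 - lat n) ^ j))"
    by (rule cube_dominated_summable[OF cube_dominated_power[OF assms(1)]])
  have "(\<Sum>n. c / (0 - lat n) ^ j) = infsum (\<lambda>w. c / (0 - w) ^ j) (L - {0})"
    using infsum_lat(2)[of "\<lambda>w. c / (0 - w) ^ j"] s by simp
  also have "\<dots> = infsum (\<lambda>w. - (c / (0 - w) ^ j)) (L - {0})"
    by (rule infsum_reindex_bij_witness[of _ uminus uminus]) (use assms in \<open>auto simp: power_minus_odd\<close>)
  also have "\<dots> = - infsum (\<lambda>w. c / (0 - w) ^ j) (L - {0})"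
    by (rule infsum_uminus)
  also have "infsum (\<lambda>w. c / (0 - w) ^ j) (L - {0}) = (\<Sum>n. c / (0 - lat n) ^ j)"
    using infsum_lat(2)[of "\<lambda>w. c / (0 - w) ^ j"] s by simp
  finally show ?thesis by simp
qed

lemma lattice_sum_even:
  assumes "j \<ge> 3" "even j"
  shows "(\<Sum>n. c / (0 - lat n) ^ j) = c * infsum (\<lambda>w. 1 / w ^ j) (L - {0})"
proof -
  have s: "summable (\<lambda>n. norm (1 / (0 - lat n) ^ j))"
    by (rule cube_dominated_summable[OF cube_dominated_power[OF assms(1)]])
  have "infsum (\<lambda>w. 1 / w ^ j) (L - {0}) = infsum (\<lambda>w. 1 / (0 - w) ^ j) (L - {0})"
    using assms by simp
  also have "\<dots> = (\<Sum>n. 1 / (0 - lat n) ^ j)"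
    using infsum_lat(2)[of "\<lambda>w. 1 / (0 - w) ^ j"] s by simp
  finally show ?thesis
    using suminf_mult[OF summable_norm_cancel[OF s], of c] by simp
qed

lemma wp_expansion:
  obtains r h where "r > 0" "h holomorphic_on ball 0 r" "ball 0 r - {0} \<subseteq> - L"
    "\<And>z. z \<in> ball 0 r - {0} \<Longrightarrow> wp L z = 1 / z ^ 2 + g2 L / 20 * z ^ 2 + g3 L / 28 * z ^ 4 + z ^ 6 * h z"
proof -
  obtain r where r: "r > 0" "ball 0 r \<subseteq> - (L - {0})"
    using open_regular openE[of "- (L - {0})" 0] by blast
  define a where "a = g2 L / 20"
  define b where "b = g3 L / 28"
  \<comment> \<open>\<open>P i\<close> is the \<open>i\<close>-th derivative of
    \<open>a * z ^ 2 + b * z ^ 4\<close>. Agreement at 0 means 2 a = 6 G_4 and 24 b = 120 G_6 for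
    the Eisenstein sums G_4 and G_6; since \<open>g2\<close> is 60 G_4 and \<open>g3\<close> is 140
    G_6, the divisors are 20 and 28.\<close>
  define P where "P = (\<lambda>(i::nat) z. if i = 0 then a * z ^ 2 + b * z ^ 4 else if i = 1 then 2 * a * z + 4 * b * z ^ 3
     else if i = 2 then 2 * a + 12 * b * z ^ 2 else if i = 3 then 24 * b * z else if i = 4 then 24 * b else (0::complex))"
  have P: "(P i has_field_derivative P (Suc i) z) (at z)" for i z
  proof -
    consider "i = 0" | "i = 1" | "i = 2" | "i = 3" | "i = 4" | "i > 4" by linarith
    thus ?thesis
      by cases (auto simp: P_def[abs_def] eval_nat_numeral intro!: derivative_eq_intros)
  qed
  define D where "D = (\<lambda>i z. wp_reg_deriv i z - P i z)"
  have der: "(D i has_field_derivative D (Suc i) z) (at z)" if "z \<in> ball 0 r" for i z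
    unfolding D_def by (intro DERIV_diff P wp_reg_has_deriv) (use that r in auto)
  have zero: "D i 0 = 0" if "i < 6" for i
  proof -
    have "i \<in> {0,1,2,3,4,5}" using that by auto
    thus ?thesis
    proof (safe)
      show "D 0 0 = 0" by (simp add: D_def P_def wp_reg_deriv_def wp_reg_def)
      have "wp_reg_deriv 1 0 = (\<Sum>n. -2 / (0 - lat n) ^ 3)"
        by (simp add: wp_reg_deriv_def eval_nat_numeral)
      also have "\<dots> = 0"
        by (rule lattice_sum_odd) auto
      finally show "D 1 0 = 0" by (simp add: D_def P_def )
      have "wp_reg_deriv 2 0 = (\<Sum>n. 6 / (0 - lat n) ^ 4)"
        by (simp add: wp_reg_deriv_def eval_nat_numeral)
      also have "\<dots> = 6 * infsum (\<lambda>w. 1 / w ^ 4) (L - {0})"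
        by (rule lattice_sum_even) auto
      finally show "D 2 0 = 0" by (simp add: D_def P_def a_def g2_def)
      have "wp_reg_deriv 3 0 = (\<Sum>n. -24 / (0 - lat n) ^ 5)"
        by (simp add: wp_reg_deriv_def eval_nat_numeral)
      also have "\<dots> = 0"
        by (rule lattice_sum_odd) auto
      finally show "D 3 0 = 0" by (simp add: D_def P_def )
      have "wp_reg_deriv 4 0 = (\<Sum>n. 120 / (0 - lat n) ^ 6)"
        by (simp add: wp_reg_deriv_def eval_nat_numeral)
      also have "\<dots> = 120 * infsum (\<lambda>w. 1 / w ^ 6) (L - {0})"
        by (rule lattice_sum_even) auto
      finally show "D 4 0 = 0" by (simp add: D_def P_def b_def g3_def)
      have "wp_reg_deriv 5 0 = (\<Sum>n. -720 / (0 - lat n) ^ 7)"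
        by (simp add: wp_reg_deriv_def eval_nat_numeral)
      also have "\<dots> = 0"
        by (rule lattice_sum_odd) auto
      finally show "D 5 0 = 0" by (simp add: D_def P_def )
    qed
  qed
  have "D 0 holomorphic_on ball 0 r"
    using der[of _ 0] unfolding holomorphic_on_open[OF open_ball] by blast
  then obtain h where h: "h holomorphic_on ball 0 r" "\<And>z. z \<in> ball 0 r \<Longrightarrow> D 0 z = z ^ 6 * h z"
    using taylor_zero_factor[of r D 6] r(1) der zero by blast
  show ?thesis
  proof (rule that[OF r(1) h(1)])
    show "ball 0 r - {0} \<subseteq> - L" using r by auto
    fix z :: complex assume z: "z \<in> ball 0 r - {0}"
    hence "wp_reg z - (a * z ^ 2 + b * z ^ 4) = z ^ 6 * h z"
      using h(2)[of z] by (simp add: D_def P_def wp_reg_deriv_def)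
    thus "wp L z = 1 / z ^ 2 + g2 L / 20 * z ^ 2 + g3 L / 28 * z ^ 4 + z ^ 6 * h z"
      by (simp add: wp_eq a_def b_def algebra_simps)
  qed
qed

lemma wp_deriv_holomorphic: "wp_deriv L holomorphic_on - L"
proof -
  have "deriv (wp L) holomorphic_on - L"
    by (intro holomorphic_deriv wp_holomorphic open_punctured)
  thus ?thesis
    by (rule holomorphic_transform) (use wp_has_deriv in \<open>auto intro: DERIV_imp_deriv\<close>)
qed

theorem wp_ode:
  assumes "z \<notin> L"
  shows "wp_deriv L z ^ 2 = 4 * wp L z ^ 3 - g2 L * wp L z - g3 L"
proof -
  obtain r h where rh: "r > 0" "h holomorphic_on ball 0 r" "ball 0 r - {0} \<subseteq> - L"
    "\<And>z. z \<in> ball 0 r - {0} \<Longrightarrow> wp L z = 1 / z ^ 2 + g2 L / 20 * z ^ 2 + g3 L / 28 * z ^ 4 + z ^ 6 * h z"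
    by (rule wp_expansion) blast
  have lim: "((\<lambda>z. wp_deriv L z ^ 2 - 4 * wp L z ^ 3 + 20 * (g2 L / 20) * wp L z + 28 * (g3 L / 28)) \<longlongrightarrow> 0) (at 0)"
    by (rule weierstrass_ode_limit[OF rh(1,2,4)]) (use rh(3) in \<open>auto intro!: wp_has_deriv\<close>)
  have "wp_deriv L z ^ 2 - 4 * wp L z ^ 3 + 20 * (g2 L / 20) * wp L z + 28 * (g3 L / 28) = 0"
    by (rule liouville_periodic[OF _ _ lim assms])
       (auto intro!: holomorphic_intros wp_holomorphic wp_deriv_holomorphic simp: wp_periodic wp_deriv_periodic)
  thus ?thesis by (simp add: algebra_simps)
qed

end

section \<open>Addition formulas\<close>

context cplx_lattice
begin

lemma wp_square_lim: "((\<lambda>z. z ^ 2 * wp L z) \<longlongrightarrow> 1) (at 0)"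
proof -
  have "(wp_reg has_field_derivative wp_reg_deriv 1 0) (at 0)"
    using wp_reg_has_deriv[of 0 0] by (simp add: wp_reg_deriv_def[of 0, abs_def])
  hence "isCont wp_reg 0" by (rule DERIV_isCont)
  hence "isCont (\<lambda>z. 1 + z ^ 2 * wp_reg z) 0" by (intro continuous_intros)
  hence "((\<lambda>z. 1 + z ^ 2 * wp_reg z) \<longlongrightarrow> 1) (at 0)" by (simp add: isCont_def)
  moreover have "eventually (\<lambda>z. 1 + z ^ 2 * wp_reg z = z ^ 2 * wp L z) (at 0)"
    by (auto simp: wp_eq eventually_at_filter field_simps)
  ultimately show ?thesis by (rule Lim_transform_eventually)
qed

text \<open>Differentiating the first order equation gives the claim multiplied by
  \<open>wp_deriv L z\<close>. To cancel this factor: if the claim failed at \<open>z\<close>, it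
  would fail near \<open>z\<close>, so \<open>wp_deriv L\<close> would vanish on an open set and
  hence everywhere, and \<open>wp L\<close> would be constant in spite of its pole.\<close>

theorem wp_deriv_has_deriv:
  assumes "z \<notin> L"
  shows "(wp_deriv L has_field_derivative 6 * wp L z ^ 2 - g2 L / 2) (at z)"
proof -
  define A where "A = (\<lambda>z. deriv (wp_deriv L) z - (6 * wp L z ^ 2 - g2 L / 2))"
  have der: "(wp_deriv L has_field_derivative deriv (wp_deriv L) z) (at z)" if "z \<notin> L" for z
    using that by (intro holomorphic_derivI[OF wp_deriv_holomorphic open_punctured]) auto
  have prod: "wp_deriv L z * A z = 0" if z: "z \<notin> L" for z
  proof -
    have "((\<lambda>z. wp_deriv L z ^ 2 - (4 * wp L z ^ 3 - g2 L * wp L z - g3 L)) has_field_derivative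
       2 * wp_deriv L z * deriv (wp_deriv L) z - (12 * wp L z ^ 2 * wp_deriv L z - g2 L * wp_deriv L z)) (at z)"
      by (rule derivative_eq_intros der wp_has_deriv z refl | simp)+
    moreover have "((\<lambda>z. wp_deriv L z ^ 2 - (4 * wp L z ^ 3 - g2 L * wp L z - g3 L)) has_field_derivative 0) (at z)"
      by (rule has_field_derivative_transform_within_open[where f = "\<lambda>_. 0" and S = "- L"])
         (use open_punctured z wp_ode in auto)
    ultimately have "2 * wp_deriv L z * deriv (wp_deriv L) z - (12 * wp L z ^ 2 * wp_deriv L z - g2 L * wp_deriv L z) = 0"
      by (rule DERIV_unique)
    thus ?thesis unfolding A_def by algebra
  qed
  have Ahol: "A holomorphic_on - L"
    unfolding A_def by (intro holomorphic_intros holomorphic_deriv wp_deriv_holomorphic wp_holomorphic open_punctured)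
  have "A z = 0"
  proof (rule ccontr)
    assume "A z \<noteq> 0"
    have "isCont A z"
      using holomorphic_on_imp_continuous_on[OF Ahol] assms
      by (simp add: continuous_on_eq_continuous_at[OF open_punctured])
    then obtain e where e: "e > 0" "\<And>x. dist x z < e \<Longrightarrow> A x \<noteq> 0"
      using continuous_at_avoid[of z A 0] \<open>A z \<noteq> 0\<close> by (auto simp: dist_commute)
    define U where "U = ball z e \<inter> - L"
    have U: "open U" "z \<in> U"
      using open_punctured assms e(1) by (auto simp: U_def)
    have zeroU: "wp_deriv L x = 0" if "x \<in> U" for x
      using prod[of x] e(2)[of x] that by (auto simp: U_def dist_commute)
    have lp: "z islimpt U"
      using interior_limit_point[of z U] U by (simp add: interior_open)
    have zero: "wp_deriv L x = 0" if "x \<notin> L" for x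
      by (rule analytic_continuation[OF wp_deriv_holomorphic open_punctured connected_punctured _ _ lp])
         (use zeroU that assms in \<open>auto simp: U_def\<close>)
    have const: "wp L x = wp L z" if "x \<notin> L" for x
      by (rule connected_deriv_zero_eq[OF connected_punctured open_punctured])
         (use zero wp_has_deriv that assms in \<open>force+\<close>)
    have "((\<lambda>x. x ^ 2 * wp L z) \<longlongrightarrow> 0) (at 0)"
      by (auto intro!: tendsto_eq_intros)
    moreover have "eventually (\<lambda>x. x ^ 2 * wp L z = x ^ 2 * wp L x) (at 0)"
      using eventually_notin_L by eventually_elim (use const in auto)
    ultimately have "((\<lambda>x. x ^ 2 * wp L x) \<longlongrightarrow> 0) (at 0)"
      by (rule Lim_transform_eventually)
    from LIM_unique[OF this wp_square_lim] show False by simp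
  qed
  thus ?thesis using der[OF assms] by (simp add: A_def)
qed

text \<open>The difference \<open>F\<close> of the two sides is doubly periodic: the exponential
  factors at \<open>x + a\<close> and \<open>x - a\<close> multiply to the square of the factor at
  \<open>x\<close>. At 0 the double poles cancel, and evenness excludes a simple one. So
  \<open>F\<close> is constant, and it vanishes at \<open>a\<close>.\<close>

theorem wp_diff_eq:
  assumes z: "z \<notin> L" and a: "a \<notin> L"
  shows "wp L z - wp L a = - (wsigma L (z + a) * wsigma L (z - a)) / (wsigma L z ^ 2 * wsigma L a ^ 2)"
proof -
  define F where "F = (\<lambda>z. wp L z - wp L a + wsigma L (z + a) * wsigma L (z - a) / (wsigma L z ^ 2 * wsigma L a ^ 2))"
  have sa: "wsigma L a \<noteq> 0" using a wsigma_zero_iff by simp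
  have shift: "(\<lambda>z. wsigma L (z + c)) holomorphic_on A" for c A
    by (rule holomorphic_on_compose_gen[of "\<lambda>z. z + c" A "wsigma L" UNIV, unfolded o_def])
       (auto intro!: holomorphic_intros)
  have hol: "F holomorphic_on - L"
    unfolding F_def using shift[of "- a"] sa wsigma_zero_iff
    by (intro holomorphic_intros wp_holomorphic shift) auto
  have per: "F (x + w) = F x" if x: "x \<notin> L" and w: "w \<in> L" for x w
  proof -
    obtain C \<eta> where C: "C \<noteq> 0" "\<And>z. wsigma L (z + w) = C * exp (\<eta> * z) * wsigma L z"
      using wsigma_quasi_periodic[OF w] by blast
    have e: "wsigma L (x + w + a) = C * exp (\<eta> * (x + a)) * wsigma L (x + a)"
         "wsigma L (x + w - a) = C * exp (\<eta> * (x - a)) * wsigma L (x - a)"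
      using C(2)[of "x + a"] C(2)[of "x - a"] by (simp_all add: algebra_simps)
    have "exp (\<eta> * (x + a)) * exp (\<eta> * (x - a)) = exp (\<eta> * x) ^ 2"
      by (simp add: algebra_simps flip: exp_add exp_double)
    hence *: "(C * exp (\<eta> * (x + a)) * s) * (C * exp (\<eta> * (x - a)) * t) = (C * exp (\<eta> * x)) ^ 2 * (s * t)" for s t
      by algebra
    have den: "wsigma L (x + w) ^ 2 * wsigma L a ^ 2 = (C * exp (\<eta> * x)) ^ 2 * (wsigma L x ^ 2 * wsigma L a ^ 2)"
      by (simp only: C(2) power_mult_distrib mult.assoc)
    have "wsigma L (x + w + a) * wsigma L (x + w - a) / (wsigma L (x + w) ^ 2 * wsigma L a ^ 2) =
       (C * exp (\<eta> * x)) ^ 2 * (wsigma L (x + a) * wsigma L (x - a)) / ((C * exp (\<eta> * x)) ^ 2 * (wsigma L x ^ 2 * wsigma L a ^ 2))"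
      by (simp only: e * den)
    also have "\<dots> = wsigma L (x + a) * wsigma L (x - a) / (wsigma L x ^ 2 * wsigma L a ^ 2)"
      by (rule mult_divide_mult_cancel_left) (use C(1) in auto)
    finally show ?thesis using wp_periodic[OF w x] by (simp add: F_def)
  qed
  have even: "F (- x) = F x" for x
  proof -
    have "wsigma L (- x + a) = - wsigma L (x - a)" "wsigma L (- x - a) = - wsigma L (x + a)"
      using wsigma_odd[of "x - a"] wsigma_odd[of "x + a"] by (simp_all add: minus_add_distrib flip: diff_conv_add_uminus)
    thus ?thesis by (simp add: F_def wp_even wsigma_odd mult.commute)
  qed
  have lim: "((\<lambda>x. x ^ 2 * F x) \<longlongrightarrow> 0) (at 0)"
  proof -
    have "((\<lambda>x. x ^ 2 * wp L x - x ^ 2 * wp L a + wsigma L (x + a) * wsigma L (x - a) / ((wsigma L x / x) ^ 2 * wsigma L a ^ 2)) \<longlongrightarrow>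
       1 - 0 ^ 2 * wp L a + wsigma L a * wsigma L (- a) / (1 ^ 2 * wsigma L a ^ 2)) (at 0)"
    proof (intro tendsto_intros wp_square_lim wsigma_div_lim)
      show "((\<lambda>x. wsigma L (x + a)) \<longlongrightarrow> wsigma L a) (at 0)"
        by (rule isCont_tendsto_compose[OF isCont_wsigma]) (auto intro!: tendsto_eq_intros)
      show "((\<lambda>x. wsigma L (x - a)) \<longlongrightarrow> wsigma L (- a)) (at 0)"
        by (rule isCont_tendsto_compose[OF isCont_wsigma]) (auto intro!: tendsto_eq_intros)
    qed (use sa in auto)
    also have "1 - 0 ^ 2 * wp L a + wsigma L a * wsigma L (- a) / (1 ^ 2 * wsigma L a ^ 2) = 0"
      using sa by (simp add: wsigma_odd power2_eq_square)
    finally show ?thesis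
      by (rule Lim_transform_eventually) (auto simp: F_def eventually_at_filter divide_simps algebra_simps)
  qed
  obtain r where r: "r > 0" "ball 0 r \<subseteq> - (L - {0})"
    using open_regular openE[of "- (L - {0})" 0] by blast
  have "F holomorphic_on ball 0 r - {0}"
    using hol by (rule holomorphic_on_subset) (use r in auto)
  then obtain k where k: "k holomorphic_on ball 0 r" "\<And>z. z \<in> ball 0 r - {0} \<Longrightarrow> F z = 0 / z ^ 2 + k z"
    using even_double_pole[of F r 0] r(1) even lim by metis
  have "isCont k 0"
    using holomorphic_on_imp_continuous_on[OF k(1)] r
    by (simp add: continuous_on_eq_continuous_at[OF open_ball])
  hence "(k \<longlongrightarrow> k 0) (at 0)" by (simp add: isCont_def)
  moreover have "eventually (\<lambda>x. x \<in> ball 0 r - {0}) (at (0::complex))"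
    using r by (intro eventually_at_in_open) auto
  hence "eventually (\<lambda>x. k x = F x) (at 0)"
    by eventually_elim (use k in auto)
  ultimately have "(F \<longlongrightarrow> k 0) (at 0)" by (rule Lim_transform_eventually)
  hence "F x = k 0" if "x \<notin> L" for x
    using liouville_periodic[OF hol per] that by blast
  hence "F z = F a" using z a by simp
  also have "F a = 0" using wsigma_zero_iff[of 0] by (simp add: F_def)
  finally show ?thesis by (simp add: F_def eq_neg_iff_add_eq_0)
qed

lemma wp_eq_iff:
  assumes "z \<notin> L" "a \<notin> L"
  shows "wp L z = wp L a \<longleftrightarrow> z + a \<in> L \<or> z - a \<in> L"
proof -
  have "wp L z = wp L a \<longleftrightarrow> wp L z - wp L a = 0" by simp
  also have "\<dots> \<longleftrightarrow> wsigma L (z + a) = 0 \<or> wsigma L (z - a) = 0"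
    unfolding wp_diff_eq[OF assms] using assms wsigma_zero_iff by simp
  finally show ?thesis by (simp only: wsigma_zero_iff)
qed

text \<open>The logarithmic derivative in \<open>z\<close> of the factorization of
  \<open>wp L z - wp L w\<close> into sigma values.\<close>

lemma wp_deriv_zeta:
  assumes z: "z \<notin> L" and w: "w \<notin> L" and zw: "z + w \<notin> L" "z - w \<notin> L"
  shows "wp_deriv L z = (wp L z - wp L w) * (zeta (z + w) + zeta (z - w) - 2 * zeta z)"
proof -
  define E where "E = (\<lambda>z. - (wsigma L (z + w) * wsigma L (z - w)) / (wsigma L z ^ 2 * wsigma L w ^ 2))"
  have nz: "wsigma L z \<noteq> 0" "wsigma L w \<noteq> 0" using z w wsigma_zero_iff by auto
  have 1: "((\<lambda>z. wsigma L (z + w)) has_field_derivative wsigma L (z + w) * zeta (z + w)) (at z)"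
    by (rule DERIV_shift[THEN iffD1, OF wsigma_has_deriv]) (use zw in auto)
  have 2: "((\<lambda>z. wsigma L (z - w)) has_field_derivative wsigma L (z - w) * zeta (z - w)) (at z)"
    using DERIV_shift[THEN iffD1, OF wsigma_has_deriv, of z "- w"] zw by simp
  have "(E has_field_derivative E z * (zeta (z + w) + zeta (z - w) - 2 * zeta z)) (at z)"
    unfolding E_def using nz
    by (auto intro!: derivative_eq_intros 1 2 wsigma_has_deriv z simp: divide_simps) (auto simp: algebra_simps power2_eq_square)
  hence "((\<lambda>z. wp L z - wp L w) has_field_derivative E z * (zeta (z + w) + zeta (z - w) - 2 * zeta z)) (at z)"
    by (rule has_field_derivative_transform_within_open[where S = "- L"])
       (use open_punctured z w wp_diff_eq in \<open>auto simp: E_def\<close>)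
  moreover have "((\<lambda>z. wp L z - wp L w) has_field_derivative wp_deriv L z - 0) (at z)"
    by (intro DERIV_diff wp_has_deriv z DERIV_const)
  ultimately have "wp_deriv L z = E z * (zeta (z + w) + zeta (z - w) - 2 * zeta z)"
    using DERIV_unique by fastforce
  thus ?thesis using wp_diff_eq[OF z w] by (simp add: E_def)
qed

text \<open>The first formula is the difference of \<open>wp_deriv_zeta\<close> for \<open>z\<close>
  and for \<open>w\<close>. Differentiating it in \<open>z\<close> brings in
  \<open>wp L (z + w)\<close> through the derivative of \<open>K\<close>, which gives the second;
  differentiating that gives the third. \<open>K\<close> is half the slope of the chord.\<close>

lemma wp_add_aux:
  assumes z: "z \<notin> L" and w: "w \<notin> L" and zw: "z + w \<notin> L" "z - w \<notin> L"
  defines "K \<equiv> zeta (z + w) - zeta z - zeta w"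
  shows "wp_deriv L z - wp_deriv L w = 2 * (wp L z - wp L w) * K"
    and "wp L (z + w) = K ^ 2 - wp L z - wp L w"
    and "wp_deriv L (z + w) = 2 * K * (wp L z - wp L (z + w)) - wp_deriv L z"
proof -
  define S where "S = - L \<inter> (\<lambda>x. x + w) -` (- L) \<inter> (\<lambda>x. x - w) -` (- L)"
  have S: "open S"
    unfolding S_def by (intro open_Int open_punctured open_vimage continuous_intros)
  have zS: "z \<in> S" using z zw by (auto simp: S_def)
  define k where "k = (\<lambda>x. zeta (x + w) - zeta x - zeta w)"
  have 1: "wp_deriv L x - wp_deriv L w = 2 * (wp L x - wp L w) * k x" if "x \<in> S" for x
  proof -
    have x: "x \<notin> L" "x + w \<notin> L" "x - w \<notin> L" using that by (auto simp: S_def)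
    have "w - x \<notin> L" using uminus_mem_iff[of "x - w"] x by simp
    hence "wp_deriv L w = (wp L w - wp L x) * (zeta (w + x) + zeta (w - x) - 2 * zeta w)"
      using x w by (intro wp_deriv_zeta) (auto simp: add.commute)
    moreover have "zeta (w - x) = - zeta (x - w)" using zeta_odd[OF x(3)] by simp
    ultimately show ?thesis
      using wp_deriv_zeta[OF x(1) w x(2,3)] unfolding k_def add.commute[of w x] by algebra
  qed
  have dk: "(k has_field_derivative wp L x - wp L (x + w)) (at x)" if "x \<in> S" for x
  proof -
    have x: "x \<notin> L" "x + w \<notin> L" using that by (auto simp: S_def)
    have "((\<lambda>x. zeta (x + w)) has_field_derivative - wp L (x + w)) (at x)"
      by (rule DERIV_shift[THEN iffD1, OF zeta_has_deriv]) (use x in auto)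
    hence "(k has_field_derivative - wp L (x + w) - (- wp L x) - 0) (at x)"
      unfolding k_def by (intro DERIV_diff zeta_has_deriv x DERIV_const)
    thus ?thesis by simp
  qed
  have 2: "wp L (x + w) = k x ^ 2 - wp L x - wp L w" if xS: "x \<in> S" for x
  proof -
    have x: "x \<notin> L" "x + w \<notin> L" "x - w \<notin> L" using that by (auto simp: S_def)
    have "((\<lambda>x. 2 * (wp L x - wp L w) * k x) has_field_derivative
       2 * wp_deriv L x * k x + (wp L x - wp L (x + w)) * (2 * (wp L x - wp L w))) (at x)"
      by (rule derivative_eq_intros wp_has_deriv x dk xS refl | simp)+
    hence "((\<lambda>x. wp_deriv L x - wp_deriv L w) has_field_derivative
       2 * wp_deriv L x * k x + (wp L x - wp L (x + w)) * (2 * (wp L x - wp L w))) (at x)"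
      by (rule has_field_derivative_transform_within_open[where S = S]) (use S xS 1 in auto)
    moreover have "((\<lambda>x. wp_deriv L x - wp_deriv L w) has_field_derivative (6 * wp L x ^ 2 - g2 L / 2) - 0) (at x)"
      by (intro DERIV_diff wp_deriv_has_deriv x DERIV_const)
    ultimately have e1: "6 * wp L x ^ 2 - g2 L / 2 = 2 * wp_deriv L x * k x + (wp L x - wp L (x + w)) * (2 * (wp L x - wp L w))"
      using DERIV_unique by fastforce
    have ne: "wp L x - wp L w \<noteq> 0" using wp_eq_iff[OF x(1) w] x by simp
    \<comment> \<open>Elimination of \<open>p'\<close> and \<open>q'\<close> from the differentiated
      slope identity, the slope identity itself and the two Weierstrass equations. The result
      carries the factor \<open>2 * (p - q) ^ 2\<close>, which is nonzero on
      \<open>S\<close>.\<close>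
    have alg: "(p - q) * (2 * (p - q)) * (s - (K ^ 2 - p - q)) = 0"
      if "6 * p ^ 2 - g / 2 = 2 * p' * K + (p - s) * (2 * (p - q))" "p' - q' = 2 * (p - q) * K"
         "p' ^ 2 = 4 * p ^ 3 - g * p - g'" "q' ^ 2 = 4 * q ^ 3 - g * q - g'" for p q p' q' s K g g' :: complex
    proof -
      have "6 * p ^ 2 * 2 - g = 2 * (2 * p' * K + (p - s) * (2 * (p - q)))"
        using that(1) by (simp add: field_simps)
      thus ?thesis using that(2-4) by algebra
    qed
    have "(wp L x - wp L w) * (2 * (wp L x - wp L w)) * (wp L (x + w) - (k x ^ 2 - wp L x - wp L w)) = 0"
      by (rule alg[OF e1 1[OF xS] wp_ode[OF x(1)] wp_ode[OF w]])
    thus ?thesis using ne by simp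
  qed
  have K: "K = k z" by (simp add: K_def k_def)
  show "wp_deriv L z - wp_deriv L w = 2 * (wp L z - wp L w) * K"
    using 1[OF zS] K by simp
  show "wp L (z + w) = K ^ 2 - wp L z - wp L w"
    using 2[OF zS] K by simp
  have "((\<lambda>x. k x ^ 2 - wp L x - wp L w) has_field_derivative
     2 * k z * (wp L z - wp L (z + w)) - wp_deriv L z) (at z)"
    by (rule derivative_eq_intros wp_has_deriv z dk zS refl | simp)+
  hence "((\<lambda>x. wp L (x + w)) has_field_derivative
     2 * k z * (wp L z - wp L (z + w)) - wp_deriv L z) (at z)"
    by (rule has_field_derivative_transform_within_open[where S = S]) (use S zS 2 in auto)
  moreover have "((\<lambda>x. wp L (x + w)) has_field_derivative wp_deriv L (z + w)) (at z)"
    by (rule DERIV_shift[THEN iffD1, OF wp_has_deriv]) (use zw in auto)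
  ultimately show "wp_deriv L (z + w) = 2 * K * (wp L z - wp L (z + w)) - wp_deriv L z"
    using DERIV_unique K by fastforce
qed

theorem wp_add:
  assumes z: "z \<notin> L" and w: "w \<notin> L" and zw: "z + w \<notin> L" "z - w \<notin> L"
  defines "l \<equiv> (wp_deriv L z - wp_deriv L w) / (wp L z - wp L w)"
  shows "wp L (z + w) = l ^ 2 / 4 - wp L z - wp L w"
    and "wp_deriv L (z + w) = l * (wp L z - wp L (z + w)) - wp_deriv L z"
proof -
  have "wp L z - wp L w \<noteq> 0" using wp_eq_iff[OF z w] zw by simp
  moreover have "2 * d * k / d = 2 * k" if "d \<noteq> 0" for d k :: complex
    using that by simp
  ultimately have l: "l = 2 * (zeta (z + w) - zeta z - zeta w)"
    unfolding l_def wp_add_aux(1)[OF z w zw] by blast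
  show "wp L (z + w) = l ^ 2 / 4 - wp L z - wp L w"
    unfolding l power_mult_distrib using wp_add_aux(2)[OF z w zw] by simp
  show "wp_deriv L (z + w) = l * (wp L z - wp L (z + w)) - wp_deriv L z"
    using wp_add_aux(3)[OF z w zw] by (simp add: l)
qed

text \<open>Dividing \<open>wp_diff_eq\<close> by \<open>x - z\<close> and letting \<open>x\<close>
  tend to \<open>z\<close> expresses the derivative as minus \<open>wsigma L (2 * z)\<close> over
  \<open>wsigma L z ^ 4\<close>.\<close>

lemma wp_deriv_nonzero:
  assumes "2 * z \<notin> L"
  shows "wp_deriv L z \<noteq> 0"
proof -
  have z: "z \<notin> L" using assms add_mem[of z z] by auto
  have nz: "wsigma L z \<noteq> 0" "wsigma L (z + z) \<noteq> 0" using z assms wsigma_zero_iff unfolding mult_2 by blast+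
  have d1: "((\<lambda>x. (wp L x - wp L z) / (x - z)) \<longlongrightarrow> wp_deriv L z) (at z)"
    using wp_has_deriv[OF z] by (simp add: has_field_derivative_iff)
  have d2: "((\<lambda>x. - (wsigma L (x + z) * (wsigma L (x - z) / (x - z))) / (wsigma L x ^ 2 * wsigma L z ^ 2)) \<longlongrightarrow>
     - (wsigma L (z + z) * 1) / (wsigma L z ^ 2 * wsigma L z ^ 2)) (at z)"
  proof (intro tendsto_intros)
    show "((\<lambda>x. wsigma L (x + z)) \<longlongrightarrow> wsigma L (z + z)) (at z)"
      by (rule isCont_tendsto_compose[OF isCont_wsigma]) (intro tendsto_intros)
    show "(wsigma L \<longlongrightarrow> wsigma L z) (at z)"
      using isCont_wsigma[of z] by (simp add: isCont_def)
    show "((\<lambda>x. wsigma L (x - z) / (x - z)) \<longlongrightarrow> 1) (at z)"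
      by (rule filterlim_compose[OF wsigma_div_lim])
         (auto simp: filterlim_at eventually_at_filter intro!: tendsto_eq_intros)
  qed (use nz in auto)
  have "eventually (\<lambda>x. (wp L x - wp L z) / (x - z) =
     - (wsigma L (x + z) * (wsigma L (x - z) / (x - z))) / (wsigma L x ^ 2 * wsigma L z ^ 2)) (at z)"
    using eventually_notin_L
    by eventually_elim (use z in \<open>simp add: wp_diff_eq\<close>)
  hence "wp_deriv L z = - (wsigma L (z + z) * 1) / (wsigma L z ^ 2 * wsigma L z ^ 2)"
    by (intro LIM_unique[OF Lim_transform_eventually[OF d1] d2])
  thus ?thesis using nz by simp
qed

text \<open>The limit \<open>w\<close> to \<open>z\<close> of the chord formulas; the slope
  \<open>m w\<close> tends to the quotient of the second and first derivatives of
  \<open>wp L\<close> at \<open>z\<close>.\<close>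

theorem wp_double:
  assumes "2 * z \<notin> L"
  defines "l \<equiv> (6 * wp L z ^ 2 - g2 L / 2) / wp_deriv L z"
  shows "wp L (2 * z) = l ^ 2 / 4 - wp L z - wp L z"
    and "wp_deriv L (2 * z) = l * (wp L z - wp L (2 * z)) - wp_deriv L z"
proof -
  have z: "z \<notin> L" using assms add_mem[of z z] by auto
  have zz: "z + z \<notin> L" using assms(1) unfolding mult_2 .
  define m where "m = (\<lambda>w. (wp_deriv L z - wp_deriv L w) / (wp L z - wp L w))"
  have "((\<lambda>w. ((wp_deriv L w - wp_deriv L z) / (w - z)) / ((wp L w - wp L z) / (w - z))) \<longlongrightarrow> l) (at z)"
    unfolding l_def using wp_has_deriv[OF z] wp_deriv_has_deriv[OF z] wp_deriv_nonzero[OF assms(1)]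
    by (intro tendsto_divide) (simp_all add: has_field_derivative_iff)
  moreover have "eventually (\<lambda>w. ((wp_deriv L w - wp_deriv L z) / (w - z)) / ((wp L w - wp L z) / (w - z)) = m w) (at z)"
    using eventually_neq_at_within[of z]
  proof eventually_elim
    case (elim w)
    hence "((wp_deriv L w - wp_deriv L z) / (w - z)) / ((wp L w - wp L z) / (w - z)) = (wp_deriv L w - wp_deriv L z) / (wp L w - wp L z)"
      by simp
    also have "\<dots> = m w" unfolding m_def by (metis minus_diff_eq minus_divide_divide)
    finally show ?case .
  qed
  ultimately have m: "(m \<longlongrightarrow> l) (at z)" by (rule Lim_transform_eventually)
  have c1: "isCont (wp L) x" if "x \<notin> L" for x using wp_has_deriv[OF that] DERIV_isCont by blast
  have c2: "isCont (wp_deriv L) x" if "x \<notin> L" for x using wp_deriv_has_deriv[OF that] DERIV_isCont by blast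
  have t: "((\<lambda>w. z + w) \<longlongrightarrow> z + z) (at z)" by (intro tendsto_intros)
  note lims = isCont_tendsto_compose[OF c1[OF zz] t] isCont_tendsto_compose[OF c2[OF zz] t]
     c1[OF z, unfolded isCont_def] m
  have ev: "eventually (\<lambda>w. w \<notin> L \<and> z + w \<notin> L \<and> z - w \<notin> L) (at z)"
  proof -
    have "open ((\<lambda>w. z + w) -` (- L))"
      by (intro open_vimage continuous_intros open_punctured)
    hence 1: "eventually (\<lambda>w. w \<in> (\<lambda>w. z + w) -` (- L)) (at z)"
      using zz by (intro eventually_at_in_open') auto
    have "filterlim (\<lambda>w. z - w) (at 0) (at z)"
      by (auto simp: filterlim_at eventually_at_filter intro!: tendsto_eq_intros)
    hence 2: "eventually (\<lambda>w. z - w \<notin> L) (at z)"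
      using eventually_notin_L[of 0] unfolding filterlim_iff by blast
    show ?thesis using 1 2 eventually_notin_L[of z] by eventually_elim auto
  qed
  have "((\<lambda>w. m w ^ 2 / 4 - wp L z - wp L w) \<longlongrightarrow> l ^ 2 / 4 - wp L z - wp L z) (at z)"
    by (intro tendsto_intros lims) auto
  moreover have "eventually (\<lambda>w. m w ^ 2 / 4 - wp L z - wp L w = wp L (z + w)) (at z)"
    using ev by eventually_elim (use wp_add(1)[OF z] in \<open>simp add: m_def\<close>)
  ultimately have "((\<lambda>w. wp L (z + w)) \<longlongrightarrow> l ^ 2 / 4 - wp L z - wp L z) (at z)"
    by (rule Lim_transform_eventually)
  from LIM_unique[OF this lims(1)] show *: "wp L (2 * z) = l ^ 2 / 4 - wp L z - wp L z"
    by (simp only: mult_2)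
  have "((\<lambda>w. m w * (wp L z - wp L (z + w)) - wp_deriv L z) \<longlongrightarrow> l * (wp L z - wp L (z + z)) - wp_deriv L z) (at z)"
    by (intro tendsto_intros lims)
  moreover have "eventually (\<lambda>w. m w * (wp L z - wp L (z + w)) - wp_deriv L z = wp_deriv L (z + w)) (at z)"
    using ev by eventually_elim (use wp_add(2)[OF z] in \<open>simp add: m_def\<close>)
  ultimately have "((\<lambda>w. wp_deriv L (z + w)) \<longlongrightarrow> l * (wp L z - wp L (z + z)) - wp_deriv L z) (at z)"
    by (rule Lim_transform_eventually)
  from LIM_unique[OF this lims(2)] show "wp_deriv L (2 * z) = l * (wp L z - wp L (2 * z)) - wp_deriv L z"
    by (simp only: mult_2)
qed

end

section \<open>The uniformization is a homomorphism\<close>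

definition complexify :: "real wcurve \<Rightarrow> complex wcurve" where
  "complexify E = \<lparr>A1 = of_real (A1 E), A2 = of_real (A2 E), A3 = of_real (A3 E), A4 = of_real (A4 E), A6 = of_real (A6 E)\<rparr>"

lemma complexify_simps [simp]:
  "A1 (complexify E) = of_real (A1 E)" "A2 (complexify E) = of_real (A2 E)" "A3 (complexify E) = of_real (A3 E)"
  "A4 (complexify E) = of_real (A4 E)" "A6 (complexify E) = of_real (A6 E)"
  by (simp_all add: complexify_def)

lemma map_pt_ec_neg: "map_pt complex_of_real (ec_neg E P) = ec_neg (complexify E) (map_pt complex_of_real P)"
  by (cases P) auto

lemma map_pt_ec_add:
  "map_pt complex_of_real (ec_add E P Q) =
     ec_add (complexify E) (map_pt complex_of_real P) (map_pt complex_of_real Q)"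
proof (cases P; cases Q)
  fix x1 y1 x2 y2 assume [simp]: "P = Pt x1 y1" "Q = Pt x2 y2"
  have 1: "complex_of_real y1 + of_real y2 + of_real (A1 E) * of_real x2 + of_real (A3 E) = 0 \<longleftrightarrow>
     y1 + y2 + A1 E * x2 + A3 E = 0"
    by (metis (no_types) of_real_0 of_real_add of_real_eq_iff of_real_mult)
  show ?thesis
    by (simp add: 1 Let_def)
qed auto

lemma map_pt_ec_imult:
  "map_pt complex_of_real (ec_imult E m P) = ec_imult (complexify E) m (map_pt complex_of_real P)"
proof -
  have "map_pt complex_of_real (ec_nmult E k P) = ec_nmult (complexify E) k (map_pt complex_of_real P)" for k
    by (induction k) (simp_all add: map_pt_ec_add)
  thus ?thesis by (simp add: ec_imult_def map_pt_ec_neg)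
qed

lemma map_pt_ec_lincomb:
  "map_pt complex_of_real (ec_lincomb E n v P) = ec_lincomb (complexify E) n v (\<lambda>i. map_pt complex_of_real (P i))"
proof -
  have "map_pt complex_of_real (foldr (\<lambda>i acc. ec_add E (ec_imult E (v i) (P i)) acc) xs Inf) =
     foldr (\<lambda>i acc. ec_add (complexify E) (ec_imult (complexify E) (v i) (map_pt complex_of_real (P i))) acc) xs Inf" for xs
    by (induction xs) (simp_all add: map_pt_ec_add map_pt_ec_imult)
  thus ?thesis by (simp add: ec_lincomb_def)
qed

lemma map_pt_eq_Inf_iff [simp]: "map_pt f P = Inf \<longleftrightarrow> P = Inf"
  by (cases P) auto

context cplx_lattice
begin

lemma unif_zero: "z \<in> L \<Longrightarrow> unif E L z = Inf"
  by (simp add: unif_def)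

lemma unif_nonzero: "z \<notin> L \<Longrightarrow> unif E L z = Pt (wp L z - of_real (b2 E / 12))
   ((wp_deriv L z - of_real (A1 E) * (wp L z - of_real (b2 E / 12)) - of_real (A3 E)) / 2)"
  by (simp add: unif_def Let_def)

lemma unif_eq_Inf_iff: "unif E L z = Inf \<longleftrightarrow> z \<in> L"
  by (cases "z \<in> L") (simp_all add: unif_zero unif_nonzero)

lemma unif_periodic: "w \<in> L \<Longrightarrow> unif E L (z + w) = unif E L z"
  by (cases "z \<in> L") (simp_all add: unif_zero unif_nonzero wp_periodic wp_deriv_periodic)

lemma unif_neg: "unif E L (- z) = ec_neg (complexify E) (unif E L z)"
  by (cases "z \<in> L") (simp_all add: unif_zero unif_nonzero wp_even wp_deriv_odd field_simps)

text \<open>Equal first coordinates leave \<open>z - w\<close> or \<open>z + w\<close> in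
  \<open>L\<close>. In the second case oddness and the equal second coordinates force the derivative
  to vanish at \<open>z\<close>, so \<open>2 * z\<close> is a period and the first case holds as
  well.\<close>

lemma unif_inj:
  assumes "unif E L z = unif E L w"
  shows "z - w \<in> L"
proof (cases "z \<in> L")
  case True
  hence "w \<in> L" using assms unif_eq_Inf_iff by metis
  thus ?thesis using True diff_mem by blast
next
  case False
  hence w: "w \<notin> L" using assms unif_eq_Inf_iff by metis
  have eq: "wp L z = wp L w" "wp_deriv L z = wp_deriv L w"
    using assms by (auto simp: unif_nonzero False w)
  show ?thesis
  proof (rule ccontr)
    assume ne: "z - w \<notin> L"
    hence zw: "z + w \<in> L" using wp_eq_iff[OF False w] eq by blast
    have "wp_deriv L w = wp_deriv L (- z + (z + w))" by simp
    also have "\<dots> = - wp_deriv L z"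
      using wp_deriv_periodic[OF zw, of "- z"] by (simp only: wp_deriv_odd)
    finally have "wp_deriv L z = 0" using eq by simp
    hence "2 * z \<in> L" using wp_deriv_nonzero by blast
    hence "2 * z - (z + w) \<in> L" using zw diff_mem by blast
    thus False using ne by simp
  qed
qed

text \<open>The case distinction follows that of \<open>ec_add\<close>: a summand at infinity,
  opposite points, the tangent at a repeated point, and the chord. The chord and tangent cases
  reduce to \<open>step\<close> once the slope is identified.\<close>

theorem unif_add:
  assumes g2: "g2 L = of_real (c4 E / 12)"
  shows "unif E L (z + w) = ec_add (complexify E) (unif E L z) (unif E L w)"
proof -
  define a1 a2 a3 a4 where "a1 = complex_of_real (A1 E)" and "a2 = complex_of_real (A2 E)"
    and "a3 = complex_of_real (A3 E)" and "a4 = complex_of_real (A4 E)"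
  define B where "B = complex_of_real (b2 E / 12)"
  have B: "12 * B = a1 ^ 2 + 4 * a2"
    by (simp add: B_def b2_def a1_def a2_def)
  have G: "g2 L = ((a1 ^ 2 + 4 * a2) ^ 2 - 24 * (2 * a4 + a1 * a3)) / 12"
    unfolding g2 c4_def b2_def b4_def a1_def a2_def a3_def a4_def by simp
  \<comment> \<open>Since x is \<open>f - B\<close> and 2 y is \<open>f' - a1 * x - a3\<close>, a
    line of slope \<open>m\<close> in the pair of functions has slope \<open>(m - a1) / 2\<close> in
    the coordinates of \<open>E\<close>. For this relation the analytic addition formulas are the
    algebraic ones.\<close>
  have step: "Pt (f3 - B) ((f3' - a1 * (f3 - B) - a3) / 2) =
     Pt (l ^ 2 + a1 * l - a2 - (f1 - B) - (f2 - B))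
        (- (l + a1) * (l ^ 2 + a1 * l - a2 - (f1 - B) - (f2 - B)) - ((f1' - a1 * (f1 - B) - a3) / 2 - l * (f1 - B)) - a3)"
    if l: "l = (m - a1) / 2" and f3: "f3 = m ^ 2 / 4 - f1 - f2" and f3': "f3' = m * (f1 - f3) - f1'"
    for f1 f2 f3 f1' f3' l m
  proof -
    have x: "l ^ 2 + a1 * l - a2 - (f1 - B) - (f2 - B) = f3 - B"
    proof -
      have "2 * l = m - a1" "4 * f3 = m ^ 2 - 4 * f1 - 4 * f2" unfolding l f3 by simp_all
      hence "12 * (l ^ 2 + a1 * l - a2 - (f1 - B) - (f2 - B)) = 12 * (f3 - B)" using B by algebra
      moreover have "x = y" if "12 * x = 12 * y" for x y :: complex using that by simp
      ultimately show ?thesis by blast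
    qed
    have "2 * (- (l + a1) * (f3 - B) - ((f1' - a1 * (f1 - B) - a3) / 2 - l * (f1 - B)) - a3) =
        f3' - a1 * (f3 - B) - a3"
      unfolding f3' l by (simp add: field_simps)
    hence "(f3' - a1 * (f3 - B) - a3) / 2 = - (l + a1) * (f3 - B) - ((f1' - a1 * (f1 - B) - a3) / 2 - l * (f1 - B)) - a3"
      by (metis nonzero_mult_div_cancel_left zero_neq_numeral)
    thus ?thesis unfolding x by simp
  qed
  consider "z \<in> L" | "w \<in> L" "z \<notin> L" | "z \<notin> L" "w \<notin> L" "z + w \<in> L" | "z \<notin> L" "w \<notin> L" "z + w \<notin> L" "z - w \<in> L"
    | "z \<notin> L" "w \<notin> L" "z + w \<notin> L" "z - w \<notin> L" by blast
  thus ?thesis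
  proof cases
    case 1
    thus ?thesis using unif_periodic[of z E w] by (simp add: unif_zero add.commute)
  next
    case 2
    show ?thesis unfolding unif_periodic[OF 2(1)] unif_zero[OF 2(1)] using 2 by (simp add: unif_nonzero)
  next
    case 3
    have w: "w = - z + (z + w)" by simp
    have "unif E L w = unif E L (- z)" using unif_periodic[OF 3(3)] w by metis
    hence "unif E L w = ec_neg (complexify E) (unif E L z)" by (simp add: unif_neg)
    moreover obtain x y where "unif E L z = Pt x y" using unif_nonzero[OF 3(1)] by blast
    ultimately show ?thesis using 3 by (simp add: unif_zero)
  next
    case 4
    have zz: "2 * z \<notin> L"
    proof
      assume "2 * z \<in> L"
      hence "2 * z - (z - w) \<in> L" using 4 diff_mem by blast
      thus False using 4 by (simp add: add.commute)
    qed
    have eqw: "unif E L w = unif E L z" using unif_periodic[OF 4(4), of E w] by simp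
    have eqzw: "unif E L (z + w) = unif E L (2 * z)"
      using unif_periodic[OF 4(4), of E "z + w"] by simp
    define f where "f = wp L z"
    define f' where "f' = wp_deriv L z"
    define y where "y = (f' - a1 * (f - B) - a3) / 2"
    have nz: "f' \<noteq> 0" using wp_deriv_nonzero[OF zz] by (simp add: f'_def)
    define m where "m = (6 * f ^ 2 - g2 L / 2) / f'"
    define l where "l = (3 * (f - B) ^ 2 + 2 * a2 * (f - B) + a4 - a1 * y) / (2 * y + a1 * (f - B) + a3)"
    have "2 * (x / 2) = x" for x :: complex by simp
    hence y: "2 * y = f' - a1 * (f - B) - a3" unfolding y_def by blast
    hence den: "2 * y + a1 * (f - B) + a3 = f'" by algebra
    \<comment> \<open>Here \<open>g2\<close> enters: expressed in the coefficients of
      \<open>E\<close>, it turns the numerator of the algebraic tangent slope into half of the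
      second derivative \<open>6 * f ^ 2 - g2 L / 2\<close> minus
      \<open>a1 * f' / 2\<close>.\<close>
    have lm: "l = (m - a1) / 2"
    proof -
      have G': "12 * g2 L = (a1 ^ 2 + 4 * a2) ^ 2 - 24 * (2 * a4 + a1 * a3)"
        using G by (simp add: mult.commute)
      define A where "A = 3 * (f - B) ^ 2 + 2 * a2 * (f - B) + a4 - a1 * y"
      have A: "48 * A = 12 * (12 * f ^ 2 - g2 L - 2 * a1 * f')"
        unfolding A_def using y B G' by algebra
      have lA: "l * f' = A" unfolding l_def den A_def[symmetric] using nz by simp
      have mf: "2 * (m * f') = 12 * f ^ 2 - g2 L" using nz by (simp add: m_def)
      have "f' * (48 * l) = 48 * (l * f')" by simp
      also have "\<dots> = 12 * (2 * (m * f') - 2 * a1 * f')" by (simp only: lA A mf)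
      also have "\<dots> = f' * (24 * (m - a1))" by (simp add: algebra_simps)
      finally have "f' * (48 * l) = f' * (24 * (m - a1))" .
      hence "48 * l = 24 * (m - a1)" using nz mult_left_cancel by blast
      moreover have "x = t / 2" if "48 * x = 24 * t" for x t :: complex
        using that by (simp add: field_simps)
      ultimately show ?thesis by blast
    qed
    have uz: "unif E L z = Pt (f - B) y"
      using 4 by (simp add: unif_nonzero f_def f'_def y_def B_def a1_def a3_def)
    have "unif E L (2 * z) = Pt (wp L (2 * z) - B) ((wp_deriv L (2 * z) - a1 * (wp L (2 * z) - B) - a3) / 2)"
      using zz by (simp add: unif_nonzero B_def a1_def a3_def)
    also have "\<dots> = Pt (l ^ 2 + a1 * l - a2 - (f - B) - (f - B))
        (- (l + a1) * (l ^ 2 + a1 * l - a2 - (f - B) - (f - B)) - ((f' - a1 * (f - B) - a3) / 2 - l * (f - B)) - a3)"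
      by (rule step[OF lm]) (use wp_double[OF zz] in \<open>simp_all add: m_def f_def f'_def\<close>)
    also have "\<dots> = ec_add (complexify E) (Pt (f - B) y) (Pt (f - B) y)"
    proof -
      have ne: "y + y + a1 * (f - B) + a3 \<noteq> 0" using den nz by simp
      show ?thesis
        using ne unfolding y_def[symmetric]
        by (simp add: Let_def l_def a1_def a2_def a3_def a4_def)
    qed
    finally show ?thesis using eqzw eqw uz by simp
  next
    case 5
    define f1 where "f1 = wp L z"
    define f2 where "f2 = wp L w"
    define f1' where "f1' = wp_deriv L z"
    define f2' where "f2' = wp_deriv L w"
    define y1 where "y1 = (f1' - a1 * (f1 - B) - a3) / 2"
    define y2 where "y2 = (f2' - a1 * (f2 - B) - a3) / 2"
    have ne: "f1 \<noteq> f2" using wp_eq_iff[OF 5(1,2)] 5 by (simp add: f1_def f2_def)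
    define m where "m = (f1' - f2') / (f1 - f2)"
    define l where "l = (y2 - y1) / ((f2 - B) - (f1 - B))"
    have lm: "l = (m - a1) / 2"
    proof -
      have "y2 - y1 = ((f2' - f1') - a1 * (f2 - f1)) / 2"
        by (simp add: y1_def y2_def field_simps)
      moreover have "m = (f2' - f1') / (f2 - f1)"
        unfolding m_def by (metis minus_diff_eq minus_divide_divide)
      moreover have "(f2 - B) - (f1 - B) = f2 - f1" by simp
      moreover have "(D - a * d) / 2 / d = (D / d - a) / 2" if "d \<noteq> 0" for D a d :: complex
        using that by (simp add: field_simps)
      moreover have "f2 - f1 \<noteq> 0" using ne by simp
      ultimately show ?thesis unfolding l_def by metis
    qed
    have u: "unif E L z = Pt (f1 - B) y1" "unif E L w = Pt (f2 - B) y2"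
      using 5 by (simp_all add: unif_nonzero f1_def f1'_def f2_def f2'_def y1_def y2_def B_def a1_def a3_def)
    have "unif E L (z + w) = Pt (wp L (z + w) - B) ((wp_deriv L (z + w) - a1 * (wp L (z + w) - B) - a3) / 2)"
      using 5 by (simp add: unif_nonzero B_def a1_def a3_def)
    also have "\<dots> = Pt (l ^ 2 + a1 * l - a2 - (f1 - B) - (f2 - B))
        (- (l + a1) * (l ^ 2 + a1 * l - a2 - (f1 - B) - (f2 - B)) - ((f1' - a1 * (f1 - B) - a3) / 2 - l * (f1 - B)) - a3)"
      by (rule step[OF lm]) (use wp_add[OF 5] in \<open>simp_all add: m_def f1_def f1'_def f2_def f2'_def\<close>)
    also have "\<dots> = ec_add (complexify E) (Pt (f1 - B) y1) (Pt (f2 - B) y2)"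
      using ne unfolding y1_def[symmetric]
      by (simp add: Let_def l_def a1_def a2_def a3_def)
    finally show ?thesis using u by simp
  qed
qed

lemma unif_lincomb:
  assumes g2: "g2 L = of_real (c4 E / 12)"
  shows "ec_lincomb (complexify E) n v (\<lambda>i. unif E L (z i)) = unif E L (\<Sum>i<n. of_int (v i) * z i)"
proof -
  have nmult: "ec_nmult (complexify E) k (unif E L x) = unif E L (of_nat k * x)" for k x
  proof (induction k)
    case (Suc k)
    thus ?case using unif_add[OF g2, of x "of_nat k * x"] by (simp add: algebra_simps)
  qed (simp add: unif_zero)
  have imult: "ec_imult (complexify E) m (unif E L x) = unif E L (of_int m * x)" for m x
  proof (cases "m \<ge> 0")
    case False
    hence "complex_of_nat (nat (- m)) = - of_int m" by (simp add: of_nat_nat)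
    thus ?thesis using False by (simp add: ec_imult_def nmult flip: unif_neg)
  qed (simp add: ec_imult_def nmult of_nat_nat)
  have "foldr (\<lambda>i acc. ec_add (complexify E) (ec_imult (complexify E) (v i) (unif E L (z i))) acc) xs Inf =
     unif E L (\<Sum>i\<leftarrow>xs. of_int (v i) * z i)" for xs
    by (induction xs) (simp_all add: unif_zero imult unif_add[OF g2])
  moreover have "(\<Sum>i\<leftarrow>[0..<n]. of_int (v i) * z i) = (\<Sum>i<n. of_int (v i) * z i)"
    by (simp add: interv_sum_list_conv_sum_set_nat atLeast0LessThan)
  ultimately show ?thesis by (simp add: ec_lincomb_def)
qed

text \<open>Turns the algebraic hypothesis of independence into a statement about sums of elliptic
  logarithms modulo \<open>L\<close>.\<close>

lemma lincomb_eq_Inf_iff: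
  assumes g2: "g2 L = of_real (c4 E / 12)"
    and zs: "\<forall>i<n. unif E L (z i) = map_pt complex_of_real (P i)"
  shows "ec_lincomb E n v P = Inf \<longleftrightarrow> (\<Sum>i<n. of_int (v i) * z i) \<in> L"
proof -
  have "ec_lincomb E n v P = Inf \<longleftrightarrow> map_pt complex_of_real (ec_lincomb E n v P) = Inf" by simp
  also have "map_pt complex_of_real (ec_lincomb E n v P) = ec_lincomb (complexify E) n v (\<lambda>i. map_pt complex_of_real (P i))"
    by (rule map_pt_ec_lincomb)
  also have "\<dots> = ec_lincomb (complexify E) n v (\<lambda>i. unif E L (z i))"
    unfolding ec_lincomb_def by (rule foldr_cong) (use zs in auto)
  also have "\<dots> = unif E L (\<Sum>i<n. of_int (v i) * z i)"
    by (rule unif_lincomb[OF g2])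
  finally show ?thesis by (simp add: unif_eq_Inf_iff)
qed

end

section \<open>The Tate series\<close>

locale tate =
  fixes q :: real
  assumes q_nz: "0 < \<bar>q\<bar>" and q_less: "\<bar>q\<bar> < 1"
begin

abbreviation Q :: complex where "Q \<equiv> complex_of_real q"

text \<open>For negative \<open>q\<close> the principal logarithm has imaginary part pi, so the
  lattice spanned with the period of \<open>exp\<close> is not rectangular; in both cases it is the
  preimage of the powers of \<open>q\<close> under \<open>exp\<close>.\<close>

definition ell :: complex where "ell = Ln Q"

definition Lam :: "complex set" where
  "Lam = {of_int m * (2 * of_real pi * \<i>) + of_int n * ell | m n. True}"

lemma Q_nz [simp]: "Q \<noteq> 0" "q \<noteq> 0" using q_nz by auto

lemma exp_ell: "exp ell = Q" by (simp add: ell_def)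

lemma Re_ell: "Re ell = ln \<bar>q\<bar>" by (simp add: ell_def Re_Ln)

sublocale lam: cplx_lattice "2 * of_real pi * \<i>" ell Lam
proof
  have "ln \<bar>q\<bar> \<noteq> 0" using q_nz q_less by simp
  thus "Im (ell / (2 * of_real pi * \<i>)) \<noteq> 0"
    using Re_ell by (simp add: Im_divide power2_eq_square)
qed (simp add: Lam_def)

lemma exp_of_int_ell: "exp (of_int n * ell) = Q powi n"
  using exp_power_int[of ell n] by (simp add: exp_ell)

lemma Lam_iff: "z \<in> Lam \<longleftrightarrow> (\<exists>n. exp z = Q powi n)"
proof
  assume "z \<in> Lam"
  then obtain m n where "z = of_int m * (2 * of_real pi * \<i>) + of_int n * ell"
    by (rule lam.L_memE)
  hence "exp z = exp (2 * of_real pi * of_int m * \<i>) * exp (of_int n * ell)"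
    by (simp add: exp_add mult_ac)
  also have "exp (2 * of_real pi * of_int m * \<i>) = 1"
    using exp_integer_2pi[of "of_int m"] by (simp add: mult_ac)
  finally show "\<exists>n. exp z = Q powi n" by (auto simp: exp_of_int_ell)
next
  assume "\<exists>n. exp z = Q powi n"
  then obtain n where "exp z = exp (of_int n * ell)" by (auto simp: exp_of_int_ell)
  then obtain m where "z = of_int n * ell + (of_int (2 * m) * of_real pi) * \<i>"
    by (auto simp: exp_eq)
  hence "z = of_int m * (2 * of_real pi * \<i>) + of_int n * ell" by (simp add: algebra_simps)
  thus "z \<in> Lam" by (metis lam.L_memI)
qed

lemma Q_pow_exp_neq:
  assumes "z \<notin> Lam"
  shows "Q ^ n * exp z \<noteq> 1" "Q ^ n * exp (- z) \<noteq> 1"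
proof -
  show "Q ^ n * exp z \<noteq> 1"
  proof
    assume "Q ^ n * exp z = 1"
    hence "exp z = Q powi (- int n)" by (simp add: power_int_minus field_simps)
    thus False using assms Lam_iff by blast
  qed
  show "Q ^ n * exp (- z) \<noteq> 1"
  proof
    assume "Q ^ n * exp (- z) = 1"
    hence "exp z = Q powi (int n)" by (simp add: exp_minus field_simps)
    thus False using assms Lam_iff by blast
  qed
qed

text \<open>A function vanishing to first order at 0 is summable along \<open>Q ^ n * x\<close>. The
  radius 1/2 keeps the arguments away from the pole at 1, and uniformity for bounded
  \<open>x\<close> is what differentiation requires.\<close>

lemma geometric_dominated:
  fixes F :: "complex \<Rightarrow> complex"
  assumes bound: "\<And>x. norm x \<le> 1 / 2 \<Longrightarrow> norm (F x) \<le> C * norm x" and C: "C \<ge> 0"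
  shows "\<forall>\<^sub>F n in sequentially. \<forall>x. norm x \<le> B \<longrightarrow> norm (F (Q ^ (n + m) * x)) \<le> (C * B) * \<bar>q\<bar> ^ n"
proof -
  have "(\<lambda>n. \<bar>q\<bar> ^ n) \<longlonglongrightarrow> 0"
    using q_less by (intro LIMSEQ_power_zero) auto
  hence "(\<lambda>n. \<bar>q\<bar> ^ n * \<bar>B\<bar>) \<longlonglongrightarrow> 0 * \<bar>B\<bar>" by (rule tendsto_mult[OF _ tendsto_const])
  hence "\<forall>\<^sub>F n in sequentially. \<bar>q\<bar> ^ n * \<bar>B\<bar> < 1 / 2"
    by (rule order_tendstoD) auto
  thus ?thesis
  proof eventually_elim
    case (elim n)
    show ?case
    proof clarify
      fix x :: complex assume x: "norm x \<le> B"
      have "norm (Q ^ (n + m) * x) = \<bar>q\<bar> ^ (n + m) * norm x"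
        by (simp add: norm_mult norm_power)
      also have "\<dots> \<le> \<bar>q\<bar> ^ n * B"
        using q_nz q_less x by (intro mult_mono power_decreasing) (auto intro: order_trans[OF norm_ge_zero])
      finally have le: "norm (Q ^ (n + m) * x) \<le> \<bar>q\<bar> ^ n * B" .
      also have "\<dots> \<le> \<bar>q\<bar> ^ n * \<bar>B\<bar>" by (intro mult_left_mono) auto
      also have "\<dots> \<le> 1 / 2" using elim by simp
      finally have "norm (F (Q ^ (n + m) * x)) \<le> C * norm (Q ^ (n + m) * x)" by (rule bound)
      also have "\<dots> \<le> C * (\<bar>q\<bar> ^ n * B)" by (intro mult_left_mono le C)
      finally show "norm (F (Q ^ (n + m) * x)) \<le> (C * B) * \<bar>q\<bar> ^ n" by (simp add: mult_ac)
    qed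
  qed
qed

lemma geometric_summable:
  fixes F :: "complex \<Rightarrow> complex"
  assumes "\<And>x. norm x \<le> 1 / 2 \<Longrightarrow> norm (F x) \<le> C * norm x" "C \<ge> 0"
  shows "summable (\<lambda>n. norm (F (Q ^ (n + m) * x)))"
proof (rule summable_comparison_test_ev)
  show "summable (\<lambda>n. (C * norm x) * \<bar>q\<bar> ^ n)"
    using q_less by (intro summable_mult summable_geometric) auto
  have "\<forall>\<^sub>F n in sequentially. \<forall>y. norm y \<le> norm x \<longrightarrow> norm (F (Q ^ (n + m) * y)) \<le> (C * norm x) * \<bar>q\<bar> ^ n"
    by (intro geometric_dominated assms)
  thus "\<forall>\<^sub>F n in sequentially. norm (norm (F (Q ^ (n + m) * x))) \<le> (C * norm x) * \<bar>q\<bar> ^ n"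
    by eventually_elim auto
qed

text \<open>Differentiation in \<open>z\<close> acts on \<open>F\<close> as x d/dx. The parameters
  \<open>m\<close> in {0, 1} and \<open>c\<close> in {1, -1} cover the two halves of a series over
  all integral powers of \<open>q\<close>.\<close>

lemma geometric_series_deriv:
  fixes F F' :: "complex \<Rightarrow> complex"
  assumes bound: "\<And>x. norm x \<le> 1 / 2 \<Longrightarrow> norm (F x) \<le> C * norm x" "C \<ge> 0"
    and der: "\<And>x. x \<noteq> 1 \<Longrightarrow> (F has_field_derivative F' x) (at x)"
    and S: "open S" and z: "z \<in> S"
    and ne: "\<And>n z. z \<in> S \<Longrightarrow> Q ^ (n + m) * exp (c * z) \<noteq> 1"
  shows "((\<lambda>z. \<Sum>n. F (Q ^ (n + m) * exp (c * z))) has_field_derivative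
     (\<Sum>n. c * (Q ^ (n + m) * exp (c * z) * F' (Q ^ (n + m) * exp (c * z))))) (at z)"
proof -
  have "\<exists>g g'. \<forall>z \<in> S. ((\<lambda>n. F (Q ^ (n + m) * exp (c * z))) sums g z) \<and>
     ((\<lambda>n. c * (Q ^ (n + m) * exp (c * z) * F' (Q ^ (n + m) * exp (c * z)))) sums g' z) \<and>
      (g has_field_derivative g' z) (at z)"
  proof (rule series_and_derivative_comparison_local[OF S])
    fix n z assume z: "z \<in> S"
    have 1: "((\<lambda>z. Q ^ (n + m) * exp (c * z)) has_field_derivative Q ^ (n + m) * (exp (c * z) * c)) (at z)"
      by (auto intro!: derivative_eq_intros)
    have "((\<lambda>z. F (Q ^ (n + m) * exp (c * z))) has_field_derivative
       F' (Q ^ (n + m) * exp (c * z)) * (Q ^ (n + m) * (exp (c * z) * c))) (at z)"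
      by (rule DERIV_chain2[OF der[OF ne[OF z]] 1])
    thus "((\<lambda>z. F (Q ^ (n + m) * exp (c * z))) has_field_derivative
       c * (Q ^ (n + m) * exp (c * z) * F' (Q ^ (n + m) * exp (c * z)))) (at z)"
      by (simp add: mult_ac)
  next
    fix z :: complex
    define B where "B = exp (norm c * (norm z + 1))"
    have "\<forall>\<^sub>F n in sequentially. \<forall>x. norm x \<le> B \<longrightarrow> norm (F (Q ^ (n + m) * x)) \<le> (C * B) * \<bar>q\<bar> ^ n"
      by (intro geometric_dominated bound)
    hence "\<forall>\<^sub>F n in sequentially. \<forall>y\<in>ball z 1 \<inter> S. norm (F (Q ^ (n + m) * exp (c * y))) \<le> (C * B) * \<bar>q\<bar> ^ n"
    proof eventually_elim
      case (elim n)
      have "norm (exp (c * y)) \<le> B" if "y \<in> ball z 1" for y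
      proof -
        have "norm y \<le> norm z + 1"
          using that norm_triangle_ineq2[of y z] by (simp add: dist_norm norm_minus_commute)
        hence "norm (c * y) \<le> norm c * (norm z + 1)"
          by (simp add: norm_mult mult_left_mono)
        thus ?thesis
          unfolding B_def by (meson exp_le_cancel_iff norm_exp order_trans)
      qed
      thus ?case using elim by auto
    qed
    thus "\<exists>d h. 0 < d \<and> summable h \<and> (\<forall>\<^sub>F n in sequentially. \<forall>y\<in>ball z d \<inter> S. norm (F (Q ^ (n + m) * exp (c * y))) \<le> h n)"
      using q_less by (intro exI[of _ 1] exI[of _ "\<lambda>n. (C * B) * \<bar>q\<bar> ^ n"] conjI summable_mult summable_geometric) auto
  qed
  then obtain g g' where g: "\<And>z. z \<in> S \<Longrightarrow> ((\<lambda>n. F (Q ^ (n + m) * exp (c * z))) sums g z) \<and>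
     ((\<lambda>n. c * (Q ^ (n + m) * exp (c * z) * F' (Q ^ (n + m) * exp (c * z)))) sums g' z) \<and>
      (g has_field_derivative g' z) (at z)"
    by blast
  have "((\<lambda>z. \<Sum>n. F (Q ^ (n + m) * exp (c * z))) has_field_derivative g' z) (at z)"
    by (rule has_field_derivative_transform_within_open[where S = S and f = g])
       (use g z S in \<open>auto simp: sums_iff\<close>)
  thus ?thesis using g[OF z] by (simp add: sums_iff)
qed

text \<open>Each of \<open>F1\<close> and \<open>F2\<close> arises from its predecessor by x d/dx,
  that is, by differentiation with respect to the logarithm of x.\<close>

definition F0 :: "complex \<Rightarrow> complex" where "F0 x = x / (1 - x)"
definition F1 :: "complex \<Rightarrow> complex" where "F1 x = x / (1 - x) ^ 2"
definition F2 :: "complex \<Rightarrow> complex" where "F2 x = x * (1 + x) / (1 - x) ^ 3"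

lemma norm_one_minus_ge: "norm x \<le> 1 / 2 \<Longrightarrow> norm (1 - x :: complex) \<ge> 1 / 2"
  using norm_triangle_ineq2[of 1 x] by simp

lemma F0_bound: "norm x \<le> 1 / 2 \<Longrightarrow> norm (F0 x) \<le> 2 * norm x"
proof -
  assume x: "norm x \<le> 1 / 2"
  have "norm (F0 x) = norm x / norm (1 - x)" by (simp add: F0_def norm_divide)
  also have "\<dots> \<le> norm x / (1 / 2)"
    using norm_one_minus_ge[OF x] by (intro divide_left_mono mult_pos_pos) auto
  finally show ?thesis by simp
qed

lemma F1_bound: "norm x \<le> 1 / 2 \<Longrightarrow> norm (F1 x) \<le> 4 * norm x"
proof -
  assume x: "norm x \<le> 1 / 2"
  have "(1 / 2) ^ 2 \<le> norm (1 - x) ^ 2"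
    using norm_one_minus_ge[OF x] by (intro power_mono) auto
  hence "norm x / norm (1 - x) ^ 2 \<le> norm x / (1 / 2) ^ 2"
    by (intro frac_le) auto
  thus ?thesis by (simp add: F1_def norm_divide norm_mult power2_eq_square)
qed

lemma F2_bound: "norm x \<le> 1 / 2 \<Longrightarrow> norm (F2 x) \<le> 16 * norm x"
proof -
  assume x: "norm x \<le> 1 / 2"
  have 1: "(1 / 2) ^ 3 \<le> norm (1 - x) ^ 3"
    using norm_one_minus_ge[OF x] by (intro power_mono) auto
  have 2: "norm (1 + x) \<le> 2" using norm_triangle_ineq[of 1 x] x by simp
  have "norm x * norm (1 + x) / norm (1 - x) ^ 3 \<le> norm x * 2 / (1 / 2) ^ 3"
    using 1 2 by (intro frac_le mult_mono) auto
  thus ?thesis by (simp add: F2_def norm_divide norm_power norm_mult eval_nat_numeral)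
qed

lemma F1_summable: "summable (\<lambda>n. norm (F1 (Q ^ (n + m) * x)))"
  by (rule geometric_summable[where C = 4]) (auto intro: F1_bound)

lemma F2_summable: "summable (\<lambda>n. norm (F2 (Q ^ (n + m) * x)))"
  by (rule geometric_summable[where C = 16]) (auto intro: F2_bound)

lemma F0_deriv: "x \<noteq> 1 \<Longrightarrow> (F0 has_field_derivative 1 / (1 - x) ^ 2) (at x)"
  unfolding F0_def[abs_def]
  by (auto intro!: derivative_eq_intros simp: power2_eq_square)

lemma F1_deriv:
  assumes "x \<noteq> 1"
  shows "(F1 has_field_derivative (1 + x) / (1 - x) ^ 3) (at x)"
proof -
  define y where "y = 1 - x"
  have y: "y \<noteq> 0" using assms by (simp add: y_def)
  have "(F1 has_field_derivative (1 * y ^ 2 - x * (2 * y * (-1))) / (y ^ 2 * y ^ 2)) (at x)"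
    unfolding F1_def[abs_def] y_def using assms
    by (auto intro!: derivative_eq_intros)
  also have "(1 * y ^ 2 - x * (2 * y * (-1))) / (y ^ 2 * y ^ 2) = (1 + x) / y ^ 3"
  proof -
    have "1 * y ^ 2 - x * (2 * y * (-1)) = y * (1 + x)" by (simp add: y_def power2_eq_square algebra_simps)
    thus ?thesis using y by (simp add: eval_nat_numeral)
  qed
  finally show ?thesis by (simp add: y_def)
qed

text \<open>The logarithmic derivative of the theta product \<open>T\<close> is \<open>logsum - 1/2\<close>, and \<open>X\<close> is, up to a constant, minus its
  derivative; the constant removes the constant term of \<open>X\<close> at the origin.\<close>
definition logsum :: "complex \<Rightarrow> complex" where
  "logsum z = - (\<Sum>n. F0 (Q ^ n * exp z)) + (\<Sum>n. F0 (Q ^ (n + 1) * exp (- z)))"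

definition X :: "complex \<Rightarrow> complex" where
  "X z = (\<Sum>n. F1 (Q ^ n * exp z)) + (\<Sum>n. F1 (Q ^ (n + 1) * exp (- z))) + 1 / 12 - 2 * of_real (tate_s 1 q)"

definition X' :: "complex \<Rightarrow> complex" where
  "X' z = (\<Sum>n. F2 (Q ^ n * exp z)) - (\<Sum>n. F2 (Q ^ (n + 1) * exp (- z)))"

lemma logsum_deriv:
  assumes "z \<notin> Lam"
  shows "(logsum has_field_derivative - X z + (1 / 12 - 2 * of_real (tate_s 1 q))) (at z)"
proof -
  have mul: "x * (1 / (1 - x) ^ 2) = F1 x" for x by (simp add: F1_def)
  have 1: "((\<lambda>z. \<Sum>n. F0 (Q ^ n * exp z)) has_field_derivative (\<Sum>n. F1 (Q ^ n * exp z))) (at z)"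
    using geometric_series_deriv[OF F0_bound _ F0_deriv lam.open_punctured, of z 0 1] assms Q_pow_exp_neq(1)
    by (simp only: mul) simp
  have "((\<lambda>z. \<Sum>n. F0 (Q ^ (n + 1) * exp (-1 * z))) has_field_derivative (\<Sum>n. - 1 * F1 (Q ^ (n + 1) * exp (-1 * z)))) (at z)"
    unfolding mul[symmetric]
    by (rule geometric_series_deriv[OF F0_bound _ F0_deriv lam.open_punctured])
       (use assms Q_pow_exp_neq(2)[of _ "_ + 1"] in auto)
  also have "(\<Sum>n. - 1 * F1 (Q ^ (n + 1) * exp (-1 * z))) = - 1 * (\<Sum>n. F1 (Q ^ (n + 1) * exp (-1 * z)))"
    by (intro suminf_mult summable_norm_cancel[OF F1_summable])
  finally have 2: "((\<lambda>z. \<Sum>n. F0 (Q ^ (n + 1) * exp (- z))) has_field_derivative - (\<Sum>n. F1 (Q ^ (n + 1) * exp (- z)))) (at z)"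
    by simp
  show ?thesis
    unfolding logsum_def[abs_def] X_def
    by (rule DERIV_cong[OF DERIV_add[OF DERIV_minus[OF 1] 2]]) simp
qed

lemma X_deriv:
  assumes "z \<notin> Lam"
  shows "(X has_field_derivative X' z) (at z)"
proof -
  have mul: "x * ((1 + x) / (1 - x) ^ 3) = F2 x" for x by (simp add: F2_def)
  have 1: "((\<lambda>z. \<Sum>n. F1 (Q ^ n * exp z)) has_field_derivative (\<Sum>n. F2 (Q ^ n * exp z))) (at z)"
    using geometric_series_deriv[OF F1_bound _ F1_deriv lam.open_punctured, of z 0 1] assms Q_pow_exp_neq(1)
    by (simp only: mul) simp
  have "((\<lambda>z. \<Sum>n. F1 (Q ^ (n + 1) * exp (-1 * z))) has_field_derivative (\<Sum>n. - 1 * F2 (Q ^ (n + 1) * exp (-1 * z)))) (at z)"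
    unfolding mul[symmetric]
    by (rule geometric_series_deriv[OF F1_bound _ F1_deriv lam.open_punctured])
       (use assms Q_pow_exp_neq(2)[of _ "_ + 1"] in auto)
  also have "(\<Sum>n. - 1 * F2 (Q ^ (n + 1) * exp (-1 * z))) = - 1 * (\<Sum>n. F2 (Q ^ (n + 1) * exp (-1 * z)))"
    by (intro suminf_mult summable_norm_cancel[OF F2_summable])
  finally have 2: "((\<lambda>z. \<Sum>n. F1 (Q ^ (n + 1) * exp (- z))) has_field_derivative - (\<Sum>n. F2 (Q ^ (n + 1) * exp (- z)))) (at z)"
    by simp
  show ?thesis
    unfolding X_def[abs_def] X'_def
    by (rule DERIV_cong[OF DERIV_diff[OF DERIV_add[OF DERIV_add[OF 1 2] DERIV_const] DERIV_const]]) simp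
qed

section \<open>Two-sided series and the coordinates of the Tate map\<close>

lemma infsum_int_split:
  fixes f :: "int \<Rightarrow> complex"
  assumes "summable (\<lambda>n. norm (f (int n)))" "summable (\<lambda>n. norm (f (- int (n + 1))))"
  shows "infsum f UNIV = (\<Sum>n. f (int n)) + (\<Sum>n. f (- int (n + 1)))" "f summable_on UNIV"
proof -
  have 1: "(f has_sum (\<Sum>n. f (int n))) (range int)"
    using norm_summable_imp_has_sum[OF assms(1) summable_sums[OF summable_norm_cancel[OF assms(1)]]]
    by (subst has_sum_reindex) (auto simp: o_def)
  have 2: "(f has_sum (\<Sum>n. f (- int (n + 1)))) (range (\<lambda>n. - int (n + 1)))"
    using norm_summable_imp_has_sum[OF assms(2) summable_sums[OF summable_norm_cancel[OF assms(2)]]]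
    by (subst has_sum_reindex) (auto simp: o_def inj_on_def)
  have "(f has_sum ((\<Sum>n. f (int n)) + (\<Sum>n. f (- int (n + 1))))) (range int \<union> range (\<lambda>n. - int (n + 1)))"
    by (rule has_sum_Un_disjoint[OF 1 2]) auto
  also have "range int \<union> range (\<lambda>n. - int (n + 1)) = UNIV"
  proof -
    have "x \<in> range int \<union> range (\<lambda>n. - int (n + 1))" for x
      by (cases x rule: int_cases) auto
    thus ?thesis by blast
  qed
  finally show "infsum f UNIV = (\<Sum>n. f (int n)) + (\<Sum>n. f (- int (n + 1)))" "f summable_on UNIV"
    by (auto simp: has_sum_iff)
qed

text \<open>Converts the terms of negative index into a series in positive powers of
  \<open>q\<close> times \<open>exp (- z)\<close>.\<close>

lemma F1_inverse: "x \<noteq> 0 \<Longrightarrow> F1 (inverse x) = F1 x"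
proof (cases "x = 1")
  case False
  assume "x \<noteq> 0"
  hence "1 - inverse x = (x - 1) / x" by (simp add: field_simps)
  thus ?thesis using \<open>x \<noteq> 0\<close> False
    by (simp add: F1_def power_divide power2_commute[of x 1] power2_eq_square[of x])
qed auto

lemma Q_powi_neg: "Q powi (- int (n + 1)) * exp z = inverse (Q ^ (n + 1) * exp (- z))"
  by (simp only: power_int_minus power_int_of_nat exp_minus inverse_mult_distrib inverse_inverse_eq)

lemma X_infsum: "X z = infsum (\<lambda>n::int. F1 (Q powi n * exp z)) UNIV + 1 / 12 - 2 * of_real (tate_s 1 q)"
proof -
  have neg: "F1 (Q powi (- int (n + 1)) * exp z) = F1 (Q ^ (n + 1) * exp (- z))" for n
    unfolding Q_powi_neg by (rule F1_inverse) auto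
  have "infsum (\<lambda>n::int. F1 (Q powi n * exp z)) UNIV =
     (\<Sum>n. F1 (Q powi int n * exp z)) + (\<Sum>n. F1 (Q powi (- int (n + 1)) * exp z))"
  proof (rule infsum_int_split(1))
    show "summable (\<lambda>n. norm (F1 (Q powi int n * exp z)))"
      using F1_summable[of 0 "exp z"] by simp
    show "summable (\<lambda>n. norm (F1 (Q powi (- int (n + 1)) * exp z)))"
      unfolding neg by (rule F1_summable)
  qed
  thus ?thesis unfolding neg by (simp add: X_def)
qed

lemma X_periodic: "w \<in> Lam \<Longrightarrow> X (z + w) = X z"
proof -
  assume "w \<in> Lam"
  then obtain k where k: "exp w = Q powi k" using Lam_iff by blast
  have "infsum (\<lambda>n::int. F1 (Q powi n * exp (z + w))) UNIV = infsum (\<lambda>n::int. F1 (Q powi n * exp z)) UNIV"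
    by (rule infsum_reindex_bij_witness[of _ "\<lambda>n. n - k" "\<lambda>n. n + k"])
       (auto simp: exp_add k power_int_add mult_ac)
  thus ?thesis by (simp add: X_infsum)
qed

lemma X'_periodic:
  assumes "w \<in> Lam" "z \<notin> Lam"
  shows "X' (z + w) = X' z"
proof -
  have "((\<lambda>z. X (z + w)) has_field_derivative X' (z + w)) (at z)"
    by (rule DERIV_shift[THEN iffD1, OF X_deriv]) (use assms in auto)
  thus ?thesis using X_deriv[OF assms(2)] X_periodic[OF assms(1)] DERIV_unique by simp
qed

text \<open>The terms of the second coordinate are \<open>(F2 - F1) / 2\<close> for nonnegative
  index; inversion turns those of negative index into \<open>(- F2 - F1) / 2\<close>. The signs are
  those of \<open>X'\<close> and \<open>X\<close>, so the second coordinate is half of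
  \<open>X'\<close> minus the first. The shift 1/12 makes the expansion of \<open>X\<close> start
  without a constant term.\<close>

lemma tate_map_exp:
  "tate_map q (exp z) = (if z \<in> Lam then Inf else Pt (X z - 1 / 12) ((X' z - (X z - 1 / 12)) / 2))"
proof (cases "z \<in> Lam")
  case True
  thus ?thesis using Lam_iff by (simp add: tate_map_def)
next
  case False
  have x: "infsum (\<lambda>n::int. Q powi n * exp z / (1 - Q powi n * exp z) ^ 2) UNIV - 2 * of_real (tate_s 1 q) = X z - 1 / 12"
    by (simp add: X_infsum F1_def)
  define G where "G = (\<lambda>x::complex. x ^ 2 / (1 - x) ^ 3)"
  define H where "H = (\<lambda>x::complex. - x / (1 - x) ^ 3)"
  have G: "G x = (F2 x - F1 x) / 2" if "x \<noteq> 1" for x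
  proof -
    define y where "y = 1 - x"
    have "y \<noteq> 0" "x = 1 - y" using that by (auto simp: y_def)
    thus ?thesis by (simp add: G_def F2_def F1_def divide_simps eval_nat_numeral) (simp add: algebra_simps)
  qed
  have H: "H x = (- F2 x - F1 x) / 2" if "x \<noteq> 1" for x
  proof -
    define y where "y = 1 - x"
    have "y \<noteq> 0" "x = 1 - y" using that by (auto simp: y_def)
    thus ?thesis by (simp add: H_def F2_def F1_def divide_simps eval_nat_numeral) (simp add: algebra_simps)
  qed
  have GH: "G (inverse x) = H x" if "x \<noteq> 1" "x \<noteq> 0" for x
  proof -
    have "1 - inverse x = (x - 1) / x" using that by (simp add: field_simps)
    moreover have "(x - 1) ^ 3 = - ((1 - x) ^ 3)" by (simp add: eval_nat_numeral algebra_simps)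
    ultimately have "G (inverse x) = inverse x ^ 2 / (- ((1 - x) ^ 3) / x ^ 3)"
      by (simp add: G_def power_divide)
    also have "\<dots> = H x"
    proof -
      have "inverse x ^ 2 * x ^ 3 = x" using that by (simp add: field_simps eval_nat_numeral)
      thus ?thesis by (simp add: H_def)
    qed
    finally show ?thesis .
  qed
  define f where "f = (\<lambda>n::int. G (Q powi n * exp z))"
  have ne: "Q ^ n * exp z \<noteq> 1" "Q ^ n * exp (- z) \<noteq> 1" for n
    using Q_pow_exp_neq[OF False] by auto
  have f1: "f (int n) = (F2 (Q ^ n * exp z) - F1 (Q ^ n * exp z)) / 2" for n
    unfolding f_def power_int_of_nat by (rule G[OF ne(1)])
  have f2: "f (- int (n + 1)) = (- F2 (Q ^ (n + 1) * exp (- z)) - F1 (Q ^ (n + 1) * exp (- z))) / 2" for n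
    unfolding f_def Q_powi_neg by (rule trans[OF GH[OF ne(2)] H[OF ne(2)]]) auto
  have s1: "summable (\<lambda>n. norm (F1 (Q ^ n * exp z)))" "summable (\<lambda>n. norm (F2 (Q ^ n * exp z)))"
    using F1_summable[of 0 "exp z"] F2_summable[of 0 "exp z"] by simp_all
  have s2: "summable (\<lambda>n. norm (F1 (Q ^ (n + 1) * exp (- z))))" "summable (\<lambda>n. norm (F2 (Q ^ (n + 1) * exp (- z))))"
    by (rule F1_summable, rule F2_summable)
  have nh: "norm ((a - b) / 2) \<le> norm b + norm a" for a b :: complex
    using norm_triangle_ineq4[of a b] norm_ge_zero[of a] norm_ge_zero[of b]
    unfolding norm_divide norm_numeral by linarith
  have n1: "summable (\<lambda>n. norm (f (int n)))"
    unfolding f1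
    by (rule summable_comparison_test_ev[OF always_eventually summable_add[OF s1]])
       (simp only: real_norm_def abs_norm_cancel, intro allI nh)
  have n2: "summable (\<lambda>n. norm (f (- int (n + 1))))"
    unfolding f2
    by (rule summable_comparison_test_ev[OF always_eventually summable_add[OF s2]])
       (simp only: real_norm_def abs_norm_cancel, intro allI order_trans[OF nh], simp)
  note S1 = summable_norm_cancel[OF s1(1)] summable_norm_cancel[OF s1(2)]
  note S2 = summable_norm_cancel[OF s2(1)] summable_norm_cancel[OF s2(2)]
  have "infsum f UNIV = (\<Sum>n. f (int n)) + (\<Sum>n. f (- int (n + 1)))"
    by (rule infsum_int_split(1)[OF n1 n2])
  also have "(\<Sum>n. f (int n)) = ((\<Sum>n. F2 (Q ^ n * exp z)) - (\<Sum>n. F1 (Q ^ n * exp z))) / 2"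
    unfolding f1 by (rule sums_unique[symmetric]) (intro sums_divide sums_diff summable_sums S1)
  also have "(\<Sum>n. f (- int (n + 1))) = (- (\<Sum>n. F2 (Q ^ (n + 1) * exp (- z))) - (\<Sum>n. F1 (Q ^ (n + 1) * exp (- z)))) / 2"
    unfolding f2 by (rule sums_unique[symmetric]) (intro sums_divide sums_diff sums_minus summable_sums S2)
  finally have i: "infsum f UNIV =
     ((\<Sum>n. F2 (Q ^ n * exp z)) - (\<Sum>n. F1 (Q ^ n * exp z))) / 2 +
     (- (\<Sum>n. F2 (Q ^ (n + 1) * exp (- z))) - (\<Sum>n. F1 (Q ^ (n + 1) * exp (- z)))) / 2" .
  have "(a - b) / 2 + (- c - d) / 2 + s = ((a - c) - (b + d + 1 / 12 - 2 * s - 1 / 12)) / 2" for a b c d s :: complex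
    by (simp add: field_simps)
  hence "infsum f UNIV + of_real (tate_s 1 q) = (X' z - (X z - 1 / 12)) / 2"
    unfolding i X_def X'_def by blast
  moreover have "f = (\<lambda>n::int. Q powi (2 * n) * exp z ^ 2 / (1 - Q powi n * exp z) ^ 3)"
    by (simp add: f_def G_def power_mult_distrib power_int_mult[of Q _ 2] mult.commute[of 2] fun_eq_iff power_int_mult)
  ultimately show ?thesis using False x Lam_iff by (simp add: tate_map_def)
qed

end

section \<open>Uniqueness for the Weierstrass differential equation\<close>

text \<open>The operator x d/dx keeps each power and multiplies its coefficient by \<open>n\<close>,
  on the same disc of convergence; it raises the index of a Lambert series by one.\<close>

lemma powser_euler:
  fixes c :: "nat \<Rightarrow> complex"
  assumes conv: "\<And>x. norm x < K \<Longrightarrow> summable (\<lambda>n. c n * x ^ n)" and x: "norm x < K"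
  shows "summable (\<lambda>n. of_nat n * c n * x ^ n)"
    and "\<exists>D. ((\<lambda>x. \<Sum>n. c n * x ^ n) has_field_derivative D) (at x) \<and> x * D = (\<Sum>n. of_nat n * c n * x ^ n)"
proof -
  have s: "summable (\<lambda>n. diffs c n * x ^ n)"
    by (rule termdiff_converges[OF x conv])
  have e: "x * (diffs c n * x ^ n) = of_nat (Suc n) * c (Suc n) * x ^ Suc n" for n
    by (simp add: diffs_def)
  have "summable (\<lambda>n. of_nat (Suc n) * c (Suc n) * x ^ Suc n)"
    using summable_mult[OF s, of x] by (simp only: e)
  thus s': "summable (\<lambda>n. of_nat n * c n * x ^ n)"
    by (subst (asm) summable_Suc_iff)
  have "x * (\<Sum>n. diffs c n * x ^ n) = (\<Sum>n. of_nat (Suc n) * c (Suc n) * x ^ Suc n)"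
    using suminf_mult[OF s, of x] by (simp only: e)
  also have "\<dots> = (\<Sum>n. of_nat n * c n * x ^ n)"
    using suminf_split_head[OF s'] by simp
  finally have "x * (\<Sum>n. diffs c n * x ^ n) = (\<Sum>n. of_nat n * c n * x ^ n)" .
  moreover have "((\<lambda>x. \<Sum>n. c n * x ^ n) has_field_derivative (\<Sum>n. diffs c n * x ^ n)) (at x)"
    by (rule termdiffs_strong'[where K = K]) (use conv x in auto)
  ultimately show "\<exists>D. ((\<lambda>x. \<Sum>n. c n * x ^ n) has_field_derivative D) (at x) \<and> x * D = (\<Sum>n. of_nat n * c n * x ^ n)"
    by blast
qed

text \<open>\<open>P\<close> grows like \<open>1 / z ^ 2\<close>, so multiplying the limit by
  \<open>z ^ 4\<close>, \<open>z ^ 2\<close> and 1 in turn isolates one coefficient at a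
  time.\<close>

lemma quadratic_pole_coeffs_zero:
  fixes P :: "complex \<Rightarrow> complex"
  assumes P: "((\<lambda>z. z ^ 2 * P z) \<longlongrightarrow> 1) (at 0)"
    and lim: "((\<lambda>z. \<alpha> * P z ^ 2 + \<beta> * P z + \<gamma>) \<longlongrightarrow> 0) (at 0)"
  shows "\<alpha> = 0" "\<beta> = 0" "\<gamma> = 0"
proof -
  have z: "((\<lambda>z::complex. z) \<longlongrightarrow> 0) (at 0)" by (rule tendsto_ident_at)
  have "((\<lambda>z. z ^ 4 * (\<alpha> * P z ^ 2 + \<beta> * P z + \<gamma>)) \<longlongrightarrow> 0 ^ 4 * 0) (at 0)"
    by (intro tendsto_mult tendsto_power z lim)
  moreover have "((\<lambda>z. \<alpha> * (z ^ 2 * P z) ^ 2 + z ^ 2 * (\<beta> * (z ^ 2 * P z)) + \<gamma> * z ^ 4) \<longlongrightarrow> \<alpha> * 1 ^ 2 + 0 ^ 2 * (\<beta> * 1) + \<gamma> * 0 ^ 4) (at 0)"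
    by (intro tendsto_mult tendsto_add tendsto_power tendsto_const z P)
  moreover have "z ^ 4 * (\<alpha> * P z ^ 2 + \<beta> * P z + \<gamma>) = \<alpha> * (z ^ 2 * P z) ^ 2 + z ^ 2 * (\<beta> * (z ^ 2 * P z)) + \<gamma> * z ^ 4" for z
    by (simp add: algebra_simps power_mult_distrib eval_nat_numeral)
  ultimately have "0 ^ 4 * 0 = \<alpha> * 1 ^ 2 + 0 ^ 2 * (\<beta> * 1) + \<gamma> * 0 ^ 4"
    by (intro LIM_unique[of "\<lambda>z. z ^ 4 * (\<alpha> * P z ^ 2 + \<beta> * P z + \<gamma>)" _ 0]) auto
  thus a: "\<alpha> = 0" by simp
  have "((\<lambda>z. z ^ 2 * (\<alpha> * P z ^ 2 + \<beta> * P z + \<gamma>)) \<longlongrightarrow> 0 ^ 2 * 0) (at 0)"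
    by (intro tendsto_mult tendsto_power z lim)
  moreover have "((\<lambda>z. \<beta> * (z ^ 2 * P z) + \<gamma> * z ^ 2) \<longlongrightarrow> \<beta> * 1 + \<gamma> * 0 ^ 2) (at 0)"
    by (intro tendsto_mult tendsto_add tendsto_power tendsto_const z P)
  moreover have "z ^ 2 * (\<alpha> * P z ^ 2 + \<beta> * P z + \<gamma>) = \<beta> * (z ^ 2 * P z) + \<gamma> * z ^ 2" for z
    by (simp add: a algebra_simps)
  ultimately have "0 ^ 2 * 0 = \<beta> * 1 + \<gamma> * 0 ^ 2"
    by (intro LIM_unique[of "\<lambda>z. z ^ 2 * (\<alpha> * P z ^ 2 + \<beta> * P z + \<gamma>)" _ 0]) auto
  thus b: "\<beta> = 0" by simp
  show "\<gamma> = 0" using lim a b by (simp add: tendsto_const_iff)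
qed

text \<open>If the regular parts differ, their difference is \<open>H w * w ^ n\<close> with
  \<open>H 0\<close> nonzero. Subtracting the two equations and comparing leading terms at 0 yields
  \<open>- 4 * n = 12\<close>, impossible for a natural number \<open>n\<close>.\<close>

lemma weierstrass_ode_unique:
  fixes f g f' g' k l :: "complex \<Rightarrow> complex"
  assumes r: "r > 0" and k: "k holomorphic_on ball 0 r" and l: "l holomorphic_on ball 0 r"
    and f: "\<And>z. z \<in> ball 0 r - {0} \<Longrightarrow> f z = 1 / z ^ 2 + k z"
    and g: "\<And>z. z \<in> ball 0 r - {0} \<Longrightarrow> g z = 1 / z ^ 2 + l z"
    and f': "\<And>z. z \<in> ball 0 r - {0} \<Longrightarrow> (f has_field_derivative f' z) (at z)"
    and g': "\<And>z. z \<in> ball 0 r - {0} \<Longrightarrow> (g has_field_derivative g' z) (at z)"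
    and fo: "\<And>z. z \<in> ball 0 r - {0} \<Longrightarrow> f' z ^ 2 = 4 * f z ^ 3 - a * f z - b"
    and go: "\<And>z. z \<in> ball 0 r - {0} \<Longrightarrow> g' z ^ 2 = 4 * g z ^ 3 - a * g z - b"
    and z: "z \<in> ball 0 r"
  shows "k z = l z"
proof (rule ccontr)
  assume neq: "k z \<noteq> l z"
  define h where "h = (\<lambda>z. k z - l z)"
  have hol: "h holomorphic_on ball 0 r" unfolding h_def by (intro holomorphic_intros k l)
  have ex: "\<exists>w\<in>ball 0 r. h w \<noteq> 0" using neq z by (auto simp: h_def)
  have r0: "0 \<in> ball (0::complex) r" using r by simp
  note zor = zorder_exist_zero[OF hol open_ball connected_ball r0 ex]
  from zor obtain s where s: "s > 0" "cball (0::complex) s \<subseteq> ball 0 r" "zor_poly h 0 holomorphic_on cball 0 s"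
    "\<And>w. w \<in> cball 0 s \<Longrightarrow> h w = zor_poly h 0 w * (w - 0) ^ nat (zorder h 0) \<and> zor_poly h 0 w \<noteq> 0"
    by blast
  define n where "n = nat (zorder h 0)"
  define H where "H = zor_poly h 0"
  have H: "H holomorphic_on ball 0 s" using s(3) unfolding H_def by (rule holomorphic_on_subset) auto
  have hH: "h w = H w * w ^ n" "H w \<noteq> 0" if "w \<in> ball 0 s" for w
    using s(4)[of w] that by (auto simp: H_def n_def)
  define k' where "k' = deriv k" define l' where "l' = deriv l" define H' where "H' = deriv H"
  have kd: "(k has_field_derivative k' w) (at w)" if "w \<in> ball 0 r" for w
    unfolding k'_def by (rule holomorphic_derivI[OF k open_ball that])
  have ld: "(l has_field_derivative l' w) (at w)" if "w \<in> ball 0 r" for w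
    unfolding l'_def by (rule holomorphic_derivI[OF l open_ball that])
  have Hd: "(H has_field_derivative H' w) (at w)" if "w \<in> ball 0 s" for w
    unfolding H'_def by (rule holomorphic_derivI[OF H open_ball that])
  have f'_eq: "f' w = - 2 / w ^ 3 + k' w" if w: "w \<in> ball 0 r - {0}" for w
  proof -
    have "((\<lambda>z. 1 / z ^ 2 + k z) has_field_derivative - 2 / w ^ 3 + k' w) (at w)"
      using w by (auto intro!: derivative_eq_intros kd simp: field_simps eval_nat_numeral)
    hence "(f has_field_derivative - 2 / w ^ 3 + k' w) (at w)"
      by (rule has_field_derivative_transform_within_open[where S = "ball 0 r - {0}"]) (use w f in auto)
    thus ?thesis using DERIV_unique f'[OF w] by blast
  qed
  have g'_eq: "g' w = - 2 / w ^ 3 + l' w" if w: "w \<in> ball 0 r - {0}" for w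
  proof -
    have "((\<lambda>z. 1 / z ^ 2 + l z) has_field_derivative - 2 / w ^ 3 + l' w) (at w)"
      using w by (auto intro!: derivative_eq_intros ld simp: field_simps eval_nat_numeral)
    hence "(g has_field_derivative - 2 / w ^ 3 + l' w) (at w)"
      by (rule has_field_derivative_transform_within_open[where S = "ball 0 r - {0}"]) (use w g in auto)
    thus ?thesis using DERIV_unique g'[OF w] by blast
  qed
  have sr: "ball 0 s \<subseteq> ball (0::complex) r" using s(2) by auto
  \<comment> \<open>The difference of the two equations, factored as differences of squares and
    cubes, multiplied by \<open>w ^ 4\<close> to clear the poles and divided by
    \<open>w ^ n\<close>; both sides are then continuous at 0.\<close>
  have key: "(- 4 + w ^ 3 * (k' w + l' w)) * (of_nat n * H w + w * H' w) =
      (4 * ((1 + w ^ 2 * k w) ^ 2 + (1 + w ^ 2 * k w) * (1 + w ^ 2 * l w) + (1 + w ^ 2 * l w) ^ 2) - a * w ^ 4) * H w"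
    if w: "w \<in> ball 0 s - {0}" for w
  proof -
    have w0: "w \<noteq> 0" and wr: "w \<in> ball 0 r - {0}" using w sr by auto
    have hw: "k w - l w = H w * w ^ n" using hH(1)[of w] w by (simp add: h_def)
    have "(h has_field_derivative k' w - l' w) (at w)"
      unfolding h_def by (intro DERIV_diff kd ld) (use wr in auto)
    moreover have "(h has_field_derivative H' w * w ^ n + of_nat n * w ^ (n - 1) * H w) (at w)"
    proof -
      have "((\<lambda>w. H w * w ^ n) has_field_derivative H' w * w ^ n + of_nat n * w ^ (n - 1) * H w) (at w)"
        using w by (auto intro!: derivative_eq_intros Hd)
      thus ?thesis
        by (rule has_field_derivative_transform_within_open[where S = "ball 0 s"]) (use w hH in auto)
    qed
    ultimately have "k' w - l' w = H' w * w ^ n + of_nat n * w ^ (n - 1) * H w" by (rule DERIV_unique)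
    hence "w * (k' w - l' w) = w * H' w * w ^ n + of_nat n * (w * w ^ (n - 1)) * H w" by (simp add: algebra_simps)
    also have "of_nat n * (w * w ^ (n - 1)) = of_nat n * w ^ n" by (cases n) auto
    finally have hd: "w * (k' w - l' w) = w ^ n * (of_nat n * H w + w * H' w)" by (simp add: algebra_simps)
    have fw: "w ^ 2 * f w = 1 + w ^ 2 * k w" using f[OF wr] w0 by (simp add: field_simps)
    have gw: "w ^ 2 * g w = 1 + w ^ 2 * l w" using g[OF wr] w0 by (simp add: field_simps)
    have fw': "w ^ 3 * f' w = - 2 + w ^ 3 * k' w" using f'_eq[OF wr] w0 by (simp add: field_simps)
    have gw': "w ^ 3 * g' w = - 2 + w ^ 3 * l' w" using g'_eq[OF wr] w0 by (simp add: field_simps)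
    have 0: "(f' w + g' w) * (f' w - g' w) = (4 * (f w ^ 2 + f w * g w + g w ^ 2) - a) * (f w - g w)"
      using fo[OF wr] go[OF wr] by algebra
    have 1: "f' w - g' w = k' w - l' w" using f'_eq[OF wr] g'_eq[OF wr] by simp
    have 2: "f w - g w = k w - l w" using f[OF wr] g[OF wr] by simp
    have "w ^ n * ((- 4 + w ^ 3 * (k' w + l' w)) * (of_nat n * H w + w * H' w)) =
       (w ^ 3 * f' w + w ^ 3 * g' w) * (w * (k' w - l' w))"
      unfolding fw' gw' hd by (simp add: algebra_simps)
    also have "\<dots> = w ^ 4 * ((f' w + g' w) * (f' w - g' w))" unfolding 1 by algebra
    also have "\<dots> = (4 * ((w ^ 2 * f w) ^ 2 + (w ^ 2 * f w) * (w ^ 2 * g w) + (w ^ 2 * g w) ^ 2) - a * w ^ 4) * (k w - l w)"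
      unfolding 0 2 by algebra
    also have "\<dots> = w ^ n * ((4 * ((1 + w ^ 2 * k w) ^ 2 + (1 + w ^ 2 * k w) * (1 + w ^ 2 * l w) + (1 + w ^ 2 * l w) ^ 2) - a * w ^ 4) * H w)"
      unfolding fw gw hw by (simp only: mult_ac)
    finally show ?thesis using w0 mult_left_cancel[of "w ^ n"] by auto
  qed
  have c: "isCont F 0" if "F holomorphic_on ball 0 e" "e > 0" for F and e :: real
    using holomorphic_on_imp_continuous_on[OF that(1)] that(2)
    by (simp add: continuous_on_eq_continuous_at[OF open_ball])
  have cs: "isCont k 0" "isCont l 0" "isCont H 0" "isCont k' 0" "isCont l' 0" "isCont H' 0"
    unfolding k'_def l'_def H'_def
    by (rule c[OF k r] c[OF l r] c[OF H s(1)] c[OF holomorphic_deriv[OF k open_ball] r]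
        c[OF holomorphic_deriv[OF l open_ball] r] c[OF holomorphic_deriv[OF H open_ball] s(1)])+
  define A where "A = (\<lambda>w. (- 4 + w ^ 3 * (k' w + l' w)) * (of_nat n * H w + w * H' w))"
  define B where "B = (\<lambda>w. (4 * ((1 + w ^ 2 * k w) ^ 2 + (1 + w ^ 2 * k w) * (1 + w ^ 2 * l w) + (1 + w ^ 2 * l w) ^ 2) - a * w ^ 4) * H w)"
  have "isCont A 0" "isCont B 0"
    unfolding A_def B_def by (intro continuous_intros cs)+
  hence "(A \<longlongrightarrow> A 0) (at 0)" "(B \<longlongrightarrow> B 0) (at 0)" by (simp_all add: isCont_def)
  moreover have "eventually (\<lambda>w. w \<in> ball 0 s - {0}) (at (0::complex))"
    using s(1) by (intro eventually_at_in_open) auto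
  hence "eventually (\<lambda>w. A w = B w) (at 0)"
    by eventually_elim (use key in \<open>simp add: A_def B_def\<close>)
  ultimately have "A 0 = B 0"
    using LIM_unique Lim_transform_eventually by blast
  hence e: "- 4 * (of_nat n * H 0) = 12 * H 0" by (simp add: A_def B_def)
  have "H 0 * complex_of_nat (n * 4 + 12) = 12 * H 0 - (- 4 * (of_nat n * H 0))"
    by (simp add: algebra_simps)
  hence "complex_of_nat (n * 4 + 12) = 0" using hH(2)[of 0] s(1) unfolding e by simp
  thus False by (subst (asm) of_nat_eq_0_iff) simp
qed

section \<open>Expansion of the Tate series at the origin\<close>

context tate
begin

text \<open>On a neighbourhood of \<open>x = 1\<close> the operator \<open>x d/dx\<close> maps \<open>lambert j\<close> to \<open>lambert (j + 1)\<close>, so the Taylor coefficients of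
  the regular part of \<open>X\<close> are the values \<open>lambert j 1\<close>, which are the sums \<open>tate_s j q\<close>.\<close>
definition lambert :: "nat \<Rightarrow> complex \<Rightarrow> complex" where
  "lambert j x = (\<Sum>n. of_nat n ^ j * (Q ^ n / (1 - Q ^ n)) * x ^ n)"

lemma norm_Q_mult_less: "norm x < 1 / \<bar>q\<bar> \<Longrightarrow> norm (Q * x) < 1"
  using q_nz by (simp add: norm_mult field_simps)

text \<open>The radius \<open>1 / \<bar>q\<bar>\<close> exceeds 1, so the disc is a neighbourhood of
  the point 1 at which the derivatives will be evaluated.\<close>

lemma lambert_summable:
  "norm x < 1 / \<bar>q\<bar> \<Longrightarrow> summable (\<lambda>n. of_nat n ^ j * (Q ^ n / (1 - Q ^ n)) * x ^ n)"
proof (induction j arbitrary: x)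
  case 0
  have "summable (\<lambda>n. 1 / (1 - \<bar>q\<bar>) * norm (Q * x) ^ n)"
    using norm_Q_mult_less[OF 0] by (intro summable_mult summable_geometric) auto
  moreover have "norm (of_nat n ^ 0 * (Q ^ n / (1 - Q ^ n)) * x ^ n) \<le> 1 / (1 - \<bar>q\<bar>) * norm (Q * x) ^ n" for n
  proof (cases n)
    case (Suc m)
    have "\<bar>q\<bar> ^ n \<le> \<bar>q\<bar> ^ 1" using q_nz q_less Suc by (intro power_decreasing) auto
    hence "1 - \<bar>q\<bar> \<le> 1 - norm (Q ^ n)" by (simp add: norm_power)
    also have "\<dots> \<le> norm (1 - Q ^ n)" using norm_triangle_ineq2[of 1 "Q ^ n"] by simp
    finally have "1 / norm (1 - Q ^ n) \<le> 1 / (1 - \<bar>q\<bar>)"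
      using q_less by (intro frac_le) auto
    hence "1 / norm (1 - Q ^ n) * norm (Q * x) ^ n \<le> 1 / (1 - \<bar>q\<bar>) * norm (Q * x) ^ n"
      by (intro mult_right_mono) auto
    thus ?thesis by (simp add: norm_mult norm_divide norm_power power_mult_distrib)
  \<comment> \<open>The term \<open>n = 0\<close> has denominator \<open>1 - Q ^ 0 = 0\<close> and
    is therefore 0 by the convention for division.\<close>
  qed (use q_less in auto)
  ultimately show ?case by (rule summable_comparison_test'[where N = 0])
next
  case (Suc j)
  have "summable (\<lambda>n. of_nat n * (of_nat n ^ j * (Q ^ n / (1 - Q ^ n))) * x ^ n)"
    by (rule powser_euler(1)[where K = "1 / \<bar>q\<bar>"]) (use Suc in auto)
  thus ?case by (simp add: mult_ac)
qed

lemma lambert_deriv: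
  assumes "norm (exp (c * z)) < 1 / \<bar>q\<bar>"
  shows "((\<lambda>z. lambert j (exp (c * z))) has_field_derivative c * lambert (Suc j) (exp (c * z))) (at z)"
proof -
  obtain D where D: "((\<lambda>x. \<Sum>n. of_nat n ^ j * (Q ^ n / (1 - Q ^ n)) * x ^ n) has_field_derivative D) (at (exp (c * z)))"
    "exp (c * z) * D = (\<Sum>n. of_nat n * (of_nat n ^ j * (Q ^ n / (1 - Q ^ n))) * exp (c * z) ^ n)"
    using powser_euler(2)[OF lambert_summable[of _ j] assms] by blast
  have D2: "exp (c * z) * D = lambert (Suc j) (exp (c * z))"
    unfolding D(2) lambert_def by (simp add: mult_ac)
  have "(lambert j has_field_derivative D) (at (exp (c * z)))"
    using D(1) by (simp add: lambert_def[abs_def])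
  moreover have "((\<lambda>z. exp (c * z)) has_field_derivative exp (c * z) * c) (at z)"
    by (auto intro!: derivative_eq_intros)
  ultimately have "((\<lambda>z. lambert j (exp (c * z))) has_field_derivative D * (exp (c * z) * c)) (at z)"
    by (rule DERIV_chain2)
  also have "D * (exp (c * z) * c) = c * (exp (c * z) * D)" by simp
  also have "\<dots> = c * lambert (Suc j) (exp (c * z))" unfolding D2 ..
  finally show ?thesis .
qed

lemma lambert_one: "j > 0 \<Longrightarrow> lambert j 1 = of_real (tate_s j q)"
proof -
  assume j: "j > 0"
  have lt: "norm (1::complex) < 1 / \<bar>q\<bar>" using q_nz q_less by simp
  have s: "summable (\<lambda>n. complex_of_nat n ^ j * (Q ^ n / (1 - Q ^ n)))"
    using lambert_summable[OF lt, of j] by simp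
  have "lambert j 1 = (\<Sum>n. of_nat n ^ j * (Q ^ n / (1 - Q ^ n)))" by (simp add: lambert_def)
  also have "\<dots> = (\<Sum>n. of_nat (Suc n) ^ j * (Q ^ Suc n / (1 - Q ^ Suc n)))"
    using suminf_split_head[OF s] j by simp
  also have "\<dots> = (\<Sum>n. complex_of_real (real (Suc n) ^ j * q ^ Suc n / (1 - q ^ Suc n)))"
    by simp
  also have "\<dots> = of_real (tate_s j q)"
  proof -
    have "summable (\<lambda>n. complex_of_nat (Suc n) ^ j * (Q ^ Suc n / (1 - Q ^ Suc n)))"
      using s by (subst summable_Suc_iff)
    hence "summable (\<lambda>n. complex_of_real (real (Suc n) ^ j * q ^ Suc n / (1 - q ^ Suc n)))"
      by simp
    hence "summable (\<lambda>n. real (Suc n) ^ j * q ^ Suc n / (1 - q ^ Suc n))"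
      by (subst (asm) summable_complex_of_real)
    thus ?thesis unfolding tate_s_def by (rule suminf_of_real[symmetric])
  qed
  finally show ?thesis .
qed

section \<open>Interchange of the double geometric series\<close>

lemma F1_sums:
  assumes "norm y < 1"
  shows "(\<lambda>m. of_nat (Suc m) * y ^ Suc m) sums F1 y"
proof -
  have "(\<lambda>m. y * (of_nat (Suc m) * y ^ m)) sums (y * (1 / (1 - y) ^ 2))"
    by (intro sums_mult geometric_deriv_sums assms)
  thus ?thesis by (simp add: F1_def mult_ac)
qed

text \<open>Expand \<open>F1 y\<close> as the sum of m y^m and sum over the powers of
  \<open>Q\<close> first: for fixed m this is a geometric series in \<open>Q ^ m\<close>. Absolute
  convergence of the double family justifies the exchange.\<close>

lemma sum_F1_eq_lambert:
  assumes x: "norm x < 1 / \<bar>q\<bar>"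
  shows "(\<Sum>n. F1 (Q ^ (n + 1) * x)) = lambert 1 x"
proof -
  define f where "f = (\<lambda>n m. of_nat (Suc m) * (Q ^ (n + 1) * x) ^ Suc m)"
  have less: "norm (Q ^ (n + 1) * x) < 1" for n
  proof -
    have "norm (Q ^ (n + 1) * x) = \<bar>q\<bar> ^ n * norm (Q * x)" by (simp add: norm_mult norm_power)
    also have "\<dots> \<le> 1 * norm (Q * x)" using q_less by (intro mult_right_mono power_le_one) auto
    finally show ?thesis using norm_Q_mult_less[OF x] by simp
  qed
  have nsums: "(\<lambda>m. norm (f n m)) sums (norm (Q ^ (n + 1) * x) / (1 - norm (Q ^ (n + 1) * x)) ^ 2)" for n
  proof -
    define y where "y = norm (Q ^ (n + 1) * x)"
    have "norm y < 1" using less[of n] by (simp add: y_def)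
    hence "(\<lambda>m. y * (of_nat (Suc m) * y ^ m)) sums (y * (1 / (1 - y) ^ 2))"
      by (intro sums_mult geometric_deriv_sums)
    moreover have "norm (f n m) = y * (of_nat (Suc m) * y ^ m)" for m
      unfolding f_def y_def norm_mult norm_power norm_of_nat by simp
    ultimately show ?thesis by (simp add: y_def)
  qed
  have fsums: "((f n) has_sum F1 (Q ^ (n + 1) * x)) UNIV" for n
    using norm_summable_imp_has_sum[of "f n"] nsums[of n] F1_sums[OF less[of n]]
    by (simp add: f_def sums_iff)
  have "(\<lambda>(n, m). norm (f n m)) summable_on UNIV \<times> UNIV"
  proof (rule summable_on_SigmaI[where g = "\<lambda>n. norm (Q ^ (n + 1) * x) / (1 - norm (Q ^ (n + 1) * x)) ^ 2"])
    show "((\<lambda>m. case (n, m) of (n, m) \<Rightarrow> norm (f n m)) has_sum norm (Q ^ (n + 1) * x) / (1 - norm (Q ^ (n + 1) * x)) ^ 2) UNIV" for n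
      using sums_nonneg_imp_has_sum[OF nsums[of n]] by simp
    define B where "B = 1 / (1 - norm (Q * x)) ^ 2"
    show "(\<lambda>n. norm (Q ^ (n + 1) * x) / (1 - norm (Q ^ (n + 1) * x)) ^ 2) summable_on UNIV"
    proof (rule summable_on_comparison_test)
      have "summable (\<lambda>n. (norm (Q * x) * B) * \<bar>q\<bar> ^ n)"
        using q_less by (intro summable_mult summable_geometric) auto
      thus "(\<lambda>n. (norm (Q * x) * B) * \<bar>q\<bar> ^ n) summable_on UNIV"
        by (subst summable_on_UNIV_nonneg_real_iff) (auto simp: B_def)
      fix n
      have e: "norm (Q ^ (n + 1) * x) = norm (Q * x) * \<bar>q\<bar> ^ n" by (simp add: norm_mult norm_power)
      have le: "norm (Q * x) * \<bar>q\<bar> ^ n \<le> norm (Q * x) * 1"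
        using q_less by (intro mult_left_mono power_le_one) auto
      have "(1 - norm (Q * x)) ^ 2 \<le> (1 - norm (Q ^ (n + 1) * x)) ^ 2"
        using norm_Q_mult_less[OF x] le unfolding e by (intro power_mono) auto
      hence "norm (Q ^ (n + 1) * x) / (1 - norm (Q ^ (n + 1) * x)) ^ 2 \<le> norm (Q ^ (n + 1) * x) / (1 - norm (Q * x)) ^ 2"
        using norm_Q_mult_less[OF x] by (intro frac_le) auto
      also have "\<dots> = norm (Q * x) * B * \<bar>q\<bar> ^ n" unfolding e B_def by simp
      finally show "norm (Q ^ (n + 1) * x) / (1 - norm (Q ^ (n + 1) * x)) ^ 2 \<le> norm (Q * x) * B * \<bar>q\<bar> ^ n" .
    qed auto
  qed auto
  hence "(\<lambda>p. norm (case p of (n, m) \<Rightarrow> f n m)) summable_on UNIV \<times> UNIV"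
    by (simp add: case_prod_unfold)
  hence abs: "(\<lambda>(n, m). f n m) summable_on UNIV \<times> UNIV"
    by (rule abs_summable_summable)
  have qm: "norm (Q ^ Suc m) < 1" for m
    using q_nz q_less power_Suc_less_one[of "\<bar>q\<bar>" m] by (simp only: norm_power norm_of_real)
  have inner: "infsum (\<lambda>n. f n m) UNIV = of_nat (Suc m) * (Q ^ Suc m / (1 - Q ^ Suc m)) * x ^ Suc m" for m
  proof -
    have eq: "f n m = (of_nat (Suc m) * Q ^ Suc m * x ^ Suc m) * (Q ^ Suc m) ^ n" for n
      unfolding f_def by (simp add: power_mult_distrib power_mult[symmetric] power_add mult_ac)
    have "summable (\<lambda>n. norm (f n m))"
      unfolding eq norm_mult norm_power[of "Q ^ Suc m"] using qm[of m] by (intro summable_mult summable_geometric) auto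
    moreover have "(\<lambda>n. f n m) sums ((of_nat (Suc m) * Q ^ Suc m * x ^ Suc m) * (1 / (1 - Q ^ Suc m)))"
      unfolding eq by (intro sums_mult geometric_sums qm)
    ultimately have "((\<lambda>n. f n m) has_sum ((of_nat (Suc m) * Q ^ Suc m * x ^ Suc m) * (1 / (1 - Q ^ Suc m)))) UNIV"
      by (rule norm_summable_imp_has_sum)
    thus ?thesis by (simp add: infsumI)
  qed
  have "((\<lambda>n. F1 (Q ^ (n + 1) * x)) has_sum infsum (\<lambda>(n, m). f n m) (UNIV \<times> UNIV)) UNIV"
    by (rule has_sum_SigmaD[OF has_sum_infsum[OF abs]]) (simp only: case_prod_conv, rule fsums)
  hence "(\<Sum>n. F1 (Q ^ (n + 1) * x)) = infsum (\<lambda>(n, m). f n m) (UNIV \<times> UNIV)"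
    using has_sum_imp_sums by (metis sums_unique)
  also have "\<dots> = infsum (\<lambda>n. infsum (f n) UNIV) UNIV"
    using infsum_Sigma'_banach[OF abs] by simp
  also have "\<dots> = infsum (\<lambda>m. infsum (\<lambda>n. f n m) UNIV) UNIV"
    by (rule infsum_swap_banach[OF abs])
  also have "\<dots> = infsum (\<lambda>m. of_nat (Suc m) * (Q ^ Suc m / (1 - Q ^ Suc m)) * x ^ Suc m) UNIV"
    unfolding inner ..
  also have "\<dots> = (\<Sum>m. of_nat (Suc m) * (Q ^ Suc m / (1 - Q ^ Suc m)) * x ^ Suc m)"
  proof -
    have "(\<lambda>(m, n). f n m) summable_on UNIV \<times> UNIV"
      using abs by (subst summable_on_swap) (simp add: case_prod_unfold)
    hence "(\<lambda>m. infsum (\<lambda>n. f n m) UNIV) summable_on UNIV"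
      using summable_on_Sigma_banach[of "\<lambda>m n. f n m" UNIV "\<lambda>_. UNIV"] by simp
    hence "(\<lambda>m. of_nat (Suc m) * (Q ^ Suc m / (1 - Q ^ Suc m)) * x ^ Suc m) summable_on UNIV"
      unfolding inner .
    thus ?thesis
      by (rule sums_unique[OF has_sum_imp_sums[OF has_sum_infsum]])
  qed
  also have "\<dots> = lambert 1 x"
    using suminf_split_head[OF lambert_summable[OF x, of 1]] by (simp add: lambert_def)
  finally show ?thesis .
qed

definition s1 :: complex where "s1 = of_real (tate_s 1 q)"
definition s3 :: complex where "s3 = of_real (tate_s 3 q)"
definition s5 :: complex where "s5 = of_real (tate_s 5 q)"

text \<open>Keeps \<open>exp z\<close> and \<open>exp (- z)\<close> in the disc of radius
  \<open>1 / \<bar>q\<bar>\<close>; the bound 1 keeps the ball inside that of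
  \<open>trig_part\<close>.\<close>

definition rho :: real where "rho = min 1 (- ln \<bar>q\<bar>)"

lemma rho_pos: "rho > 0" using q_nz q_less by (simp add: rho_def)

lemma rho_exp:
  fixes z c :: complex
  assumes "z \<in> ball 0 rho" "norm c \<le> 1"
  shows "norm (exp (c * z)) < 1 / \<bar>q\<bar>"
proof -
  have "norm (exp (c * z)) \<le> exp (norm (c * z))" by (rule norm_exp)
  also have "norm (c * z) \<le> 1 * norm z" using assms by (simp only: norm_mult) (intro mult_right_mono, auto)
  hence "exp (norm (c * z)) \<le> exp (norm z)" by simp
  also have "exp (norm z) < exp (- ln \<bar>q\<bar>)" using assms by (simp add: rho_def)
  also have "exp (- ln \<bar>q\<bar>) = 1 / \<bar>q\<bar>" using q_nz by (simp add: exp_minus inverse_eq_divide)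
  finally show ?thesis by simp
qed

text \<open>Only the factor-free term \<open>F1 (exp z)\<close> has a pole at 0. The others add up
  to \<open>lambert 1 (exp z) + lambert 1 (exp (- z))\<close>, whose even derivatives at 0 are twice
  \<open>s1\<close>, \<open>s3\<close>, \<open>s5\<close> and whose odd ones cancel; the constant
  \<open>2 * s1\<close> is compensated in \<open>X\<close>.\<close>

lemma X_regular_part:
  obtains h where "h holomorphic_on ball 0 rho"
    "\<And>z. z \<in> ball 0 rho \<Longrightarrow> X z = F1 (exp z) + 1 / 12 + s3 * z ^ 2 + s5 / 12 * z ^ 4 + z ^ 6 * h z"
proof -
  define P where "P = (\<lambda>(i::nat) z. if i = 0 then 2 * s1 + s3 * z ^ 2 + s5 / 12 * z ^ 4 else if i = 1 then 2 * s3 * z + s5 / 3 * z ^ 3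
     else if i = 2 then 2 * s3 + s5 * z ^ 2 else if i = 3 then 2 * s5 * z else if i = 4 then 2 * s5 else (0::complex))"
  have P: "(P i has_field_derivative P (Suc i) z) (at z)" for i z
  proof -
    consider "i = 0" | "i = 1" | "i = 2" | "i = 3" | "i = 4" | "i > 4" by linarith
    thus ?thesis
      by cases (auto simp: P_def[abs_def] eval_nat_numeral intro!: derivative_eq_intros)
  qed
  define D where "D = (\<lambda>i z. lambert (Suc i) (exp (1 * z)) + (-1) ^ i * lambert (Suc i) (exp (-1 * z)) - P i z)"
  have der: "(D i has_field_derivative D (Suc i) z) (at z)" if z: "z \<in> ball 0 rho" for i z
  proof -
    have "(D i has_field_derivative 1 * lambert (Suc (Suc i)) (exp (1 * z)) + (-1) ^ i * (-1 * lambert (Suc (Suc i)) (exp (-1 * z))) - P (Suc i) z) (at z)"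
      unfolding D_def by (intro DERIV_diff DERIV_add DERIV_cmult P lambert_deriv rho_exp z) auto
    thus ?thesis by (simp add: D_def)
  qed
  have zero: "D i 0 = 0" if "i < 6" for i
  proof -
    have "i \<in> {0,1,2,3,4,5}" using that by auto
    thus ?thesis using lambert_one[of 1] lambert_one[of 3] lambert_one[of 5]
      by (auto simp: D_def P_def s1_def s3_def s5_def eval_nat_numeral)
  qed
  have "D 0 holomorphic_on ball 0 rho"
    using der[of _ 0] unfolding holomorphic_on_open[OF open_ball] by blast
  then obtain h where h: "h holomorphic_on ball 0 rho" "\<And>z. z \<in> ball 0 rho \<Longrightarrow> D 0 z = z ^ 6 * h z"
    using taylor_zero_factor[of rho D 6] rho_pos der zero by blast
  show ?thesis
  proof (rule that[OF h(1)])
    fix z :: complex assume z: "z \<in> ball 0 rho"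
    have "(\<Sum>n. F1 (Q ^ (n + 1) * exp z)) = lambert 1 (exp z)"
      using sum_F1_eq_lambert[of "exp z"] rho_exp[OF z, of 1] by simp
    moreover have "(\<Sum>n. F1 (Q ^ (n + 1) * exp (- z))) = lambert 1 (exp (- z))"
      using sum_F1_eq_lambert[of "exp (- z)"] rho_exp[OF z, of "-1"] by simp
    moreover have "(\<Sum>n. F1 (Q ^ n * exp z)) = F1 (exp z) + (\<Sum>n. F1 (Q ^ (n + 1) * exp z))"
      using suminf_split_head[OF summable_norm_cancel[OF F1_summable[of 0 "exp z"]]] by simp
    ultimately have "X z = F1 (exp z) + 1 / 12 + s3 * z ^ 2 + s5 / 12 * z ^ 4 +
        (lambert 1 (exp z) + lambert 1 (exp (- z)) - (2 * s1 + s3 * z ^ 2 + s5 / 12 * z ^ 4))"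
      by (simp add: X_def s1_def)
    moreover have "lambert 1 (exp z) + lambert 1 (exp (- z)) - (2 * s1 + s3 * z ^ 2 + s5 / 12 * z ^ 4) = z ^ 6 * h z"
      using h(2)[OF z] by (simp add: D_def P_def)
    ultimately show "X z = F1 (exp z) + 1 / 12 + s3 * z ^ 2 + s5 / 12 * z ^ 4 + z ^ 6 * h z"
      by (simp only:)
  qed
qed

lemma exp_neq_1_ball:
  fixes z :: complex
  assumes "z \<in> ball 0 1 - {0}"
  shows "exp z \<noteq> 1"
proof
  assume "exp z = 1"
  then obtain n :: int where n: "Re z = 0" "Im z = of_int (2 * n) * pi" by (auto simp: exp_eq_1)
  have "\<bar>Im z\<bar> < 1" using assms abs_Im_le_cmod[of z] by simp
  hence "\<bar>real_of_int (2 * n)\<bar> * pi < 1" using n(2) by (simp add: abs_mult)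
  moreover have "n \<noteq> 0 \<Longrightarrow> \<bar>real_of_int (2 * n)\<bar> * pi \<ge> 1 * pi" by (intro mult_right_mono) auto
  ultimately have "n = 0" using pi_gt3 by linarith
  thus False using n assms complex_eqI[of z 0] by auto
qed

text \<open>The coefficients come from the equation satisfied by \<open>p = e\<^sup>z / (1 - e\<^sup>z)\<^sup>2 + 1/12\<close>, the degenerate case \<open>q = 0\<close>.\<close>
lemma trig_part:
  obtains h where "h holomorphic_on ball 0 1"
    "\<And>z. z \<in> ball 0 1 - {0} \<Longrightarrow> F1 (exp z) + 1 / 12 = 1 / z ^ 2 + 1 / 240 * z ^ 2 - 1 / 6048 * z ^ 4 + z ^ 6 * h z"
proof -
  define p where "p = (\<lambda>z. F1 (exp z) + 1 / 12)"
  have pd: "(p has_field_derivative F2 (exp z)) (at z)" if "z \<in> ball 0 1 - {0}" for z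
  proof -
    have "((\<lambda>z. F1 (exp z)) has_field_derivative (1 + exp z) / (1 - exp z) ^ 3 * exp z) (at z)"
      by (rule DERIV_chain2[OF F1_deriv[OF exp_neq_1_ball[OF that]] DERIV_exp])
    hence "(p has_field_derivative (1 + exp z) / (1 - exp z) ^ 3 * exp z + 0) (at z)"
      unfolding p_def by (intro DERIV_add DERIV_const)
    thus ?thesis by (simp add: F2_def mult_ac)
  qed
  have phol: "p holomorphic_on ball 0 1 - {0}"
    unfolding holomorphic_on_open[OF open_delete[OF open_ball]] using pd by blast
  have even: "p (- z) = p z" for z
    using F1_inverse[of "exp z"] by (simp add: p_def exp_minus)
  have lim: "((\<lambda>z. z ^ 2 * p z) \<longlongrightarrow> 1) (at 0)"
  proof -
    have "((\<lambda>z::complex. (exp z - 1) / z) \<longlongrightarrow> 1) (at 0)"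
      using DERIV_exp[of "0::complex"] by (simp add: has_field_derivative_iff)
    hence "((\<lambda>z. exp z / ((exp z - 1) / z) ^ 2 + z ^ 2 / 12) \<longlongrightarrow> exp 0 / 1 ^ 2 + 0 ^ 2 / 12) (at (0::complex))"
      by (intro tendsto_intros) auto
    moreover have "eventually (\<lambda>z. exp z / ((exp z - 1) / z) ^ 2 + z ^ 2 / 12 = z ^ 2 * p z) (at 0)"
      by (auto simp: eventually_at_filter p_def F1_def power_divide power2_commute[of "exp _" 1] algebra_simps)
    ultimately show ?thesis using Lim_transform_eventually by fastforce
  qed
  obtain k where k: "k holomorphic_on ball 0 1" "\<And>z. z \<in> ball 0 1 - {0} \<Longrightarrow> p z = 1 / z ^ 2 + k z"
    "\<And>z. z \<in> ball 0 1 \<Longrightarrow> k (- z) = k z"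
    using even_double_pole[OF phol _ even lim] by auto
  obtain k1 where k1: "k1 holomorphic_on ball 0 1" "\<And>z. z \<in> ball 0 1 \<Longrightarrow> k z = k 0 + z ^ 2 * k1 z"
    "\<And>z. z \<in> ball 0 1 \<Longrightarrow> k1 (- z) = k1 z"
    using holomorphic_ball_even_factor[OF k(1) _ k(3)] by auto
  obtain k2 where k2: "k2 holomorphic_on ball 0 1" "\<And>z. z \<in> ball 0 1 \<Longrightarrow> k1 z = k1 0 + z ^ 2 * k2 z"
    "\<And>z. z \<in> ball 0 1 \<Longrightarrow> k2 (- z) = k2 z"
    using holomorphic_ball_even_factor[OF k1(1) _ k1(3)] by auto
  obtain h where h: "h holomorphic_on ball 0 1" "\<And>z. z \<in> ball 0 1 \<Longrightarrow> k2 z = k2 0 + z ^ 2 * h z"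
    using holomorphic_ball_even_factor[OF k2(1) zero_less_one k2(3)] by metis
  define c where "c = k 0" define a where "a = k1 0" define b where "b = k2 0"
  have pe: "p z = 1 / z ^ 2 + c + a * z ^ 2 + b * z ^ 4 + z ^ 6 * h z" if z: "z \<in> ball 0 1 - {0}" for z
  proof -
    have "p z = 1 / z ^ 2 + (k 0 + z ^ 2 * (k1 0 + z ^ 2 * (k2 0 + z ^ 2 * h z)))"
      using k(2)[OF z] k1(2)[of z] k2(2)[of z] h(2)[of z] z by simp
    thus ?thesis by (simp add: a_def b_def c_def algebra_simps eval_nat_numeral)
  qed
  define f where "f = (\<lambda>z. p z - c)"
  have fd: "(f has_field_derivative F2 (exp z)) (at z)" if "z \<in> ball 0 1 - {0}" for z
    unfolding f_def using DERIV_diff[OF pd[OF that] DERIV_const, of c] by simp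
  have "((\<lambda>z. F2 (exp z) ^ 2 - 4 * f z ^ 3 + 20 * a * f z + 28 * b) \<longlongrightarrow> 0) (at 0)"
    by (rule weierstrass_ode_limit[OF _ h(1) _ fd]) (auto simp: f_def pe)
  \<comment> \<open>The derivative is eliminated. The remaining quadratic polynomial in
    \<open>f\<close> tends to 0 although \<open>f\<close> has a double pole, so its three
    coefficients vanish: \<open>c = 0\<close>, then \<open>20 * a = 1 / 12\<close> and
    \<open>28 * b = - 1 / 216\<close>.\<close>
  moreover have "eventually (\<lambda>z. F2 (exp z) ^ 2 - 4 * f z ^ 3 + 20 * a * f z + 28 * b =
     12 * c * f z ^ 2 + (12 * c ^ 2 - 1 / 12 + 20 * a) * f z + (4 * c ^ 3 - c / 12 + 1 / 216 + 28 * b)) (at 0)"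
  proof -
    \<comment> \<open>Before the shift this is the nodal cubic F2^2 = 4 F1^3 + F1^2; adding 1/12
      removes the quadratic term.\<close>
    have ode: "F2 x ^ 2 = 4 * (F1 x + 1 / 12) ^ 3 - (F1 x + 1 / 12) / 12 + 1 / 216" if "x \<noteq> 1" for x
    proof -
      define y where "y = inverse (1 - x)"
      have xy: "(1 - x) * y = 1" using that by (simp add: y_def)
      have F: "F1 x = x * y ^ 2" "F2 x = x * (1 + x) * y ^ 3"
        by (simp_all add: F1_def F2_def y_def field_simps)
      have "4 * (w + 1 / 12) ^ 3 - (w + 1 / 12) / 12 + 1 / 216 = 4 * w ^ 3 + w ^ 2" for w :: complex
        by (simp add: field_simps eval_nat_numeral)
      moreover have "(x * (1 + x) * y ^ 3) ^ 2 = 4 * (x * y ^ 2) ^ 3 + (x * y ^ 2) ^ 2"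
        using xy by algebra
      ultimately show ?thesis unfolding F by simp
    qed
    have "eventually (\<lambda>z. z \<in> ball 0 1 - {0}) (at (0::complex))"
      by (intro eventually_at_in_open) auto
    thus ?thesis
    proof eventually_elim
      case (elim z)
      have "F2 (exp z) ^ 2 = 4 * (f z + c) ^ 3 - (f z + c) / 12 + 1 / 216"
        using ode[OF exp_neq_1_ball[OF elim]] by (simp add: f_def p_def)
      moreover have "4 * (F + c) ^ 3 - (F + c) / 12 + 1 / 216 - 4 * F ^ 3 + 20 * a * F + 28 * b =
         12 * c * F ^ 2 + (12 * c ^ 2 - 1 / 12 + 20 * a) * F + (4 * c ^ 3 - c / 12 + 1 / 216 + 28 * b)" for F
        by (simp add: field_simps eval_nat_numeral)
      ultimately show ?case by simp
    qed
  qed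
  ultimately have L: "((\<lambda>z. 12 * c * f z ^ 2 + (12 * c ^ 2 - 1 / 12 + 20 * a) * f z + (4 * c ^ 3 - c / 12 + 1 / 216 + 28 * b)) \<longlongrightarrow> 0) (at 0)"
    by (rule Lim_transform_eventually)
  have lf: "((\<lambda>z. z ^ 2 * f z) \<longlongrightarrow> 1) (at 0)"
  proof -
    have "((\<lambda>z. z ^ 2 * p z - z ^ 2 * c) \<longlongrightarrow> 1 - 0 ^ 2 * c) (at 0)"
      by (intro tendsto_intros lim)
    thus ?thesis by (simp add: f_def algebra_simps)
  qed
  note coeffs = quadratic_pole_coeffs_zero[OF lf L]
  have c0: "c = 0" using coeffs(1) by simp
  have a0: "a = 1 / 240" using coeffs(2) c0 by (simp add: field_simps)
  have b0: "b = - 1 / 6048" using coeffs(3) c0 by (simp add: field_simps add_eq_0_iff)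
  show ?thesis
    by (rule that[OF h(1)]) (use pe c0 a0 b0 in \<open>simp add: p_def\<close>)
qed

text \<open>The sum of the contributions of \<open>trig_part\<close> and
  \<open>X_regular_part\<close>; \<open>20 * aX\<close> is \<open>c4 / 12\<close> of the Tate
  curve.\<close>

definition aX :: complex where "aX = 1 / 240 + s3"
definition bX :: complex where "bX = - 1 / 6048 + s5 / 12"

lemma X_expansion:
  obtains r h where "r > 0" "h holomorphic_on ball 0 r" "ball 0 r - {0} \<subseteq> - Lam"
    "\<And>z. z \<in> ball 0 r - {0} \<Longrightarrow> X z = 1 / z ^ 2 + aX * z ^ 2 + bX * z ^ 4 + z ^ 6 * h z"
proof -
  obtain h1 where h1: "h1 holomorphic_on ball 0 rho"
    "\<And>z. z \<in> ball 0 rho \<Longrightarrow> X z = F1 (exp z) + 1 / 12 + s3 * z ^ 2 + s5 / 12 * z ^ 4 + z ^ 6 * h1 z"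
    by (rule X_regular_part) blast
  obtain h2 where h2: "h2 holomorphic_on ball 0 1"
    "\<And>z. z \<in> ball 0 1 - {0} \<Longrightarrow> F1 (exp z) + 1 / 12 = 1 / z ^ 2 + 1 / 240 * z ^ 2 - 1 / 6048 * z ^ 4 + z ^ 6 * h2 z"
    by (rule trig_part) blast
  obtain s where s: "s > 0" "ball 0 s \<subseteq> - (Lam - {0})"
    using lam.open_regular openE[of "- (Lam - {0})" 0] by blast
  define r where "r = min s rho"
  have r: "r > 0" "ball 0 r \<subseteq> ball (0::complex) rho" "ball 0 r \<subseteq> ball (0::complex) 1" "ball 0 r \<subseteq> ball (0::complex) s"
    using s(1) rho_pos by (auto simp: r_def rho_def)
  show ?thesis
  proof (rule that[of r "\<lambda>z. h1 z + h2 z"])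
    show "(\<lambda>z. h1 z + h2 z) holomorphic_on ball 0 r"
      by (intro holomorphic_intros holomorphic_on_subset[OF h1(1)] holomorphic_on_subset[OF h2(1)] r)
    show "ball 0 r - {0} \<subseteq> - Lam" using s(2) r(4) by auto
    fix z :: complex assume z: "z \<in> ball 0 r - {0}"
    have z1: "z \<in> ball 0 rho" "z \<in> ball 0 1 - {0}" using z r(2,3) by blast+
    show "X z = 1 / z ^ 2 + aX * z ^ 2 + bX * z ^ 4 + z ^ 6 * (h1 z + h2 z)"
      unfolding h1(2)[OF z1(1)] h2(2)[OF z1(2)] aX_def bX_def by (simp add: algebra_simps)
  qed (rule r)
qed

lemma X_holomorphic: "X holomorphic_on - Lam"
  using X_deriv lam.open_punctured by (auto simp: holomorphic_on_open)

lemma X'_holomorphic: "X' holomorphic_on - Lam"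
proof -
  have "deriv X holomorphic_on - Lam"
    by (intro holomorphic_deriv X_holomorphic lam.open_punctured)
  thus ?thesis
    by (rule holomorphic_transform) (use X_deriv in \<open>auto intro: DERIV_imp_deriv\<close>)
qed

lemma X_ode:
  assumes "z \<notin> Lam"
  shows "X' z ^ 2 = 4 * X z ^ 3 - 20 * aX * X z - 28 * bX"
proof -
  obtain r h where rh: "r > 0" "h holomorphic_on ball 0 r" "ball 0 r - {0} \<subseteq> - Lam"
    "\<And>z. z \<in> ball 0 r - {0} \<Longrightarrow> X z = 1 / z ^ 2 + aX * z ^ 2 + bX * z ^ 4 + z ^ 6 * h z"
    by (rule X_expansion) blast
  have lim: "((\<lambda>z. X' z ^ 2 - 4 * X z ^ 3 + 20 * aX * X z + 28 * bX) \<longlongrightarrow> 0) (at 0)"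
    by (rule weierstrass_ode_limit[OF rh(1,2,4)]) (use rh(3) in \<open>auto intro!: X_deriv\<close>)
  have "X' z ^ 2 - 4 * X z ^ 3 + 20 * aX * X z + 28 * bX = 0"
    by (rule lam.liouville_periodic[OF _ _ lim assms])
       (auto intro!: holomorphic_intros X_holomorphic X'_holomorphic simp: X_periodic X'_periodic)
  thus ?thesis by (simp add: algebra_simps)
qed

lemma X_square_lim: "((\<lambda>z. z ^ 2 * X z) \<longlongrightarrow> 1) (at 0)"
proof -
  obtain r h where rh: "r > 0" "h holomorphic_on ball 0 r" "ball 0 r - {0} \<subseteq> - Lam"
    "\<And>z. z \<in> ball 0 r - {0} \<Longrightarrow> X z = 1 / z ^ 2 + aX * z ^ 2 + bX * z ^ 4 + z ^ 6 * h z"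
    by (rule X_expansion) blast
  have "isCont h 0"
    using holomorphic_on_imp_continuous_on[OF rh(2)] rh(1)
    by (simp add: continuous_on_eq_continuous_at[OF open_ball])
  hence "isCont (\<lambda>z. 1 + aX * z ^ 4 + bX * z ^ 6 + z ^ 8 * h z) 0" by (intro continuous_intros)
  hence "((\<lambda>z. 1 + aX * z ^ 4 + bX * z ^ 6 + z ^ 8 * h z) \<longlongrightarrow> 1) (at 0)" by (simp add: isCont_def)
  moreover have "eventually (\<lambda>z. z \<in> ball 0 r - {0}) (at (0::complex))"
    using rh(1) by (intro eventually_at_in_open) auto
  hence "eventually (\<lambda>z. 1 + aX * z ^ 4 + bX * z ^ 6 + z ^ 8 * h z = z ^ 2 * X z) (at 0)"
    by eventually_elim (use rh(4) in \<open>simp add: algebra_simps eval_nat_numeral\<close>)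
  ultimately show ?thesis by (rule Lim_transform_eventually)
qed

end

section \<open>Identification of the period lattice\<close>

context tate
begin

text \<open>By uniqueness for the differential equation, \<open>wp L\<close> and the rescaled
  \<open>X\<close> agree near 0. Off both sets of poles the plane is connected, the removed set
  being countable, so they agree there. Finally the sets of poles coincide, since a double pole of
  one function cannot be a point of continuity of the other.\<close>

lemma lattice_identification:
  assumes L: "cplx_lattice w1 w2 L" and mu: "mu \<noteq> 0"
    and g2: "g2 L = 20 * aX * mu ^ 4" and g3: "g3 L = 28 * bX * mu ^ 6"
  shows "z \<in> L \<longleftrightarrow> mu * z \<in> Lam"
    and "z \<notin> L \<Longrightarrow> wp L z = mu ^ 2 * X (mu * z)"
    and "z \<notin> L \<Longrightarrow> wp_deriv L z = mu ^ 3 * X' (mu * z)"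
proof -
  interpret L: cplx_lattice w1 w2 L by (rule L)
  define f where "f = (\<lambda>z. mu ^ 2 * X (mu * z))"
  define f' where "f' = (\<lambda>z. mu ^ 3 * X' (mu * z))"
  have f': "(f has_field_derivative f' z) (at z)" if "mu * z \<notin> Lam" for z
  proof -
    have "((\<lambda>z. mu * z) has_field_derivative mu) (at z)" by (auto intro!: derivative_eq_intros)
    from DERIV_chain2[OF X_deriv[OF that] this]
    have "((\<lambda>z. X (mu * z)) has_field_derivative X' (mu * z) * mu) (at z)" .
    hence "(f has_field_derivative mu ^ 2 * (X' (mu * z) * mu)) (at z)"
      unfolding f_def by (rule DERIV_cmult)
    thus ?thesis by (simp add: f'_def power2_eq_square power3_eq_cube mult_ac)
  qed
  have fo: "f' z ^ 2 = 4 * f z ^ 3 - g2 L * f z - g3 L" if "mu * z \<notin> Lam" for z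
    using X_ode[OF that] unfolding f_def f'_def g2 g3 by algebra
  obtain r1 h1 where h1: "r1 > 0" "h1 holomorphic_on ball 0 r1" "ball 0 r1 - {0} \<subseteq> - L"
    "\<And>z. z \<in> ball 0 r1 - {0} \<Longrightarrow> wp L z = 1 / z ^ 2 + g2 L / 20 * z ^ 2 + g3 L / 28 * z ^ 4 + z ^ 6 * h1 z"
    by (rule L.wp_expansion) blast
  obtain r2 h2 where h2: "r2 > 0" "h2 holomorphic_on ball 0 r2" "ball 0 r2 - {0} \<subseteq> - Lam"
    "\<And>z. z \<in> ball 0 r2 - {0} \<Longrightarrow> X z = 1 / z ^ 2 + aX * z ^ 2 + bX * z ^ 4 + z ^ 6 * h2 z"
    by (rule X_expansion) blast
  define r where "r = min r1 (r2 / norm mu)"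
  have r: "r > 0" using h1(1) h2(1) mu by (simp add: r_def)
  have b1: "z \<in> ball 0 r1 - {0}" if "z \<in> ball 0 r - {0}" for z :: complex
    using that by (auto simp: r_def)
  have b2: "mu * z \<in> ball 0 r2 - {0}" if "z \<in> ball 0 r - {0}" for z
    using that mu by (auto simp: r_def norm_mult field_simps)
  define k where "k = (\<lambda>z. g2 L / 20 * z ^ 2 + g3 L / 28 * z ^ 4 + z ^ 6 * h1 z)"
  define l where "l = (\<lambda>z. mu ^ 2 * (aX * (mu * z) ^ 2 + bX * (mu * z) ^ 4 + (mu * z) ^ 6 * h2 (mu * z)))"
  have kh: "k holomorphic_on ball 0 r"
    unfolding k_def by (intro holomorphic_intros holomorphic_on_subset[OF h1(2)]) (auto simp: r_def)
  have lh: "l holomorphic_on ball 0 r"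
  proof -
    have "(\<lambda>z. h2 (mu * z)) holomorphic_on ball 0 r"
    proof (rule holomorphic_on_compose_gen[of "\<lambda>z. mu * z" _ h2 "ball 0 r2", unfolded o_def])
      show "(*) mu ` ball 0 r \<subseteq> ball 0 r2"
        using b2 h2(1) by (force simp: image_subset_iff)
    qed (auto intro!: holomorphic_intros h2)
    thus ?thesis unfolding l_def by (intro holomorphic_intros)
  qed
  have near: "wp L z = f z" if z: "z \<in> ball 0 r - {0}" for z
  proof -
    have fz: "f w = 1 / w ^ 2 + l w" if w: "w \<in> ball 0 r - {0}" for w
    proof -
      have "mu ^ 2 * (1 / (mu * w) ^ 2) = 1 / w ^ 2" using mu w by (simp add: power_mult_distrib)
      moreover have "mu ^ 2 * (x + a + b + c) = mu ^ 2 * x + mu ^ 2 * (a + b + c)" for x a b c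
        by (simp add: algebra_simps)
      ultimately show ?thesis unfolding f_def h2(4)[OF b2[OF w]] l_def by simp
    qed
    have wz: "wp L w = 1 / w ^ 2 + k w" if w: "w \<in> ball 0 r - {0}" for w
      unfolding h1(4)[OF b1[OF w]] k_def by (simp add: algebra_simps)
    have "k z = l z"
    proof (rule weierstrass_ode_unique[OF r kh lh wz fz])
      fix w :: complex assume w: "w \<in> ball 0 r - {0}"
      have wL: "w \<notin> L" "mu * w \<notin> Lam" using b1[OF w] b2[OF w] h1(3) h2(3) by auto
      show "(wp L has_field_derivative wp_deriv L w) (at w)" by (rule L.wp_has_deriv[OF wL(1)])
      show "(f has_field_derivative f' w) (at w)" by (rule f'[OF wL(2)])
      show "wp_deriv L w ^ 2 = 4 * wp L w ^ 3 - g2 L * wp L w - g3 L" by (rule L.wp_ode[OF wL(1)])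
      show "f' w ^ 2 = 4 * f w ^ 3 - g2 L * f w - g3 L" by (rule fo[OF wL(2)])
    qed (use z in auto)
    thus ?thesis using fz[OF z] wz[OF z] by simp
  qed
  define M where "M = (\<lambda>z. mu * z) -` Lam"
  define U where "U = - (L \<union> M)"
  have clM: "closed M" unfolding M_def
    by (intro closed_vimage continuous_intros lam.closed_subset_L) auto
  have cM: "countable M"
  proof -
    have "M = (\<lambda>z. z / mu) ` Lam" using mu by (auto simp: M_def image_iff field_simps)
    thus ?thesis using lam.countable_L by simp
  qed
  have opU: "open U" unfolding U_def
    using clM L.closed_subset_L[of L] by (intro open_Compl closed_Un) auto
  have conU: "connected U"
    unfolding U_def using connected_open_diff_countable[of UNIV "L \<union> M"] L.countable_L cM connected_UNIV
    by (simp add: Compl_eq_Diff_UNIV)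
  have fhol: "f holomorphic_on U"
    unfolding holomorphic_on_open[OF opU] using f' by (auto simp: U_def M_def)
  have wphol: "wp L holomorphic_on U"
    by (rule holomorphic_on_subset[OF L.wp_holomorphic]) (auto simp: U_def)
  define V where "V = ball (0::complex) r - {0}"
  have VU: "V \<subseteq> U"
  proof
    fix x assume "x \<in> V"
    hence "x \<in> ball 0 r - {0}" by (simp only: V_def)
    hence "x \<notin> L" "mu * x \<notin> Lam" using b1 b2 h1(3) h2(3) by blast+
    thus "x \<in> U" by (simp add: U_def M_def)
  qed
  have opV: "open V" by (auto simp: V_def)
  define v where "v = complex_of_real (r / 2)"
  have vV: "v \<in> V" using r by (auto simp: v_def V_def)
  have eqU: "wp L z = f z" if "z \<in> U" for z
  proof -
    have "wp L z - f z = 0"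
    proof (rule analytic_continuation[of "\<lambda>z. wp L z - f z" U V v])
      show "v islimpt V" using interior_limit_point[of v V] vV opV by (simp add: interior_open)
    qed (use opU conU VU vV near that in \<open>auto intro!: holomorphic_intros wphol fhol simp: V_def\<close>)
    thus ?thesis by simp
  qed
  have evU: "eventually (\<lambda>x. x \<in> U) (at w)" for w
  proof -
    have "open (- (M - {w}))"
    proof -
      have "closed ((\<lambda>z. mu * z) -` (Lam - {mu * w}))"
        by (intro closed_vimage continuous_intros lam.closed_subset_L) auto
      moreover have "(\<lambda>z. mu * z) -` (Lam - {mu * w}) = M - {w}"
        using mu by (auto simp: M_def)
      ultimately show ?thesis by (simp only: open_Compl)
    qed
    hence "eventually (\<lambda>x. x \<in> - (M - {w}) - {w}) (at w)"
      by (intro eventually_at_in_open) auto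
    thus ?thesis using L.eventually_notin_L[of w] by eventually_elim (auto simp: U_def)
  qed
  have sh: "filterlim (\<lambda>x. x - w) (at 0) (at w)" for w :: complex
    by (auto simp: filterlim_at eventually_at_filter intro!: tendsto_eq_intros)
  have poleL: "((\<lambda>x. (x - w) ^ 2 * wp L x) \<longlongrightarrow> 1) (at w)" if "w \<in> L" for w
  proof -
    have "((\<lambda>x. (x - w) ^ 2 * wp L (x - w)) \<longlongrightarrow> 1) (at w)"
      by (rule filterlim_compose[OF L.wp_square_lim sh])
    moreover have "eventually (\<lambda>x. (x - w) ^ 2 * wp L (x - w) = (x - w) ^ 2 * wp L x) (at w)"
      using L.eventually_notin_L[of w]
      by eventually_elim (use L.wp_periodic[of "- w"] that in auto)
    ultimately show ?thesis by (rule Lim_transform_eventually)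
  qed
  have poleM: "((\<lambda>x. (x - w) ^ 2 * f x) \<longlongrightarrow> 1) (at w)" if "w \<in> M" for w
  proof -
    have "filterlim (\<lambda>x. mu * (x - w)) (at 0) (at w)"
      using mu by (auto simp: filterlim_at eventually_at_filter intro!: tendsto_eq_intros)
    from filterlim_compose[OF X_square_lim this]
    have "((\<lambda>x. (mu * (x - w)) ^ 2 * X (mu * (x - w))) \<longlongrightarrow> 1) (at w)" .
    moreover have "(mu * (x - w)) ^ 2 * X (mu * (x - w)) = (x - w) ^ 2 * f x" for x
    proof -
      have "X (mu * (x - w)) = X (mu * x)"
        using X_periodic[of "- (mu * w)" "mu * x"] that by (simp add: M_def algebra_simps)
      thus ?thesis by (simp add: f_def power_mult_distrib mult_ac)
    qed
    ultimately show ?thesis by simp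
  qed
  have nopole: False if F: "((\<lambda>x. (x - w) ^ 2 * F x) \<longlongrightarrow> 1) (at w)" and G: "isCont G w"
    and FG: "eventually (\<lambda>x. F x = G x) (at w)" for F G :: "complex \<Rightarrow> complex" and w
  proof -
    have "((\<lambda>x. (x - w) ^ 2 * G x) \<longlongrightarrow> (w - w) ^ 2 * G w) (at w)"
      using G by (intro tendsto_intros) (auto simp: isCont_def)
    moreover have "eventually (\<lambda>x. (x - w) ^ 2 * G x = (x - w) ^ 2 * F x) (at w)"
      using FG by eventually_elim simp
    ultimately have "((\<lambda>x. (x - w) ^ 2 * F x) \<longlongrightarrow> (w - w) ^ 2 * G w) (at w)"
      by (rule Lim_transform_eventually)
    from LIM_unique[OF this F] show False by simp
  qed
  have ev1: "eventually (\<lambda>x. wp L x = f x) (at w)" and ev2: "eventually (\<lambda>x. f x = wp L x) (at w)" for w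
    using evU[of w] by (eventually_elim, simp add: eqU)+
  show iff: "z \<in> L \<longleftrightarrow> mu * z \<in> Lam" for z
  proof
    assume z: "z \<in> L"
    show "mu * z \<in> Lam"
    proof (rule ccontr)
      assume "mu * z \<notin> Lam"
      hence "isCont f z" using f' DERIV_isCont by blast
      from nopole[OF poleL[OF z] this ev1] show False .
    qed
  next
    assume z: "mu * z \<in> Lam"
    show "z \<in> L"
    proof (rule ccontr)
      assume "z \<notin> L"
      hence "isCont (wp L) z" using L.wp_has_deriv DERIV_isCont by blast
      moreover have "z \<in> M" using z by (simp add: M_def)
      ultimately show False using nopole[OF poleM _ ev2] by blast
    qed
  qed
  have LU: "z \<in> U" if "z \<notin> L" for z
    using that iff by (simp add: U_def M_def)
  show "wp L z = mu ^ 2 * X (mu * z)" if "z \<notin> L" for z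
    using eqU[OF LU[OF that]] by (simp add: f_def)
  show "wp_deriv L z = mu ^ 3 * X' (mu * z)" if "z \<notin> L" for z
  proof -
    have "(f has_field_derivative wp_deriv L z) (at z)"
      by (rule has_field_derivative_transform_within_open[OF L.wp_has_deriv[OF that] opU LU[OF that] eqU])
    moreover have "(f has_field_derivative f' z) (at z)"
      using f' iff that by blast
    ultimately have "wp_deriv L z = f' z" by (rule DERIV_unique)
    thus ?thesis by (simp add: f'_def)
  qed
qed

end

section \<open>The theta product\<close>

context tate
begin

text \<open>The infinite q-Pochhammer symbol, with base \<open>q\<close> and argument
  \<open>x\<close>.\<close>

definition phi :: "complex \<Rightarrow> complex" where
  "phi x = (\<Prod>n. 1 - Q ^ n * x)"

lemma phi_abs_convergent: "abs_convergent_prod (\<lambda>n. 1 - Q ^ n * x)"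
proof -
  have "summable (\<lambda>n. \<bar>q\<bar> ^ n * norm x)"
    using q_less by (intro summable_mult2 summable_geometric) auto
  thus ?thesis
    by (simp add: abs_convergent_prod_conv_summable norm_mult norm_power)
qed

lemma phi_convergent: "convergent_prod (\<lambda>n. 1 - Q ^ n * x)"
  by (rule abs_convergent_prod_imp_convergent_prod[OF phi_abs_convergent])

lemma phi_has_prod: "(\<lambda>n. 1 - Q ^ n * x) has_prod phi x"
  unfolding phi_def by (rule convergent_prod_has_prod[OF phi_convergent])

lemma phi_eq_0_iff: "phi x = 0 \<longleftrightarrow> (\<exists>n. Q ^ n * x = 1)"
  using has_prod_eq_0_iff[OF phi_has_prod[of x]] by (auto simp: image_iff)

lemma phi_unfold: "phi x = (1 - x) * phi (Q * x)"
proof -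
  have "(\<lambda>n. 1 - Q ^ n * x) has_prod (phi (Q * x) * (1 - Q ^ 0 * x))"
  proof (rule has_prod_Suc_imp)
    show "(\<lambda>n. 1 - Q ^ Suc n * x) has_prod phi (Q * x)"
      using phi_has_prod[of "Q * x"] by (simp add: mult_ac)
  qed
  from has_prod_unique2[OF phi_has_prod this] show ?thesis by (simp add: mult_ac)
qed

lemma phi_uniform_limit:
  assumes R: "R > 0"
  shows "uniform_limit (cball 0 R) (\<lambda>N x. \<Prod>n<N. 1 - Q ^ n * x) phi sequentially"
proof -
  have "uniformly_convergent_on (cball 0 R) (\<lambda>N x. \<Prod>n<N. 1 - Q ^ n * x)"
  proof (rule uniformly_convergent_on_prod')
    show "uniformly_convergent_on (cball 0 R) (\<lambda>N x. \<Sum>n<N. norm (1 - Q ^ n * x - 1))"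
    proof (rule Weierstrass_m_test'_ev)
      show "\<forall>\<^sub>F n in sequentially. \<forall>x\<in>cball 0 R. norm (norm (1 - Q ^ n * x - 1)) \<le> \<bar>q\<bar> ^ n * R"
        by (intro always_eventually allI ballI) (auto simp: norm_mult norm_power intro!: mult_left_mono)
      show "summable (\<lambda>n. \<bar>q\<bar> ^ n * R)"
        using q_less by (intro summable_mult2 summable_geometric) auto
    qed
  qed (auto intro!: continuous_intros)
  then obtain g where g: "uniform_limit (cball 0 R) (\<lambda>N x. \<Prod>n<N. 1 - Q ^ n * x) g sequentially"
    by (auto simp: uniformly_convergent_on_def)
  have "g x = phi x" if "x \<in> cball 0 R" for x
  proof -
    have "(\<lambda>N. \<Prod>n<N. 1 - Q ^ n * x) \<longlonglongrightarrow> g x" by (rule tendsto_uniform_limitI[OF g that])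
    moreover have "(\<lambda>N. \<Prod>n<N. 1 - Q ^ n * x) \<longlonglongrightarrow> phi x" by (rule has_prod_imp_tendsto'[OF phi_has_prod])
    ultimately show ?thesis by (rule LIMSEQ_unique)
  qed
  hence "uniform_limit (cball 0 R) (\<lambda>N x. \<Prod>n<N. 1 - Q ^ n * x) g sequentially \<longleftrightarrow>
     uniform_limit (cball 0 R) (\<lambda>N x. \<Prod>n<N. 1 - Q ^ n * x) phi sequentially"
    by (intro uniform_limit_cong') auto
  thus ?thesis using g by blast
qed

lemma phi_holomorphic: "phi holomorphic_on A"
proof (rule holomorphic_on_subset)
  show "phi holomorphic_on UNIV"
  proof (rule holomorphic_uniform_sequence)
    fix z :: complex
    have "uniform_limit (cball 0 (norm z + 1)) (\<lambda>N x. \<Prod>n<N. 1 - Q ^ n * x) phi sequentially"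
      by (rule phi_uniform_limit) (auto intro: add_nonneg_pos)
    hence "uniform_limit (cball z 1) (\<lambda>N x. \<Prod>n<N. 1 - Q ^ n * x) phi sequentially"
      by (rule uniform_limit_on_subset) (simp add: cball_subset_cball_iff)
    thus "\<exists>d>0. cball z d \<subseteq> UNIV \<and> uniform_limit (cball z d) (\<lambda>N x. \<Prod>n<N. 1 - Q ^ n * x) phi sequentially"
      by (intro exI[of _ 1]) auto
  qed (auto intro!: holomorphic_intros)
qed auto

lemma isCont_phi: "isCont phi x"
  using holomorphic_on_imp_continuous_on[OF phi_holomorphic[of UNIV]]
  by (simp add: continuous_on_eq_continuous_at[OF open_UNIV])

lemma phi_deriv:
  assumes "\<And>n. Q ^ n * x \<noteq> 1"
  obtains D where "(phi has_field_derivative D) (at x)" "x * D = - phi x * (\<Sum>n. F0 (Q ^ n * x))"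
proof -
  have nz: "phi x \<noteq> 0" using assms phi_eq_0_iff by blast
  define R where "R = norm x + 1"
  have R: "R > 0" by (simp add: R_def add_nonneg_pos)
  have "(\<lambda>n. deriv (\<lambda>x. 1 - Q ^ n * x) x / (1 - Q ^ n * x)) sums (deriv phi x / phi x)"
  proof (rule logderiv_prodinf_complex_uniform_limit[where A = "ball 0 R"])
    show "uniform_limit (ball 0 R) (\<lambda>N x. \<Prod>n<N. 1 - Q ^ n * x) phi sequentially"
      using phi_uniform_limit[OF R] by (rule uniform_limit_on_subset) auto
  qed (use nz in \<open>auto simp: R_def intro!: holomorphic_intros\<close>)
  also have "(\<lambda>n. deriv (\<lambda>x. 1 - Q ^ n * x) x / (1 - Q ^ n * x)) = (\<lambda>n. - (Q ^ n) / (1 - Q ^ n * x))"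
  proof
    fix n
    have "((\<lambda>x. 1 - Q ^ n * x) has_field_derivative - (Q ^ n)) (at x)" by (auto intro!: derivative_eq_intros)
    hence "deriv (\<lambda>x. 1 - Q ^ n * x) x = - (Q ^ n)" by (rule DERIV_imp_deriv)
    thus "deriv (\<lambda>x. 1 - Q ^ n * x) x / (1 - Q ^ n * x) = - (Q ^ n) / (1 - Q ^ n * x)" by simp
  qed
  finally have "(\<lambda>n. (- x) * (- (Q ^ n) / (1 - Q ^ n * x))) sums ((- x) * (deriv phi x / phi x))"
    by (rule sums_mult)
  moreover have "(- x) * (- (Q ^ n) / (1 - Q ^ n * x)) = F0 (Q ^ n * x)" for n
    by (simp add: F0_def)
  ultimately have "(\<lambda>n. F0 (Q ^ n * x)) sums ((- x) * (deriv phi x / phi x))" by simp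
  hence "(\<Sum>n. F0 (Q ^ n * x)) = - x * (deriv phi x / phi x)" by (simp add: sums_iff)
  hence "x * deriv phi x = - phi x * (\<Sum>n. F0 (Q ^ n * x))" using nz by simp
  moreover have "(phi has_field_derivative deriv phi x) (at x)"
    by (rule holomorphic_derivI[OF phi_holomorphic open_UNIV]) auto
  ultimately show ?thesis using that by blast
qed

definition T :: "complex \<Rightarrow> complex" where
  "T z = - exp (- z / 2) * phi (exp z) * phi (Q * exp (- z))"

text \<open>With the factor of index 0 taken out, oddness and the simple zero at the origin are
  visible.\<close>

lemma T_eq: "T z = (exp (z / 2) - exp (- z / 2)) * phi (Q * exp z) * phi (Q * exp (- z))"
proof -
  have "- exp (- z / 2) * (1 - exp z) = exp (z / 2) - exp (- z / 2)"
  proof -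
    have "exp (- z / 2) * exp z = exp (z / 2)" by (simp flip: exp_add)
    thus ?thesis by (simp add: algebra_simps)
  qed
  moreover have "T z = (- exp (- z / 2) * (1 - exp z)) * phi (Q * exp z) * phi (Q * exp (- z))"
    unfolding T_def phi_unfold[of "exp z"] by (simp only: mult_ac)
  ultimately show ?thesis by (simp only:)
qed

lemma T_odd: "T (- z) = - T z"
  by (simp add: T_eq algebra_simps)

lemma T_eq_0_iff: "T z = 0 \<longleftrightarrow> z \<in> Lam"
proof
  assume "z \<in> Lam"
  then obtain k where k: "exp z = Q powi k" using Lam_iff by blast
  show "T z = 0"
  proof (cases "k \<ge> 0")
    case True
    define n where "n = nat k"
    have "exp z = Q ^ n" using k True by (simp add: n_def power_int_def)
    show ?thesis
    proof (cases n)
      case 0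
      hence "Q ^ 0 * exp z = 1" using \<open>exp z = Q ^ n\<close> by simp
      hence "phi (exp z) = 0" using phi_eq_0_iff by blast
      thus ?thesis by (simp add: T_def)
    next
      case (Suc m)
      hence "Q ^ m * (Q * exp (- z)) = 1" using \<open>exp z = Q ^ n\<close> by (simp add: exp_minus field_simps)
      hence "phi (Q * exp (- z)) = 0" using phi_eq_0_iff by blast
      thus ?thesis by (simp add: T_def)
    qed
  next
    case False
    define n where "n = nat (- k)"
    have "Q ^ n * exp z = 1" using k False by (simp add: n_def power_int_def field_simps)
    hence "phi (exp z) = 0" using phi_eq_0_iff by blast
    thus ?thesis by (simp add: T_def)
  qed
next
  assume 0: "T z = 0"
  show "z \<in> Lam"
  proof (rule ccontr)
    assume z: "z \<notin> Lam"
    have "phi (exp z) \<noteq> 0" using Q_pow_exp_neq(1)[OF z] phi_eq_0_iff by blast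
    moreover have "phi (Q * exp (- z)) \<noteq> 0"
    proof
      assume "phi (Q * exp (- z)) = 0"
      then obtain n where "Q ^ n * (Q * exp (- z)) = 1" using phi_eq_0_iff by blast
      hence "Q ^ Suc n * exp (- z) = 1" by (simp add: mult_ac)
      thus False using Q_pow_exp_neq(2)[OF z] by blast
    qed
    ultimately show False using 0 by (simp add: T_def)
  qed
qed

lemma T_deriv:
  assumes z: "z \<notin> Lam"
  shows "(T has_field_derivative T z * (- 1 / 2 + logsum z)) (at z)"
proof -
  obtain D1 where D1: "(phi has_field_derivative D1) (at (exp z))"
    "exp z * D1 = - phi (exp z) * (\<Sum>n. F0 (Q ^ n * exp z))"
    using phi_deriv[of "exp z"] Q_pow_exp_neq(1)[OF z] by blast
  have "Q ^ n * (Q * exp (- z)) \<noteq> 1" for n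
    using Q_pow_exp_neq(2)[OF z, of "Suc n"] by (simp add: mult_ac)
  then obtain D2 where D2: "(phi has_field_derivative D2) (at (Q * exp (- z)))"
    "Q * exp (- z) * D2 = - phi (Q * exp (- z)) * (\<Sum>n. F0 (Q ^ n * (Q * exp (- z))))"
    using phi_deriv[of "Q * exp (- z)"] by blast
  have shift: "(\<Sum>n. F0 (Q ^ n * (Q * exp (- z)))) = (\<Sum>n. F0 (Q ^ (n + 1) * exp (- z)))"
    by (simp add: mult_ac)
  have 1: "((\<lambda>z. phi (exp z)) has_field_derivative D1 * exp z) (at z)"
    by (rule DERIV_chain2[OF D1(1) DERIV_exp])
  have "((\<lambda>z. Q * exp (- z)) has_field_derivative - (Q * exp (- z))) (at z)"
    by (auto intro!: derivative_eq_intros)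
  from DERIV_chain2[OF D2(1) this]
  have 2: "((\<lambda>z. phi (Q * exp (- z))) has_field_derivative D2 * - (Q * exp (- z))) (at z)" .
  have 3: "((\<lambda>z. - exp (- z / 2)) has_field_derivative exp (- z / 2) / 2) (at z)"
    by (auto intro!: derivative_eq_intros)
  have "(T has_field_derivative
     ((exp (- z / 2) / 2) * phi (exp z) + (D1 * exp z) * (- exp (- z / 2))) * phi (Q * exp (- z)) +
     (D2 * - (Q * exp (- z))) * (- exp (- z / 2) * phi (exp z))) (at z)"
    unfolding T_def[abs_def] by (intro DERIV_mult 1 2 3)
  also have "((exp (- z / 2) / 2) * phi (exp z) + (D1 * exp z) * (- exp (- z / 2))) * phi (Q * exp (- z)) +
     (D2 * - (Q * exp (- z))) * (- exp (- z / 2) * phi (exp z)) = T z * (- 1 / 2 + logsum z)"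
  proof -
    have alg: "((e / 2) * p + d1 * (- e)) * r + (- d2) * (- e * p) = (- e * p * r) * (- 1 / 2 + (- a + b))"
      if "d1 = - p * a" "d2 = - r * b" for e p r d1 d2 a b :: complex
      unfolding that by (simp add: field_simps)
    have "D1 * exp z = - phi (exp z) * (\<Sum>n. F0 (Q ^ n * exp z))" using D1(2) by (simp add: mult.commute)
    moreover have "D2 * (Q * exp (- z)) = - phi (Q * exp (- z)) * (\<Sum>n. F0 (Q ^ (n + 1) * exp (- z)))"
      using D2(2) unfolding shift by (simp only: mult.commute)
    ultimately show ?thesis unfolding T_def logsum_def mult_minus_right[of D2] by (rule alg)
  qed
  finally show ?thesis .
qed

lemma T_div_lim: "((\<lambda>z. T z / z) \<longlongrightarrow> phi Q ^ 2) (at 0)"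
proof -
  have "((\<lambda>z. exp (z / 2) - exp (- z / 2)) has_field_derivative 1) (at (0::complex))"
    by (auto intro!: derivative_eq_intros)
  hence 1: "((\<lambda>z::complex. (exp (z / 2) - exp (- z / 2)) / z) \<longlongrightarrow> 1) (at 0)"
    by (simp add: has_field_derivative_iff)
  have "isCont (\<lambda>z. phi (Q * exp z)) 0" "isCont (\<lambda>z. phi (Q * exp (- z))) 0"
    by (rule isCont_o2[OF _ isCont_phi], intro continuous_intros)+
  hence "((\<lambda>z. phi (Q * exp z)) \<longlongrightarrow> phi Q) (at 0)" "((\<lambda>z. phi (Q * exp (- z))) \<longlongrightarrow> phi Q) (at 0)"
    by (simp_all add: isCont_def)
  hence "((\<lambda>z. (exp (z / 2) - exp (- z / 2)) / z * phi (Q * exp z) * phi (Q * exp (- z))) \<longlongrightarrow> 1 * phi Q * phi Q) (at 0)"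
    by (intro tendsto_mult 1)
  thus ?thesis by (simp add: T_eq power2_eq_square)
qed

lemma phi_Q_nz: "phi Q \<noteq> 0"
proof
  assume "phi Q = 0"
  then obtain n where "Q ^ n * Q = 1" using phi_eq_0_iff by blast
  hence "norm (Q ^ Suc n) = 1" by (simp add: mult.commute)
  hence "\<bar>q\<bar> ^ Suc n = 1" by (simp only: norm_power norm_of_real)
  thus False using power_Suc_less_one[of "\<bar>q\<bar>" n] q_nz q_less by simp
qed

section \<open>Factors of automorphy of the theta product\<close>

lemma T_shift_2pi: "T (z + of_int a * (2 * of_real pi * \<i>)) = (-1) powi a * T z"
proof -
  have e: "exp (of_int a * (2 * of_real pi * \<i>)) = 1"
    using exp_integer_2pi[of "of_int a"] by (simp add: mult_ac)
  have h: "exp (- (z + of_int a * (2 * of_real pi * \<i>)) / 2) = exp (- z / 2) * (-1) powi a"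
  proof -
    have "exp (- (z + of_int a * (2 * of_real pi * \<i>)) / 2) = exp (- z / 2 + of_int (- a) * (of_real pi * \<i>))"
      by (simp add: field_simps)
    also have "\<dots> = exp (- z / 2) * exp (of_real pi * \<i>) powi (- a)"
      by (simp only: exp_add exp_power_int)
    also have "exp (of_real pi * \<i>) = -1" by (simp add: mult.commute)
    also have "(- 1 :: complex) powi (- a) = (-1) powi a"
      by (simp add: power_int_minus flip: power_int_inverse)
    finally show ?thesis .
  qed
  have e1: "exp (z + of_int a * (2 * of_real pi * \<i>)) = exp z" by (simp only: exp_add e mult_1_right)
  hence e2: "exp (- (z + of_int a * (2 * of_real pi * \<i>))) = exp (- z)" by (simp only: exp_minus)
  show ?thesis
    unfolding T_def h e1 e2 by simp
qed

lemma T_shift_ell: "T (z + ell) = - exp (- z - ell / 2) * T z"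
proof -
  have h: "exp (- (z + ell) / 2) = exp (- z / 2) * exp (- ell / 2)"
    unfolding exp_add[symmetric] by (rule arg_cong[where f = exp]) (simp add: field_simps)
  have e1: "exp (z + ell) = Q * exp z" by (simp add: exp_add exp_ell mult.commute)
  have e2: "Q * exp (- (z + ell)) = exp (- z)"
  proof -
    have "exp (- (z + ell)) = inverse (exp z * Q)" by (simp only: exp_minus exp_add exp_ell)
    thus ?thesis by (simp add: exp_minus)
  qed
  have "phi (exp (- z)) = (1 - exp (- z)) * phi (Q * exp (- z))" by (rule phi_unfold)
  hence a: "T (z + ell) = - exp (- z / 2) * exp (- ell / 2) * phi (Q * exp z) * ((1 - exp (- z)) * phi (Q * exp (- z)))"
    unfolding T_def h e1 e2 by simp
  have b: "T z = - exp (- z / 2) * ((1 - exp z) * phi (Q * exp z)) * phi (Q * exp (- z))"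
    unfolding T_def by (simp only: phi_unfold[of "exp z", symmetric])
  have c: "exp (- z - ell / 2) = exp (- z) * exp (- ell / 2)" by (simp flip: exp_add)
  have d: "exp (- z) * (1 - exp z) = - (1 - exp (- z))" by (simp add: algebra_simps flip: exp_add)
  have "- exp (- z - ell / 2) * T z = exp (- z / 2) * exp (- ell / 2) * phi (Q * exp z) * ((exp (- z) * (1 - exp z)) * phi (Q * exp (- z)))"
    unfolding b c by (simp only: mult_ac minus_mult_left[symmetric] minus_mult_right[symmetric] minus_minus)
  thus ?thesis unfolding a d by (simp only: mult_minus_left mult_minus_right)
qed

text \<open>The exponents \<open>- z - ell / 2\<close> at the successive points \<open>z\<close>,
  \<open>z + ell\<close>, and so on add up to an expression quadratic in \<open>b\<close>. Negative
  \<open>b\<close> are reached by inverting a single shift.\<close>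

lemma T_shift_int_ell: "T (z + of_int b * ell) = (-1) powi b * exp (- of_int b * z - of_int b ^ 2 * ell / 2) * T z"
proof (induction b arbitrary: z rule: int_induct[where k = 0])
  case base
  show ?case by simp
next
  case (step1 b)
  have "T (z + of_int (b + 1) * ell) = T ((z + of_int b * ell) + ell)" by (simp add: algebra_simps)
  also have "\<dots> = - exp (- (z + of_int b * ell) - ell / 2) * ((-1) powi b * exp (- of_int b * z - of_int b ^ 2 * ell / 2) * T z)"
    unfolding T_shift_ell step1 ..
  also have "\<dots> = (-1) powi (b + 1) * (exp (- (z + of_int b * ell) - ell / 2) * exp (- of_int b * z - of_int b ^ 2 * ell / 2)) * T z"
    by (simp add: power_int_add)
  also have "exp (- (z + of_int b * ell) - ell / 2) * exp (- of_int b * z - of_int b ^ 2 * ell / 2) =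
      exp (- of_int (b + 1) * z - of_int (b + 1) ^ 2 * ell / 2)"
    unfolding exp_add[symmetric] by (rule arg_cong[where f = exp]) (simp add: field_simps power2_eq_square)
  finally show ?case .
next
  case (step2 b)
  have "(-1) powi b * exp (- of_int b * z - of_int b ^ 2 * ell / 2) * T z = T ((z + of_int (b - 1) * ell) + ell)"
    using step2(2)[of z] by (simp add: algebra_simps)
  also have "\<dots> = - exp (- (z + of_int (b - 1) * ell) - ell / 2) * T (z + of_int (b - 1) * ell)"
    by (rule T_shift_ell)
  finally have "T (z + of_int (b - 1) * ell) =
     - (exp (z + of_int (b - 1) * ell + ell / 2) * ((-1) powi b * exp (- of_int b * z - of_int b ^ 2 * ell / 2) * T z))"
  proof -
    assume a: "(-1) powi b * exp (- of_int b * z - of_int b ^ 2 * ell / 2) * T z =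
       - exp (- (z + of_int (b - 1) * ell) - ell / 2) * T (z + of_int (b - 1) * ell)"
    have i: "exp (z + of_int (b - 1) * ell + ell / 2) * exp (- (z + of_int (b - 1) * ell) - ell / 2) = 1"
      unfolding exp_add[symmetric] by simp
    show ?thesis unfolding a using i by (simp add: mult.assoc[symmetric])
  qed
  also have "\<dots> = (-1) powi (b - 1) * (exp (z + of_int (b - 1) * ell + ell / 2) * exp (- of_int b * z - of_int b ^ 2 * ell / 2)) * T z"
    by (simp add: power_int_diff)
  also have "exp (z + of_int (b - 1) * ell + ell / 2) * exp (- of_int b * z - of_int b ^ 2 * ell / 2) =
      exp (- of_int (b - 1) * z - of_int (b - 1) ^ 2 * ell / 2)"
    unfolding exp_add[symmetric] by (rule arg_cong[where f = exp]) (simp add: field_simps power2_eq_square)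
  finally show ?case .
qed

lemma T_shift:
  "T (z + (of_int a * (2 * of_real pi * \<i>) + of_int b * ell)) =
     (-1) powi (a + b) * exp (- of_int b * z - of_int b ^ 2 * ell / 2) * T z"
proof -
  have "T (z + (of_int a * (2 * of_real pi * \<i>) + of_int b * ell)) =
     T ((z + of_int b * ell) + of_int a * (2 * of_real pi * \<i>))" by (simp add: algebra_simps)
  also have "\<dots> = (-1) powi a * ((-1) powi b * exp (- of_int b * z - of_int b ^ 2 * ell / 2) * T z)"
    unfolding T_shift_2pi T_shift_int_ell ..
  finally show ?thesis by (simp add: power_int_add)
qed

text \<open>The logarithmic derivative of \<open>T (mu * z)\<close> differs from \<open>zeta\<close>
  by \<open>c * z + B\<close>. Since both are odd, \<open>B = 0\<close>, so the Gaussian has no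
  linear part; the limits of \<open>T z / z\<close> and \<open>wsigma L z / z\<close> at 0 give the
  constant factor.\<close>

theorem wsigma_eq_T:
  assumes L: "cplx_lattice w1 w2 L" and mu: "mu \<noteq> 0"
    and g2: "g2 L = 20 * aX * mu ^ 4" and g3: "g3 L = 28 * bX * mu ^ 6"
  obtains \<kappa> where "\<And>z. T (mu * z) = mu * phi Q ^ 2 * exp (\<kappa> * z ^ 2) * wsigma L z"
proof -
  interpret L: cplx_lattice w1 w2 L by (rule L)
  note ident = lattice_identification[OF L mu g2 g3]
  define Z where "Z = (\<lambda>z. mu * (- 1 / 2 + logsum (mu * z)))"
  have muLam: "mu * z \<notin> Lam" if "z \<notin> L" for z using ident(1)[of z] that by simp
  have dmu: "((\<lambda>z. mu * z) has_field_derivative mu) (at z)" for z by (auto intro!: derivative_eq_intros)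
  have T': "((\<lambda>z. T (mu * z)) has_field_derivative T (mu * z) * Z z) (at z)" if "z \<notin> L" for z
    using DERIV_chain2[OF T_deriv[OF muLam[OF that]] dmu] by (simp add: Z_def mult_ac)
  define c where "c = mu ^ 2 * (1 / 12 - 2 * of_real (tate_s 1 q))"
  have Z': "(Z has_field_derivative - wp L z + c) (at z)" if "z \<notin> L" for z
  proof -
    have "((\<lambda>z. - 1 / 2 + logsum (mu * z)) has_field_derivative 0 + (- X (mu * z) + (1 / 12 - 2 * of_real (tate_s 1 q))) * mu) (at z)"
      by (intro DERIV_add DERIV_const DERIV_chain2[OF logsum_deriv[OF muLam[OF that]] dmu])
    from DERIV_cmult[OF this, of mu] show ?thesis
      unfolding Z_def ident(2)[OF that] c_def by (simp add: algebra_simps power2_eq_square)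
  qed
  obtain z0 where z0: "z0 \<notin> L" using L.half_period_notin by blast
  define B where "B = Z z0 - L.zeta z0 - c * z0"
  have B: "Z z - L.zeta z - c * z = B" if "z \<notin> L" for z
  proof -
    have "((\<lambda>z. Z z - L.zeta z - c * z) has_field_derivative 0) (at x)" if "x \<in> - L" for x
    proof -
      have "((\<lambda>z. Z z - L.zeta z - c * z) has_field_derivative (- wp L x + c) - (- wp L x) - c) (at x)"
        by (intro DERIV_diff Z' L.zeta_has_deriv DERIV_cmult_Id) (use that in auto)
      thus ?thesis by simp
    qed
    thus ?thesis unfolding B_def
      by (rule connected_deriv_zero_eq[OF L.connected_punctured L.open_punctured]) (use that z0 in auto)
  qed
  have Zodd: "Z (- z) = - Z z" if z: "z \<notin> L" for z
  proof -
    have z': "- z \<notin> L" using z by simp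
    have "((\<lambda>z. T (mu * (- z))) has_field_derivative (T (mu * (- z)) * Z (- z)) * (- 1)) (at z)"
      by (rule DERIV_chain2[where g = uminus, OF T'[OF z']]) (auto intro!: derivative_eq_intros)
    moreover have "(\<lambda>z. T (mu * (- z))) = (\<lambda>z. - T (mu * z))" by (simp add: T_odd)
    moreover have "((\<lambda>z. - T (mu * z)) has_field_derivative - (T (mu * z) * Z z)) (at z)"
      by (intro DERIV_minus T' z)
    ultimately have "(T (mu * (- z)) * Z (- z)) * (- 1) = - (T (mu * z) * Z z)"
      using DERIV_unique by metis
    hence "T (mu * z) * Z (- z) = - T (mu * z) * Z z" by (simp add: T_odd)
    moreover have "T (mu * z) \<noteq> 0" using muLam[OF z] T_eq_0_iff by simp
    ultimately show ?thesis by (metis mult_left_cancel mult_minus_left mult_minus_right)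
  qed
  have B0: "B = 0"
  proof -
    have "Z (- z0) - L.zeta (- z0) - c * (- z0) = B" using B[of "- z0"] z0 by simp
    hence "- (Z z0 - L.zeta z0 - c * z0) = B" unfolding Zodd[OF z0] L.zeta_odd[OF z0] by (simp add: algebra_simps)
    thus ?thesis unfolding B[OF z0] by simp
  qed
  have Zeq: "Z z = L.zeta z + c * z" if "z \<notin> L" for z using B[OF that] B0 by (simp add: algebra_simps)
  define A where "A = T (mu * z0) / wsigma L z0 * exp (- (c / 2) * z0 ^ 2)"
  have A: "T (mu * z) / wsigma L z * exp (- (c / 2) * z ^ 2) = A" if "z \<notin> L" for z
  proof -
    have "((\<lambda>z. T (mu * z) / wsigma L z * exp (- (c / 2) * z ^ 2)) has_field_derivative 0) (at x)" if x: "x \<in> - L" for x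
    proof -
      have nz: "wsigma L x \<noteq> 0" using x L.wsigma_zero_iff by simp
      have xL: "x \<notin> L" using x by simp
      have e: "((\<lambda>z. exp (- (c / 2) * z ^ 2)) has_field_derivative exp (- (c / 2) * x ^ 2) * (- c * x)) (at x)"
        by (auto intro!: derivative_eq_intros)
      have D: "((\<lambda>z. T (mu * z) / wsigma L z * exp (- (c / 2) * z ^ 2)) has_field_derivative
         ((T (mu * x) * Z x) * wsigma L x - T (mu * x) * (wsigma L x * L.zeta x)) / (wsigma L x * wsigma L x) * exp (- (c / 2) * x ^ 2)
          + (exp (- (c / 2) * x ^ 2) * (- c * x)) * (T (mu * x) / wsigma L x)) (at x)"
        using nz by (intro DERIV_mult DERIV_divide L.wsigma_has_deriv T' e xL)
      have alg: "((t * (y + c * x)) * s - t * (s * y)) / (s * s) * E + (E * (- c * x)) * (t / s) = 0"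
        if "s \<noteq> 0" for t y s E :: complex
        using that by (simp add: field_simps)
      show ?thesis using D unfolding Zeq[OF xL] alg[OF nz] .
    qed
    thus ?thesis unfolding A_def
      by (rule connected_deriv_zero_eq[OF L.connected_punctured L.open_punctured]) (use that z0 in auto)
  qed
  have "((\<lambda>z. mu * (T (mu * z) / (mu * z)) / (wsigma L z / z) * exp (- (c / 2) * z ^ 2)) \<longlongrightarrow>
      mu * phi Q ^ 2 / 1 * exp (- (c / 2) * 0 ^ 2)) (at 0)"
  proof (intro tendsto_intros L.wsigma_div_lim)
    have "filterlim (\<lambda>z. mu * z) (at 0) (at 0)"
      using mu by (auto simp: filterlim_at eventually_at_filter intro!: tendsto_eq_intros)
    from filterlim_compose[OF T_div_lim this]
    show "((\<lambda>z. T (mu * z) / (mu * z)) \<longlongrightarrow> phi Q ^ 2) (at 0)" .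
  qed auto
  moreover have "eventually (\<lambda>z. mu * (T (mu * z) / (mu * z)) / (wsigma L z / z) * exp (- (c / 2) * z ^ 2) = A) (at 0)"
    using L.eventually_notin_L
  proof eventually_elim
    case (elim z)
    hence "z \<noteq> 0" by auto
    hence e: "mu * (T (mu * z) / (mu * z)) / (wsigma L z / z) = T (mu * z) / wsigma L z"
      using mu by simp
    show ?case unfolding e by (rule A[OF elim])
  qed
  ultimately have "((\<lambda>z. A) \<longlongrightarrow> mu * phi Q ^ 2 / 1 * exp (- (c / 2) * 0 ^ 2)) (at (0::complex))"
    by (rule Lim_transform_eventually)
  hence Aval: "A = mu * phi Q ^ 2" by (simp add: tendsto_const_iff)
  show ?thesis
  proof (rule that[of "c / 2"])
    show "T (mu * z) = mu * phi Q ^ 2 * exp (c / 2 * z ^ 2) * wsigma L z" for z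
    proof (cases "z \<in> L")
      case True
      hence "T (mu * z) = 0" "wsigma L z = 0" using ident(1)[of z] T_eq_0_iff L.wsigma_zero_iff by blast+
      thus ?thesis by simp
    next
      case False
      hence nz: "wsigma L z \<noteq> 0" using L.wsigma_zero_iff by simp
      have "T (mu * z) = (T (mu * z) / wsigma L z * exp (- (c / 2) * z ^ 2)) * exp (c / 2 * z ^ 2) * wsigma L z"
        using nz by (simp add: exp_minus)
      thus ?thesis unfolding A[OF False] Aval .
    qed
  qed
qed

end

section \<open>Net values and changes of Weierstrass coordinates\<close>

definition unitv :: "nat \<Rightarrow> nat \<Rightarrow> int" where
  "unitv i = (\<lambda>j. if j = i then 1 else 0)"

definition pairv :: "nat \<Rightarrow> nat \<Rightarrow> nat \<Rightarrow> int" where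
  "pairv i j = (\<lambda>l. unitv i l + unitv j l)"

text \<open>The denominator is read off from the values of \<open>F\<close> at
  \<open>unitv i\<close> and \<open>pairv i j\<close>. As an operation on functions of
  \<open>v\<close> it is multiplicative, so each factor of a product formula for \<open>F\<close>
  can be treated by itself.\<close>

definition net :: "nat \<Rightarrow> ((nat \<Rightarrow> int) \<Rightarrow> complex) \<Rightarrow> (nat \<Rightarrow> int) \<Rightarrow> complex" where
  "net n F v = F v / ((\<Prod>i<n. F (unitv i) powi (2 * v i ^ 2 - (\<Sum>j<n. v i * v j))) *
      (\<Prod>i<n. \<Prod>j\<in>{i<..<n}. F (pairv i j) powi (v i * v j)))"

text \<open>What \<open>net\<close> does to exponents. The value type is generic because it is
  applied to complex exponents of \<open>exp\<close> and to integer exponents of signs.\<close>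

definition anet :: "nat \<Rightarrow> ((nat \<Rightarrow> int) \<Rightarrow> 'a::comm_ring_1) \<Rightarrow> (nat \<Rightarrow> int) \<Rightarrow> 'a" where
  "anet n a v = a v - (\<Sum>i<n. of_int (2 * v i ^ 2 - (\<Sum>j<n. v i * v j)) * a (unitv i))
      - (\<Sum>i<n. \<Sum>j\<in>{i<..<n}. of_int (v i * v j) * a (pairv i j))"

lemma net_mult: "net n (\<lambda>v. F v * G v) v = net n F v * net n G v"
  by (simp add: net_def power_int_mult_distrib prod.distrib)

lemma net_exp: "net n (\<lambda>v. exp (a v)) v = exp (anet n a v)"
proof -
  have e: "exp x powi m = exp (of_int m * x)" for x :: complex and m by (rule exp_power_int)
  show ?thesis
    unfolding net_def anet_def e by (simp add: exp_diff exp_sum)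
qed

lemma powi_sum:
  fixes c :: complex
  assumes "c \<noteq> 0"
  shows "c powi (\<Sum>i\<in>A. f i) = (\<Prod>i\<in>A. c powi f i)"
proof (cases "finite A")
  case True
  thus ?thesis by (induction A) (auto simp: power_int_add assms)
qed auto

lemma net_powi:
  assumes c: "c \<noteq> 0"
  shows "net n (\<lambda>v. c powi (a v)) v = c powi (anet n a v)"
proof -
  have e: "(c powi x) powi m = c powi (m * x)" for x m
    by (simp only: power_int_mult[symmetric] mult.commute)
  show ?thesis
    unfolding net_def anet_def e by (simp add: power_int_diff c powi_sum divide_divide_eq_left)
qed

lemma net_of_real_pos:
  assumes "r v > 0" "\<And>i. i < n \<Longrightarrow> r (unitv i) > 0" "\<And>i j. i < j \<Longrightarrow> j < n \<Longrightarrow> r (pairv i j) > 0"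
  shows "\<exists>R>0. net n (\<lambda>v. complex_of_real (r v)) v = of_real R"
proof -
  define R where "R = r v / ((\<Prod>i<n. r (unitv i) powi (2 * v i ^ 2 - (\<Sum>j<n. v i * v j))) *
      (\<Prod>i<n. \<Prod>j\<in>{i<..<n}. r (pairv i j) powi (v i * v j)))"
  have "R > 0"
    unfolding R_def using assms
    by (intro divide_pos_pos mult_pos_pos prod_pos zero_less_power_int ballI) auto
  moreover have "net n (\<lambda>v. complex_of_real (r v)) v = of_real R"
    by (simp add: net_def R_def of_real_power_int)
  ultimately show ?thesis by blast
qed

lemma sum_upper_triangle:
  fixes g :: "nat \<Rightarrow> nat \<Rightarrow> 'a::ab_group_add"
  shows "(\<Sum>i<n. \<Sum>j\<in>{i<..<n}. g i j + g j i) = (\<Sum>i<n. \<Sum>j<n. g i j) - (\<Sum>i<n. g i i)"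
proof (induction n)
  case (Suc n)
  have "(\<Sum>i<n. \<Sum>j\<in>{i<..<Suc n}. g i j + g j i) = (\<Sum>i<n. (\<Sum>j\<in>{i<..<n}. g i j + g j i) + (g i n + g n i))"
  proof (rule sum.cong)
    fix i assume "i \<in> {..<n}"
    hence "{i<..<Suc n} = insert n {i<..<n}" by auto
    thus "(\<Sum>j\<in>{i<..<Suc n}. g i j + g j i) = (\<Sum>j\<in>{i<..<n}. g i j + g j i) + (g i n + g n i)"
      by (simp add: add.commute)
  qed auto
  moreover have "{n<..<Suc n} = {}" by auto
  ultimately show ?case using Suc by (simp add: sum.distrib algebra_simps)
qed auto

lemma sum_unitv: "i < n \<Longrightarrow> (\<Sum>j<n. of_int (unitv i j) * (\<alpha> j :: 'a::comm_ring_1)) = \<alpha> i"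
proof -
  assume "i < n"
  have "(\<Sum>j<n. of_int (unitv i j) * \<alpha> j) = (\<Sum>j<n. if j = i then \<alpha> j else 0)"
    by (intro sum.cong) (auto simp: unitv_def)
  thus ?thesis using \<open>i < n\<close> by simp
qed

lemma sum_pairv: "i < n \<Longrightarrow> j < n \<Longrightarrow> (\<Sum>l<n. of_int (pairv i j l) * (\<alpha> l :: 'a::comm_ring_1)) = \<alpha> i + \<alpha> j"
  by (simp add: pairv_def distrib_right sum.distrib sum_unitv)

text \<open>The pairs containing \<open>i\<close> contribute \<open>v i\<close> times the sum of the
  other entries, so the total weight of \<open>\<alpha> i\<close> in the denominator is
  \<open>v i ^ 2\<close>. The resulting coefficient is always even, which is why integral linear
  sign exponents leave no trace.\<close>

lemma anet_linear:
  fixes \<alpha> :: "nat \<Rightarrow> 'a::comm_ring_1"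
  shows "anet n (\<lambda>v. \<Sum>i<n. of_int (v i) * \<alpha> i) v = (\<Sum>i<n. of_int (v i - v i ^ 2) * \<alpha> i)"
proof -
  have "(\<Sum>i<n. \<Sum>j\<in>{i<..<n}. of_int (v i * v j) * (\<Sum>l<n. of_int (pairv i j l) * \<alpha> l)) =
     (\<Sum>i<n. \<Sum>j\<in>{i<..<n}. of_int (v i * v j) * \<alpha> i + of_int (v j * v i) * \<alpha> j)"
    by (intro sum.cong refl) (simp add: sum_pairv, simp add: algebra_simps)
  also have "\<dots> = (\<Sum>i<n. \<Sum>j<n. of_int (v i * v j) * \<alpha> i) - (\<Sum>i<n. of_int (v i * v i) * \<alpha> i)"
    by (rule sum_upper_triangle)
  finally have tri: "(\<Sum>i<n. \<Sum>j\<in>{i<..<n}. of_int (v i * v j) * (\<Sum>l<n. of_int (pairv i j l) * \<alpha> l)) =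
     (\<Sum>i<n. of_int (\<Sum>j<n. v i * v j) * \<alpha> i) - (\<Sum>i<n. of_int (v i ^ 2) * \<alpha> i)"
    by (simp add: sum_distrib_right power2_eq_square)
  have un: "(\<Sum>i<n. of_int (2 * v i ^ 2 - (\<Sum>j<n. v i * v j)) * (\<Sum>l<n. of_int (unitv i l) * \<alpha> l)) =
      (\<Sum>i<n. of_int (2 * v i ^ 2 - (\<Sum>j<n. v i * v j)) * \<alpha> i)"
    by (intro sum.cong refl) (simp add: sum_unitv)
  show ?thesis
    unfolding anet_def tri un sum_subtractf[symmetric]
    by (intro sum.cong refl) (simp add: algebra_simps)
qed

text \<open>A quadratic form is determined by its values at unit vectors and sums of two of them,
  and the weights in the denominator are those of this reconstruction. Hence Gaussian factors and
  quadratic factors of automorphy contribute 1.\<close>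

lemma anet_quadratic:
  fixes \<alpha> \<gamma> :: "nat \<Rightarrow> 'a::comm_ring_1"
  shows "anet n (\<lambda>v. (\<Sum>i<n. of_int (v i) * \<alpha> i) * (\<Sum>i<n. of_int (v i) * \<gamma> i)) v = 0"
proof -
  have "(\<Sum>i<n. \<Sum>j\<in>{i<..<n}. of_int (v i * v j) * ((\<Sum>l<n. of_int (pairv i j l) * \<alpha> l) * (\<Sum>l<n. of_int (pairv i j l) * \<gamma> l))) =
     (\<Sum>i<n. \<Sum>j\<in>{i<..<n}. of_int (v i * v j) * (\<alpha> i * \<gamma> i + \<alpha> i * \<gamma> j) + of_int (v j * v i) * (\<alpha> j * \<gamma> j + \<alpha> j * \<gamma> i))"
    by (intro sum.cong refl) (simp add: sum_pairv, simp add: algebra_simps)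
  also have "\<dots> = (\<Sum>i<n. \<Sum>j<n. of_int (v i * v j) * (\<alpha> i * \<gamma> i + \<alpha> i * \<gamma> j)) -
     (\<Sum>i<n. of_int (v i * v i) * (\<alpha> i * \<gamma> i + \<alpha> i * \<gamma> i))"
    by (rule sum_upper_triangle)
  also have "(\<Sum>i<n. \<Sum>j<n. of_int (v i * v j) * (\<alpha> i * \<gamma> i + \<alpha> i * \<gamma> j)) =
     (\<Sum>i<n. of_int (\<Sum>j<n. v i * v j) * (\<alpha> i * \<gamma> i)) + (\<Sum>i<n. of_int (v i) * \<alpha> i) * (\<Sum>i<n. of_int (v i) * \<gamma> i)"
  proof -
    have "(\<Sum>i<n. \<Sum>j<n. of_int (v i * v j) * (\<alpha> i * \<gamma> i + \<alpha> i * \<gamma> j)) =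
       (\<Sum>i<n. \<Sum>j<n. of_int (v i * v j) * (\<alpha> i * \<gamma> i)) + (\<Sum>i<n. \<Sum>j<n. (of_int (v i) * \<alpha> i) * (of_int (v j) * \<gamma> j))"
      unfolding sum.distrib[symmetric] by (intro sum.cong refl) (simp add: algebra_simps)
    moreover have "(\<Sum>i<n. \<Sum>j<n. of_int (v i * v j) * (\<alpha> i * \<gamma> i)) = (\<Sum>i<n. of_int (\<Sum>j<n. v i * v j) * (\<alpha> i * \<gamma> i))"
      by (simp only: of_int_sum sum_distrib_right)
    ultimately show ?thesis by (simp only: sum_product)
  qed
  finally have tri: "(\<Sum>i<n. \<Sum>j\<in>{i<..<n}. of_int (v i * v j) * ((\<Sum>l<n. of_int (pairv i j l) * \<alpha> l) * (\<Sum>l<n. of_int (pairv i j l) * \<gamma> l))) =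
     (\<Sum>i<n. of_int (\<Sum>j<n. v i * v j) * (\<alpha> i * \<gamma> i)) + (\<Sum>i<n. of_int (v i) * \<alpha> i) * (\<Sum>i<n. of_int (v i) * \<gamma> i)
      - (\<Sum>i<n. of_int (v i * v i) * (\<alpha> i * \<gamma> i + \<alpha> i * \<gamma> i))" .
  have un: "(\<Sum>i<n. of_int (2 * v i ^ 2 - (\<Sum>j<n. v i * v j)) * ((\<Sum>l<n. of_int (unitv i l) * \<alpha> l) * (\<Sum>l<n. of_int (unitv i l) * \<gamma> l))) =
      (\<Sum>i<n. of_int (v i * v i) * (\<alpha> i * \<gamma> i + \<alpha> i * \<gamma> i)) - (\<Sum>i<n. of_int (\<Sum>j<n. v i * v j) * (\<alpha> i * \<gamma> i))"
    unfolding sum_subtractf[symmetric]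
    by (intro sum.cong refl) (simp add: sum_unitv, simp add: algebra_simps power2_eq_square)
  show ?thesis unfolding anet_def tri un by simp
qed

lemma anet_const: "anet n (\<lambda>_. 1) v = - Nq n v"
proof -
  have "(\<Sum>i<n. \<Sum>j\<in>{i<..<n}. v i * v j + v j * v i) = (\<Sum>i<n. \<Sum>j<n. v i * v j) - (\<Sum>i<n. v i * v i)"
    by (rule sum_upper_triangle)
  hence 1: "2 * (\<Sum>i<n. \<Sum>j\<in>{i<..<n}. v i * v j) = (\<Sum>i<n. \<Sum>j<n. v i * v j) - (\<Sum>i<n. v i ^ 2)"
    by (simp add: sum.distrib power2_eq_square mult.commute sum_distrib_left)
  have 2: "(\<Sum>i<n. 2 * v i ^ 2 - (\<Sum>j<n. v i * v j)) = 2 * (\<Sum>i<n. v i ^ 2) - (\<Sum>i<n. \<Sum>j<n. v i * v j)"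
    by (simp add: sum_subtractf sum_distrib_left)
  show ?thesis unfolding anet_def Nq_def using 1 2 by simp
qed

lemma anet_add: "anet n (\<lambda>v. a v + b v) v = anet n a v + anet n b v"
  by (simp add: anet_def distrib_left sum.distrib)

lemma anet_cmult: "anet n (\<lambda>v. c * a v) v = c * anet n a v"
  by (simp add: anet_def right_diff_distrib sum_distrib_left mult.left_commute[of _ c])

lemma net_const: "c \<noteq> 0 \<Longrightarrow> net n (\<lambda>_. c) v = c powi (- Nq n v)"
  using net_powi[of c n "\<lambda>_. 1" v] by (simp add: anet_const)

lemma netPsi_eq_net: "netPsi L n z v = (-1) powi (Nq n v) * net n (\<lambda>v. wsigma L (\<Sum>i<n. of_int (v i) * z i)) v"
proof -
  have 1: "(\<Prod>i<n. wsigma L (\<Sum>l<n. of_int (unitv i l) * z l) powi (2 * v i ^ 2 - (\<Sum>j<n. v i * v j))) =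
     (\<Prod>i<n. wsigma L (z i) powi (2 * v i ^ 2 - (\<Sum>j<n. v i * v j)))"
    by (intro prod.cong refl) (simp add: sum_unitv)
  have 2: "(\<Prod>i<n. \<Prod>j\<in>{i<..<n}. wsigma L (\<Sum>l<n. of_int (pairv i j l) * z l) powi (v i * v j)) =
     (\<Prod>i<n. \<Prod>j\<in>{i<..<n}. wsigma L (z i + z j) powi (v i * v j))"
    by (intro prod.cong refl) (simp add: sum_pairv)
  show ?thesis unfolding netPsi_def net_def 1 2 by simp
qed

section \<open>Invariants under a change of Weierstrass coordinates\<close>

lemma weq_coeffs_unique:
  fixes a1 :: real
  assumes "\<And>x y. a1 * x * y + a3 * y - a2 * x ^ 2 - a4 * x - a6 = a1' * x * y + a3' * y - a2' * x ^ 2 - a4' * x - a6'"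
  shows "a1 = a1'" "a2 = a2'" "a3 = a3'" "a4 = a4'" "a6 = a6'"
proof -
  show 6: "a6 = a6'" using assms[of 0 0] by simp
  show 3: "a3 = a3'" using assms[of 0 1] 6 by simp
  have "a2 + a4 = a2' + a4'" "a2 - a4 = a2' - a4'" using assms[of 1 0] assms[of "-1" 0] 6 by auto
  thus 2: "a2 = a2'" and 4: "a4 = a4'" by auto
  show "a1 = a1'" using assms[of 1 1] 2 3 4 6 by simp
qed

text \<open>The leading terms \<open>y ^ 2\<close> and \<open>x ^ 3\<close> scale by
  \<open>mu ^ 6\<close> on both sides. What remains is an identity in all real \<open>x\<close> and
  \<open>y\<close>, so coefficients may be compared and powers of \<open>mu\<close>
  cancelled.\<close>

lemma wiso_coeffs:
  assumes "wiso E E' mu r s t"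
  shows "mu * A1 E' = A1 E + 2 * s"
    and "mu ^ 2 * A2 E' = A2 E - s * A1 E + 3 * r - s ^ 2"
    and "mu ^ 3 * A3 E' = A3 E + r * A1 E + 2 * t"
    and "mu ^ 4 * A4 E' = A4 E - s * A3 E + 2 * r * A2 E - (t + r * s) * A1 E + 3 * r ^ 2 - 2 * s * t"
    and "mu ^ 6 * A6 E' = A6 E + r * A4 E + r ^ 2 * A2 E + r ^ 3 - t * A3 E - t ^ 2 - r * t * A1 E"
proof -
  have mu: "mu \<noteq> 0" and eq: "\<And>x y. weq E (mu^2 * x + r) (mu^3 * y + s * mu^2 * x + t) = mu^6 * weq E' x y"
    using assms by (auto simp: wiso_def)
  define d2 where "d2 = A2 E - s * A1 E + 3 * r - s ^ 2"
  define d4 where "d4 = A4 E - s * A3 E + 2 * r * A2 E - (t + r * s) * A1 E + 3 * r ^ 2 - 2 * s * t"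
  define d6 where "d6 = A6 E + r * A4 E + r ^ 2 * A2 E + r ^ 3 - t * A3 E - t ^ 2 - r * t * A1 E"
  have ident: "(mu ^ 5 * (A1 E + 2 * s)) * x * y + (mu ^ 3 * (A3 E + r * A1 E + 2 * t)) * y - (mu ^ 4 * d2) * x ^ 2 - (mu ^ 2 * d4) * x - d6
     = (mu ^ 6 * A1 E') * x * y + (mu ^ 6 * A3 E') * y - (mu ^ 6 * A2 E') * x ^ 2 - (mu ^ 6 * A4 E') * x - mu ^ 6 * A6 E'" for x y
  proof -
    have "(mu ^ 5 * (A1 E + 2 * s)) * x * y + (mu ^ 3 * (A3 E + r * A1 E + 2 * t)) * y - (mu ^ 4 * d2) * x ^ 2 - (mu ^ 2 * d4) * x - d6
       = weq E (mu^2 * x + r) (mu^3 * y + s * mu^2 * x + t) - mu ^ 6 * y ^ 2 + mu ^ 6 * x ^ 3"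
      unfolding weq_def d2_def d4_def d6_def by algebra
    also have "\<dots> = mu ^ 6 * weq E' x y - mu ^ 6 * y ^ 2 + mu ^ 6 * x ^ 3" unfolding eq ..
    also have "\<dots> = (mu ^ 6 * A1 E') * x * y + (mu ^ 6 * A3 E') * y - (mu ^ 6 * A2 E') * x ^ 2 - (mu ^ 6 * A4 E') * x - mu ^ 6 * A6 E'"
      unfolding weq_def by algebra
    finally show ?thesis .
  qed
  note c = weq_coeffs_unique[OF ident]
  have can: "x = y" if "mu ^ k * x = mu ^ k * y" for k x y using that mu by simp
  have "mu ^ 5 * (mu * A1 E') = mu ^ 5 * (A1 E + 2 * s)" unfolding c(1) by algebra
  thus "mu * A1 E' = A1 E + 2 * s" by (rule can)
  have "mu ^ 4 * (mu ^ 2 * A2 E') = mu ^ 4 * d2" unfolding c(2) by algebra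
  thus "mu ^ 2 * A2 E' = A2 E - s * A1 E + 3 * r - s ^ 2" unfolding d2_def by (rule can)
  have "mu ^ 3 * (mu ^ 3 * A3 E') = mu ^ 3 * (A3 E + r * A1 E + 2 * t)" unfolding c(3) by algebra
  thus "mu ^ 3 * A3 E' = A3 E + r * A1 E + 2 * t" by (rule can)
  have "mu ^ 2 * (mu ^ 4 * A4 E') = mu ^ 2 * d4" unfolding c(4) by algebra
  thus "mu ^ 4 * A4 E' = A4 E - s * A3 E + 2 * r * A2 E - (t + r * s) * A1 E + 3 * r ^ 2 - 2 * s * t"
    unfolding d4_def by (rule can)
  show "mu ^ 6 * A6 E' = A6 E + r * A4 E + r ^ 2 * A2 E + r ^ 3 - t * A3 E - t ^ 2 - r * t * A1 E"
    unfolding c(5)[symmetric] d6_def ..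
qed

lemma wiso_b2:
  assumes "wiso E E' mu r s t"
  shows "mu ^ 2 * b2 E' = b2 E + 12 * r"
proof -
  have "mu ^ 2 * b2 E' = (mu * A1 E') ^ 2 + 4 * (mu ^ 2 * A2 E')" unfolding b2_def by algebra
  also have "\<dots> = b2 E + 12 * r" unfolding wiso_coeffs[OF assms] b2_def by algebra
  finally show ?thesis .
qed

lemma wiso_b4:
  assumes "wiso E E' mu r s t"
  shows "mu ^ 4 * b4 E' = b4 E + r * b2 E + 6 * r ^ 2"
proof -
  have "mu ^ 4 * b4 E' = 2 * (mu ^ 4 * A4 E') + (mu * A1 E') * (mu ^ 3 * A3 E')" unfolding b4_def by algebra
  also have "\<dots> = b4 E + r * b2 E + 6 * r ^ 2" unfolding wiso_coeffs[OF assms] b4_def b2_def by algebra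
  finally show ?thesis .
qed

lemma wiso_b6:
  assumes "wiso E E' mu r s t"
  shows "mu ^ 6 * b6 E' = b6 E + 2 * r * b4 E + r ^ 2 * b2 E + 4 * r ^ 3"
proof -
  have "mu ^ 6 * b6 E' = (mu ^ 3 * A3 E') ^ 2 + 4 * (mu ^ 6 * A6 E')" unfolding b6_def by algebra
  also have "\<dots> = b6 E + 2 * r * b4 E + r ^ 2 * b2 E + 4 * r ^ 3"
    unfolding wiso_coeffs[OF assms] b4_def b2_def b6_def by algebra
  finally show ?thesis .
qed

lemma wiso_c4:
  assumes "wiso E E' mu r s t"
  shows "c4 E = mu ^ 4 * c4 E'"
proof -
  have "mu ^ 4 * c4 E' = (mu ^ 2 * b2 E') ^ 2 - 24 * (mu ^ 4 * b4 E')" unfolding c4_def by algebra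
  also have "\<dots> = c4 E" unfolding wiso_b2[OF assms] wiso_b4[OF assms] c4_def by algebra
  finally show ?thesis ..
qed

lemma wiso_c6:
  assumes "wiso E E' mu r s t"
  shows "c6 E = mu ^ 6 * c6 E'"
proof -
  have "mu ^ 6 * c6 E' = - ((mu ^ 2 * b2 E') ^ 3) + 36 * (mu ^ 2 * b2 E') * (mu ^ 4 * b4 E') - 216 * (mu ^ 6 * b6 E')"
    unfolding c6_def by algebra
  also have "\<dots> = c6 E" unfolding wiso_b2[OF assms] wiso_b4[OF assms] wiso_b6[OF assms] c6_def by algebra
  finally show ?thesis ..
qed

section \<open>Signs of the real theta function\<close>

context tate
begin

definition phir :: "real \<Rightarrow> real" where
  "phir x = (\<Prod>n. 1 - q ^ n * x)"

lemma phir_has_prod: "(\<lambda>n. 1 - q ^ n * x) has_prod phir x"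
proof -
  have "summable (\<lambda>n. \<bar>q\<bar> ^ n * \<bar>x\<bar>)"
    using q_less by (intro summable_mult2 summable_geometric) auto
  hence "abs_convergent_prod (\<lambda>n. 1 - q ^ n * x)"
    by (simp add: abs_convergent_prod_conv_summable abs_mult power_abs)
  thus ?thesis
    unfolding phir_def by (intro convergent_prod_has_prod abs_convergent_prod_imp_convergent_prod)
qed

lemma phi_of_real: "phi (of_real x) = of_real (phir x)"
proof -
  have "(\<lambda>n. complex_of_real (1 - q ^ n * x)) has_prod of_real (phir x)"
    using phir_has_prod[of x] by (subst has_prod_of_real_iff)
  hence "(\<lambda>n. 1 - Q ^ n * of_real x) has_prod of_real (phir x)" by simp
  from has_prod_unique2[OF phi_has_prod this] show ?thesis .
qed

lemma phir_pos: "(\<And>n. q ^ n * x < 1) \<Longrightarrow> phir x > 0"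
  by (rule has_prod_pos[OF phir_has_prod]) auto

lemma phir_unfold: "phir x = (1 - x) * phir (q * x)"
proof -
  have e: "Q * of_real x = of_real (q * x)" by simp
  have "complex_of_real (phir x) = of_real ((1 - x) * phir (q * x))"
    using phi_unfold[of "of_real x"] unfolding e phi_of_real by simp
  thus ?thesis by (simp only: of_real_eq_iff)
qed

text \<open>\<open>T\<close> without its exponential prefactor and its leading sign, as a function
  of the real number \<open>u = exp z\<close>.\<close>

definition theta :: "real \<Rightarrow> real" where
  "theta u = phir u * phir (q / u)"

lemma theta_shift:
  assumes "u \<noteq> 0"
  shows "theta (q * u) = - theta u / u"
proof -
  have e: "q * (1 / u) = q / u" "q / (q * u) = 1 / u" by simp_all
  have a: "theta (q * u) = phir (q * u) * ((1 - 1 / u) * phir (q / u))"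
    unfolding theta_def e(2) phir_unfold[of "1 / u"] e(1) ..
  have b: "theta u = (1 - u) * phir (q * u) * phir (q / u)"
    unfolding theta_def phir_unfold[of u] ..
  have c: "1 - 1 / u = - (1 - u) / u" using assms by (simp add: field_simps)
  show ?thesis unfolding a b c using assms by (simp add: field_simps)
qed

text \<open>The generator of the positive elements of \<open>q\<^sup>\<int>\<close>: with it, \<open>\<beta>\<^sub>i\<close> is the logarithm of \<open>|u\<^sub>i|\<close> to base \<open>pq\<close> for
  either sign of \<open>q\<close>.\<close>
definition pq :: real where "pq = (if q > 0 then q else q ^ 2)"

lemma pq: "0 < pq" "pq < 1"
proof -
  have "q ^ 2 < 1" using q_less by (simp add: abs_square_less_1)
  thus "0 < pq" "pq < 1" using q_nz q_less by (auto simp: pq_def)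
qed

text \<open>For negative \<open>q\<close> the shift is applied twice and gives the factor
  \<open>1 / (q * u ^ 2)\<close>, again negative. So one step of \<open>pq\<close> reverses the sign
  in both cases, which explains the halved logarithm in the definition of the exponents.\<close>

lemma theta_pq_shift:
  assumes "u > 0"
  shows "\<exists>c>0. theta (pq * u) = - c * theta u"
proof (cases "q > 0")
  case True
  thus ?thesis using theta_shift[of u] assms by (intro exI[of _ "1 / u"]) (auto simp: pq_def)
next
  case False
  hence q: "q < 0" using q_nz by auto
  have "theta (pq * u) = theta (q * (q * u))" using q by (simp add: pq_def power2_eq_square mult.assoc)
  also have "\<dots> = - (- theta u / u) / (q * u)"
    using theta_shift[of "q * u"] theta_shift[of u] assms q by simp
  also have "\<dots> = - (1 / (- q * u * u)) * theta u" using assms q by simp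
  finally show ?thesis using assms q by (intro exI[of _ "1 / (- q * u * u)"]) (auto intro!: mult_pos_pos mult_neg_pos)
qed

text \<open>For \<open>u\<close> between \<open>pq\<close> and 1 all factors of both products are
  positive: \<open>q ^ Suc n\<close> never exceeds \<open>pq\<close>, because odd powers of a
  negative \<open>q\<close> are negative. The endpoint 1, where the value is 0, belongs to integral
  exponents.\<close>

lemma theta_base:
  assumes "pq < u" "u \<le> 1"
  shows "theta u \<ge> 0"
proof (cases "u = 1")
  case True
  thus ?thesis using phir_unfold[of 1] by (simp add: theta_def)
next
  case False
  have u: "0 < u" "u < 1" using assms False pq by auto
  have "q ^ n * u < 1" for n
  proof -
    have "q ^ n * u \<le> \<bar>q\<bar> ^ n * u" using u by (intro mult_right_mono) (auto simp: power_abs[symmetric])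
    also have "\<dots> \<le> 1 * u" using u q_less by (intro mult_right_mono power_le_one) auto
    finally show ?thesis using u by linarith
  qed
  moreover have "q ^ n * (q / u) < 1" for n
  proof -
    have "q ^ Suc n \<le> pq"
    proof (cases "q > 0")
      case True
      have "q ^ Suc n \<le> q ^ 1" using True q_less by (intro power_decreasing) auto
      thus ?thesis using True by (simp add: pq_def)
    next
      case False
      show ?thesis
      proof (cases "even (Suc n)")
        case True
        then obtain m where m: "Suc n = 2 * m" by blast
        have "q ^ Suc n = (q ^ 2) ^ m" unfolding m by (rule power_mult)
        also have "\<dots> \<le> (q ^ 2) ^ 1" using m q_less by (intro power_decreasing) (auto simp: abs_square_le_1)
        finally show ?thesis using False by (simp add: pq_def)
      next
        case odd: False
        have "q ^ Suc n \<le> 0" unfolding power_le_zero_eq using odd False by auto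
        thus ?thesis using pq by linarith
      qed
    qed
    thus ?thesis using assms u by (simp add: field_simps)
  qed
  ultimately have "phir u > 0" "phir (q / u) > 0" by (auto intro!: phir_pos)
  thus ?thesis by (simp add: theta_def)
qed

lemma theta_pq_powi:
  assumes "u > 0"
  shows "\<exists>c>0. theta (pq powi m * u) = (-1) powi m * c * theta u"
proof (induction m rule: int_induct[where k = 0])
  case base
  show ?case by (intro exI[of _ 1]) auto
next
  case (step1 m)
  then obtain c where c: "c > 0" "theta (pq powi m * u) = (-1) powi m * c * theta u" by blast
  have "pq powi m * u > 0" using assms pq by (intro mult_pos_pos zero_less_power_int)
  then obtain d where d: "d > 0" "theta (pq * (pq powi m * u)) = - d * theta (pq powi m * u)"
    using theta_pq_shift by blast
  have e: "pq powi (m + 1) * u = pq * (pq powi m * u)" using pq by (simp add: power_int_add)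
  have "theta (pq powi (m + 1) * u) = (-1) powi (m + 1) * (d * c) * theta u"
    unfolding e d(2) c(2) by (simp add: power_int_add)
  thus ?case using c d by (intro exI[of _ "d * c"]) auto
next
  case (step2 m)
  then obtain c where c: "c > 0" "theta (pq powi m * u) = (-1) powi m * c * theta u" by blast
  have "pq powi (m - 1) * u > 0" using assms pq by (intro mult_pos_pos zero_less_power_int)
  then obtain d where d: "d > 0" "theta (pq * (pq powi (m - 1) * u)) = - d * theta (pq powi (m - 1) * u)"
    using theta_pq_shift by blast
  have e: "pq * (pq powi (m - 1) * u) = pq powi m * u" using pq by (simp add: power_int_diff)
  have "- d * theta (pq powi (m - 1) * u) = (-1) powi m * c * theta u"
    using d(2) unfolding e c(2) by simp
  hence "theta (pq powi (m - 1) * u) = (-1) powi (m - 1) * (c / d) * theta u"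
    using d by (simp add: power_int_diff field_simps)
  thus ?case using c d by (intro exI[of _ "c / d"]) auto
qed

text \<open>Splitting off the integral part of \<open>b\<close> leaves \<open>pq powr frac b\<close>
  in the base interval. The inequality is weak so that it also covers integral \<open>b\<close>, a
  zero of \<open>theta\<close>.\<close>

lemma theta_sign_pos: "(-1) powi \<lfloor>b\<rfloor> * theta (pq powr b) \<ge> 0"
proof -
  define u where "u = pq powr frac b"
  have u: "u > 0" using pq by (simp add: u_def)
  have "pq powr b = pq powr (of_int \<lfloor>b\<rfloor> + frac b)" by (simp add: frac_def)
  also have "\<dots> = pq powi \<lfloor>b\<rfloor> * u"
    using pq by (simp add: powr_add u_def powr_real_of_int')
  finally obtain c where c: "c > 0" "theta (pq powr b) = (-1) powi \<lfloor>b\<rfloor> * c * theta u"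
    using theta_pq_powi[OF u] by metis
  have "pq < u"
    using powr_less_mono'[of pq "frac b" 1] pq frac_lt_1[of b] by (simp add: u_def)
  moreover have "u \<le> 1"
    using powr_mono'[of 0 "frac b" pq] pq by (simp add: u_def)
  ultimately have "theta u \<ge> 0" by (rule theta_base)
  hence "0 \<le> c * theta u" using c by simp
  also have "\<dots> = (-1) powi \<lfloor>b\<rfloor> * theta (pq powr b)"
    unfolding c(2) by (cases "even \<lfloor>b\<rfloor>") (auto simp: power_int_minus_left)
  finally show ?thesis .
qed

lemma theta_neg:
  assumes "q > 0" "u < 0"
  shows "theta u > 0"
proof -
  have "q ^ n * u < 1" for n
  proof -
    have "q ^ n * u \<le> 0" using assms by (intro mult_nonneg_nonpos) auto
    thus ?thesis by linarith
  qed
  moreover have "q ^ n * (q / u) < 1" for n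
  proof -
    have "q ^ n * (q / u) \<le> 0" using assms by (intro mult_nonneg_nonpos divide_nonneg_nonpos) auto
    thus ?thesis by linarith
  qed
  ultimately show ?thesis by (auto simp: theta_def intro!: mult_pos_pos phir_pos)
qed

lemma T_of_real_exp:
  assumes "exp x = of_real u" "u \<noteq> 0"
  shows "T x = - exp (- x / 2) * of_real (theta u)"
proof -
  have e: "Q * exp (- x) = of_real (q / u)"
    using assms by (simp add: exp_minus field_simps)
  show ?thesis unfolding T_def assms(1) e phi_of_real theta_def by simp
qed

text \<open>The coefficients found in the expansion of \<open>X\<close> are the algebraic invariants
  of the Tate curve, so the scaled Tate series and the Weierstrass function of \<open>E\<close>
  satisfy the same equation.\<close>

lemma tate_invariants:
  assumes "wiso E (tate_curve q) mu r s t"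
  shows "of_real (c4 E / 12) = 20 * aX * of_real mu ^ 4"
    and "of_real (c6 E / 216) = 28 * bX * of_real mu ^ 6"
    and "mu ^ 2 = b2 E + 12 * r" and "mu = A1 E + 2 * s" and "A3 E + r * A1 E + 2 * t = 0"
proof -
  have c4: "c4 (tate_curve q) = 1 + 240 * tate_s 3 q"
    by (simp add: c4_def b2_def b4_def tate_curve_def)
  have c6: "c6 (tate_curve q) = - 1 + 504 * tate_s 5 q"
    by (simp add: c6_def b2_def b4_def b6_def tate_curve_def field_simps)
  show "of_real (c4 E / 12) = 20 * aX * of_real mu ^ 4"
    unfolding wiso_c4[OF assms] c4 by (simp add: aX_def s3_def field_simps)
  show "of_real (c6 E / 216) = 28 * bX * of_real mu ^ 6"
    unfolding wiso_c6[OF assms] c6 by (simp add: bX_def s5_def field_simps)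
  show "mu ^ 2 = b2 E + 12 * r"
  proof -
    have "b2 (tate_curve q) = 1" by (simp add: b2_def tate_curve_def)
    thus ?thesis using wiso_b2[OF assms] by simp
  qed
  show "mu = A1 E + 2 * s"
    using wiso_coeffs(1)[OF assms] by (simp add: tate_curve_def)
  show "A3 E + r * A1 E + 2 * t = 0"
    using wiso_coeffs(3)[OF assms] by (simp add: tate_curve_def)
qed

text \<open>The two parametrizations differ by the normalizing shifts \<open>b2 E / 12\<close> and
  1/12; the transformation of \<open>b2\<close> converts one into the other, with \<open>r\<close>
  as the discrepancy.\<close>

lemma unif_eq_tate_psi:
  assumes L: "cplx_lattice w1 w2 L" and iso: "wiso E (tate_curve q) mu r s t"
    and g2: "g2 L = of_real (c4 E / 12)" and g3: "g3 L = of_real (c6 E / 216)"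
  shows "unif E L z = tate_psi q mu r s t (exp (of_real mu * z))"
proof -
  interpret L: cplx_lattice w1 w2 L by (rule L)
  note inv = tate_invariants[OF iso]
  have mu: "complex_of_real mu \<noteq> 0" using iso by (simp add: wiso_def)
  note ident = lattice_identification[OF L mu, unfolded g2 g3, OF inv(1,2)]
  show ?thesis
  proof (cases "z \<in> L")
    case True
    hence "of_real mu * z \<in> Lam" using ident(1) by blast
    thus ?thesis using True by (simp add: L.unif_zero tate_psi_def tate_map_exp)
  next
    case False
    hence "of_real mu * z \<notin> Lam" using ident(1) by blast
    define m where "m = complex_of_real mu"
    define a1 where "a1 = complex_of_real (A1 E)"
    define a3 where "a3 = complex_of_real (A3 E)"
    define x where "x = X (m * z) - 1 / 12"
    define y where "y = X' (m * z)"
    have e1: "complex_of_real (b2 E / 12) = m ^ 2 / 12 - of_real r"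
    proof -
      have b: "b2 E = mu ^ 2 - 12 * r" using inv(3) by simp
      show ?thesis unfolding b m_def by (simp add: field_simps)
    qed
    have e2: "m = a1 + 2 * of_real s"
      unfolding m_def a1_def inv(4) by simp
    have "of_real (A3 E + r * A1 E + 2 * t) = (0::complex)" unfolding inv(5) by simp
    hence e3: "a3 = - of_real r * a1 - 2 * of_real t"
      unfolding a1_def a3_def by (simp add: algebra_simps eq_neg_iff_add_eq_0)
    have wx: "wp L z - of_real (b2 E / 12) = m ^ 2 * x + of_real r"
      unfolding ident(2)[OF False] e1 x_def m_def by (simp add: algebra_simps)
    have "2 * (m ^ 3 * ((y - x) / 2) + of_real s * m ^ 2 * x + of_real t) =
       m ^ 3 * y - a1 * (m ^ 2 * x + of_real r) - a3"
      unfolding e3 unfolding e2 by (simp add: field_simps eval_nat_numeral)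
    hence wy: "(wp_deriv L z - of_real (A1 E) * (m ^ 2 * x + of_real r) - of_real (A3 E)) / 2 =
       m ^ 3 * ((y - x) / 2) + of_real s * m ^ 2 * x + of_real t"
      unfolding ident(3)[OF False] a1_def a3_def y_def m_def by (simp add: field_simps)
    show ?thesis
      using False \<open>of_real mu * z \<notin> Lam\<close>
      unfolding L.unif_nonzero[OF False] wx wy
      by (simp add: tate_psi_def tate_map_exp x_def y_def m_def)
  qed
qed

end

lemma Parity_sign: "R > 0 \<Longrightarrow> Parity ((-1) powi m * R) mod 2 = m mod 2"
  by (cases "even m") (auto simp: Parity_def power_int_minus_left even_iff_mod_2_eq_zero odd_iff_mod_2_eq_one)

lemma minus_i_powi_double: "(- \<i>) powi (2 * m) = (-1) powi m"
  by (simp add: power_int_mult)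

lemma rational_common_denominator:
  fixes c :: "nat \<Rightarrow> real"
  assumes "\<forall>i<n. c i \<in> \<rat>"
  shows "\<exists>D v. D \<noteq> (0::int) \<and> (\<forall>i<n. of_int D * c i = of_int (v i))"
  using assms
proof (induction n)
  case 0
  show ?case by (intro exI[of _ 1]) auto
next
  case (Suc n)
  then obtain D v where D: "D \<noteq> 0" "\<forall>i<n. of_int D * c i = of_int (v i)" by auto
  obtain a b :: int where ab: "b > 0" "c n = of_int a / of_int b"
    using Suc.prems Rats_cases'[of "c n"] by (metis lessI)
  show ?case
  proof (intro exI[of _ "D * b"] exI[of _ "\<lambda>i. if i = n then D * a else b * v i"] conjI allI impI)
    show "D * b \<noteq> 0" using D(1) ab(1) by simp
    fix i assume "i < Suc n"
    show "of_int (D * b) * c i = of_int (if i = n then D * a else b * v i)"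
    proof (cases "i = n")
      case True
      thus ?thesis using ab by simp
    next
      case False
      hence "of_int D * c i = of_int (v i)" using \<open>i < Suc n\<close> D(2) by simp
      hence "of_int b * (of_int D * c i) = of_int b * of_int (v i)" by simp
      thus ?thesis using False by (simp add: mult_ac)
    qed
  qed
qed

section \<open>Signs of net polynomials\<close>

theorem theorem1p9:
  fixes E :: "real wcurve" and n k :: nat and P :: "nat \<Rightarrow> real ecpt"
    and L :: "complex set" and z :: "nat \<Rightarrow> complex"
    and q mu r s t :: real and u :: "nat \<Rightarrow> real"
  assumes ell: "elliptic E"
    and onc: "\<forall>i<n. on_curve E (P i)"
    and indep: "Z_lin_indep E n P"
    and per: "period_lattice E L"
    and zs: "\<forall>i<n. unif E L (z i) = map_pt complex_of_real (P i)"
    and q: "0 < \<bar>q\<bar>" "\<bar>q\<bar> < 1"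
    and iso: "wiso E (tate_curve q) mu r s t"
    and us: "\<forall>i<n. tate_psi q mu r s t (complex_of_real (u i)) = map_pt complex_of_real (P i)"
    and unorm: "\<forall>i<n. (if q > 0 then q < \<bar>u i\<bar> \<and> \<bar>u i\<bar> < 1 else q^2 < u i \<and> u i < 1)"
    and k: "k \<le> n" "\<forall>i<k. u i < 0" "\<forall>i. k \<le> i \<and> i < n \<longrightarrow> u i > 0"
  shows "let \<beta> = (\<lambda>i. if q > 0 then log q \<bar>u i\<bar> else log \<bar>q\<bar> (u i) / 2) in
     (\<forall>i<n. \<beta> i \<notin> \<rat>) \<and>
     (\<forall>c :: nat \<Rightarrow> real. (\<forall>i<n. c i \<in> \<rat>) \<and> (\<Sum>i<n. c i * \<beta> i) = 0 \<longrightarrow> (\<forall>i<n. c i = 0)) \<and>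
     (\<exists>e::int. (e = 0 \<or> e = 1) \<and>
       (\<forall>v :: nat \<Rightarrow> int. (\<exists>i<n. v i \<noteq> 0) \<longrightarrow>
         (let \<Phi> = (-1) powi (e * Nq n v) * Re (netPsi L n z v);
              S = (\<Sum>i<k. \<Sum>j\<in>{i<..<k}. \<lfloor>\<beta> i + \<beta> j\<rfloor> * v i * v j)
                + (\<Sum>i\<in>{k..<n}. \<Sum>j\<in>{i<..<n}. \<lfloor>\<beta> i + \<beta> j\<rfloor> * v i * v j)
                + (\<Sum>i<k. v i div 2)
          in (if even (\<Sum>i<k. v i)
              then Parity \<Phi> mod 2 = (S + \<lfloor>\<Sum>i<n. of_int (v i) * \<beta> i\<rfloor>) mod 2
              else Parity \<Phi> mod 2 = S mod 2))))"
proof -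
  interpret tate q using q by unfold_locales auto
  obtain w1 w2 where "Im (w2 / w1) \<noteq> 0" "L = {of_int m * w1 + of_int n * w2 | m n. True}"
    using per by (auto simp: period_lattice_def lattice_def)
  hence L: "cplx_lattice w1 w2 L" by unfold_locales
  interpret L: cplx_lattice w1 w2 L by (rule L)
  have g2: "g2 L = of_real (c4 E / 12)" and g3: "g3 L = of_real (c6 E / 216)"
    using per by (auto simp: period_lattice_def)
  define m where "m = complex_of_real mu"
  have mu0: "mu \<noteq> 0" using iso by (simp add: wiso_def)
  hence m0: "m \<noteq> 0" by (simp add: m_def)
  have G2: "g2 L = 20 * aX * m ^ 4" and G3: "g3 L = 28 * bX * m ^ 6"
    unfolding g2 g3 m_def by (rule tate_invariants[OF iso])+
  note ident = lattice_identification[OF L m0 G2 G3]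
  obtain \<kappa> where \<kappa>: "\<And>z. T (m * z) = m * phi Q ^ 2 * exp (\<kappa> * z ^ 2) * wsigma L z"
    using wsigma_eq_T[OF L m0 G2 G3] by blast
  define \<beta> where "\<beta> = (\<lambda>i. if q > 0 then log q \<bar>u i\<bar> else log \<bar>q\<bar> (u i) / 2)"
  have u0: "u i \<noteq> 0" if "i < n" for i
  proof -
    have "if q > 0 then q < \<bar>u i\<bar> \<and> \<bar>u i\<bar> < 1 else q^2 < u i \<and> u i < 1" using unorm that by blast
    moreover have "q ^ 2 > 0" by simp
    ultimately show ?thesis by (auto split: if_splits)
  qed
  \<comment> \<open>The normalization of the \<open>u i\<close> admits negative values only for
    positive \<open>q\<close>.\<close>
  have qpos: "q > 0" if "i < k" for i
  proof (rule ccontr)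
    assume "\<not> q > 0"
    hence "q ^ 2 < u i" using unorm that k(1) by (auto split: if_splits)
    moreover have "q ^ 2 \<ge> 0" by simp
    ultimately show False using k(2) that by (meson less_asym order_le_less_trans)
  qed
  have lnpq: "ln pq < 0" using pq by simp
  have ln_u: "ln \<bar>u i\<bar> = \<beta> i * ln pq" if "i < n" for i
  proof (cases "q > 0")
    case True
    thus ?thesis using lnpq by (simp add: \<beta>_def pq_def log_def)
  next
    case False
    hence "q < 0" using q by auto
    have "u i > 0" using False unorm that by (smt (verit) zero_le_power2)
    moreover have "ln (q ^ 2) = 2 * ln \<bar>q\<bar>"
      using q by (metis power2_abs ln_realpow of_nat_numeral)
    moreover have "ln \<bar>q\<bar> \<noteq> 0" using q by simp
    ultimately show ?thesis using False by (simp add: \<beta>_def pq_def log_def)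
  qed
  have \<beta>01: "0 < \<beta> i" "\<beta> i < 1" if "i < n" for i
  proof -
    have un: "if q > 0 then q < \<bar>u i\<bar> \<and> \<bar>u i\<bar> < 1 else q^2 < u i \<and> u i < 1" using unorm that by blast
    have "pq < \<bar>u i\<bar> \<and> \<bar>u i\<bar> < 1"
    proof (cases "q > 0")
      case False
      hence un': "q ^ 2 < u i" "u i < 1" using un by auto
      have "0 < u i" by (rule order_le_less_trans[OF zero_le_power2 un'(1)])
      hence "\<bar>u i\<bar> = u i" by simp
      thus ?thesis using un' False by (simp add: pq_def)
    qed (use un in \<open>simp add: pq_def\<close>)
    hence "ln pq < ln \<bar>u i\<bar>" "ln \<bar>u i\<bar> < 0" using pq u0[OF that] by auto
    hence "ln pq < \<beta> i * ln pq" "\<beta> i * ln pq < 0" using ln_u[OF that] by auto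
    thus "0 < \<beta> i" "\<beta> i < 1" using lnpq by (auto simp: mult_less_0_iff)
  qed
  define x where "x = (\<lambda>i. Ln (complex_of_real (u i)))"
  define sg where "sg = (\<lambda>i. if i < k then 1 else 0 :: int)"
  have x_eq: "x i = of_real (\<beta> i * ln pq) + of_int (sg i) * (\<i> * of_real pi)" if i: "i < n" for i
  proof (cases "i < k")
    case True
    hence "u i < 0" using k by blast
    thus ?thesis using True ln_u[OF i] by (simp add: x_def sg_def Ln_of_real')
  next
    case False
    hence "u i > 0" using k i by auto
    thus ?thesis using False ln_u[OF i] by (simp add: x_def sg_def Ln_of_real)
  qed
  \<comment> \<open>\<open>z i\<close> and \<open>x i / m\<close> map to the same point, hence
    differ by a period; \<open>p i\<close> records its coordinates in \<open>Lam\<close>.\<close>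
  have "\<forall>i. \<exists>p :: int \<times> int. i < n \<longrightarrow> m * z i = x i + (of_int (fst p) * (2 * of_real pi * \<i>) + of_int (snd p) * ell)"
  proof (intro allI)
    fix i
    show "\<exists>p :: int \<times> int. i < n \<longrightarrow> m * z i = x i + (of_int (fst p) * (2 * of_real pi * \<i>) + of_int (snd p) * ell)"
    proof (cases "i < n")
      case True
      have "unif E L (x i / m) = tate_psi q mu r s t (exp (of_real mu * (x i / m)))"
        by (rule unif_eq_tate_psi[OF L iso g2 g3])
      also have "exp (of_real mu * (x i / m)) = of_real (u i)"
        using m0 u0[OF True] by (simp add: x_def m_def)
      also have "tate_psi q mu r s t (complex_of_real (u i)) = unif E L (z i)"
        using us zs True by simp
      finally have "z i - x i / m \<in> L" using L.unif_inj by metis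
      hence "m * (z i - x i / m) \<in> Lam" using ident(1) by blast
      then obtain a b where "m * (z i - x i / m) = of_int a * (2 * of_real pi * \<i>) + of_int b * ell"
        by (rule lam.L_memE)
      hence "m * z i = x i + (of_int a * (2 * of_real pi * \<i>) + of_int b * ell)"
        using m0 by (simp add: algebra_simps)
      thus ?thesis by (intro exI[of _ "(a, b)"]) auto
    qed auto
  qed
  then obtain p where p: "\<And>i. i < n \<Longrightarrow> m * z i = x i + (of_int (fst (p i)) * (2 * of_real pi * \<i>) + of_int (snd (p i)) * ell)"
    by metis
  define a where "a = (\<lambda>i. fst (p i))"
  define b where "b = (\<lambda>i. snd (p i))"
  define zv where "zv = (\<lambda>v :: nat \<Rightarrow> int. \<Sum>i<n. of_int (v i) * z i)"
  define xv where "xv = (\<lambda>v :: nat \<Rightarrow> int. \<Sum>i<n. of_int (v i) * x i)"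
  define bv where "bv = (\<lambda>v :: nat \<Rightarrow> int. \<Sum>i<n. of_int (v i) * \<beta> i)"
  define sv where "sv = (\<lambda>v :: nat \<Rightarrow> int. \<Sum>i<n. of_int (v i) * sg i)"
  define Bv where "Bv = (\<lambda>v :: nat \<Rightarrow> int. \<Sum>i<n. of_int (v i) * b i)"
  \<comment> \<open>The complex copy of \<open>Bv\<close>, written as a linear form so that
    \<open>anet_quadratic\<close> applies to \<open>Bc v * xv v\<close>.\<close>
  define Bc where "Bc = (\<lambda>v :: nat \<Rightarrow> int. \<Sum>i<n. of_int (v i) * complex_of_int (b i))"
  define Av where "Av = (\<lambda>v :: nat \<Rightarrow> int. \<Sum>i<n. of_int (v i) * a i)"
  have Bc: "Bc v = of_int (Bv v)" for v by (simp add: Bc_def Bv_def)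
  have mzv: "m * zv v = xv v + (of_int (Av v) * (2 * of_real pi * \<i>) + of_int (Bv v) * ell)" for v
  proof -
    have "m * zv v = (\<Sum>i<n. of_int (v i) * (m * z i))"
      unfolding zv_def sum_distrib_left by (intro sum.cong refl) (simp add: mult_ac)
    also have "\<dots> = (\<Sum>i<n. of_int (v i) * x i + (of_int (v i * a i) * (2 * of_real pi * \<i>) + of_int (v i * b i) * ell))"
      by (intro sum.cong refl) (simp add: p a_def b_def algebra_simps)
    also have "\<dots> = xv v + (of_int (Av v) * (2 * of_real pi * \<i>) + of_int (Bv v) * ell)"
      by (simp add: sum.distrib xv_def Av_def Bv_def sum_distrib_right)
    finally show ?thesis .
  qed
  have xv_eq: "xv v = of_real (bv v * ln pq) + of_int (sv v) * (\<i> * of_real pi)" for v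
  proof -
    have "xv v = (\<Sum>i<n. of_int (v i) * of_real (\<beta> i) * of_real (ln pq) + of_int (v i * sg i) * (\<i> * of_real pi))"
      unfolding xv_def by (intro sum.cong refl) (simp add: x_eq algebra_simps)
    thus ?thesis by (simp add: sum.distrib bv_def sv_def sum_distrib_right)
  qed
  have zv_Lam: "zv v \<in> L \<longleftrightarrow> xv v \<in> Lam" for v
  proof -
    have "of_int (Av v) * (2 * of_real pi * \<i>) + of_int (Bv v) * ell \<in> Lam" by (rule lam.L_memI)
    thus ?thesis unfolding ident(1)[of "zv v"] mzv by simp
  qed
  have indepZ: "\<forall>i<n. v i = 0" if "zv v \<in> L" for v
    using indep L.lincomb_eq_Inf_iff[OF g2 zs, of v] that unfolding Z_lin_indep_def zv_def by blast
  have key: "\<forall>i<n. v i = 0" if "bv v = of_int N" for v and N :: int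
  proof -
    \<comment> \<open>An integral value \<open>bv v\<close> makes the product of the powers of
      \<open>u i\<close> equal to a power of \<open>pq\<close> only up to sign. Doubling
      \<open>v\<close> removes the sign, and the product becomes a power of
      \<open>q\<close>.\<close>
    define w where "w = (\<lambda>i. 2 * v i)"
    have "bv w = 2 * bv v" by (simp add: bv_def w_def sum_distrib_left mult_ac)
    hence bw: "bv w = 2 * of_int N" using that by simp
    have sw: "sv w = 2 * sv v" by (simp add: sv_def w_def sum_distrib_left mult_ac)
    have "exp (xv w) = exp (of_real (bv w * ln pq)) * exp (of_int (sv v) * (2 * of_real pi * \<i>))"
      unfolding xv_eq sw exp_add by (simp add: mult_ac)
    also have "exp (of_int (sv v) * (2 * of_real pi * \<i>)) = 1"
      using exp_integer_2pi[of "of_int (sv v)"] by (simp add: mult_ac)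
    also have "exp (of_real (bv w * ln pq)) = complex_of_real (pq powr (bv w))"
      using pq unfolding exp_of_real powr_def by simp
    also have "pq powr (bv w) = pq powi (2 * N)"
      using pq powr_real_of_int'[of pq "2 * N"] by (simp add: bw)
    also have "complex_of_real (pq powi (2 * N)) = Q powi (if q > 0 then 2 * N else 2 * (2 * N))"
    proof (cases "q > 0")
      case True
      thus ?thesis by (simp add: pq_def of_real_power_int)
    next
      case False
      have "complex_of_real (pq powi (2 * N)) = (Q powi 2) powi (2 * N)"
        using False by (simp add: pq_def of_real_power_int)
      also have "\<dots> = Q powi (2 * (2 * N))" by (simp only: power_int_mult)
      finally show ?thesis using False by simp
    qed
    finally have "xv w \<in> Lam" using Lam_iff by auto
    hence "\<forall>i<n. w i = 0" using indepZ zv_Lam by blast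
    thus ?thesis by (simp add: w_def)
  qed
  have P2: "\<forall>i<n. c i = 0" if c: "\<forall>i<n. c i \<in> \<rat>" "(\<Sum>i<n. c i * \<beta> i) = 0" for c :: "nat \<Rightarrow> real"
  proof -
    obtain D v where D: "D \<noteq> (0::int)" "\<forall>i<n. of_int D * c i = of_int (v i)"
      using rational_common_denominator[OF c(1)] by blast
    have "bv v = (\<Sum>i<n. of_int D * c i * \<beta> i)"
      unfolding bv_def by (intro sum.cong refl) (use D(2) in auto)
    also have "\<dots> = of_int D * (\<Sum>i<n. c i * \<beta> i)" by (simp add: sum_distrib_left mult_ac)
    finally have "bv v = of_int 0" using c(2) by simp
    hence "\<forall>i<n. v i = 0" by (rule key)
    thus ?thesis using D by simp
  qed
  have P1: "\<beta> i \<notin> \<rat>" if i: "i < n" for i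
  proof
    assume "\<beta> i \<in> \<rat>"
    then obtain c d :: int where cd: "d > 0" "\<beta> i = of_int c / of_int d" by (rule Rats_cases')
    define v where "v = (\<lambda>j. d * unitv i j)"
    have "bv v = of_int d * (\<Sum>j<n. of_int (unitv i j) * \<beta> j)"
      by (simp add: bv_def v_def sum_distrib_left mult_ac)
    also have "\<dots> = of_int c" using cd i by (simp add: sum_unitv)
    finally have "v i = 0" using key i by blast
    thus False using cd(1) by (simp add: v_def unitv_def)
  qed
  \<comment> \<open>\<open>U v\<close> is the product of the powers \<open>u i powi v i\<close>.
    \<open>T (xv v)\<close> will be split into -1, a power of \<open>- \<i>\<close>, the nonnegative
    number \<open>\<rho> v\<close> and the sign \<open>(-1) powi \<eta> v\<close>, each of which
    passes separately through \<open>net\<close>.\<close>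
  define U where "U = (\<lambda>v. (-1) powi (sv v) * pq powr (bv v))"
  define \<eta> where "\<eta> = (\<lambda>v. if even (sv v) then \<lfloor>bv v\<rfloor> else 0)"
  define \<rho> where "\<rho> = (\<lambda>v. exp (- (bv v * ln pq) / 2) * \<bar>theta (U v)\<bar>)"
  have sv_k: "sv v = (\<Sum>i<k. v i)" for v
  proof -
    have "sv v = (\<Sum>i<n. if i < k then v i else 0)" unfolding sv_def by (intro sum.cong) (auto simp: sg_def)
    also have "\<dots> = (\<Sum>i\<in>{..<n} \<inter> {..<k}. v i)" by (simp add: sum.inter_restrict)
    also have "{..<n} \<inter> {..<k} = {..<k}" using k(1) by auto
    finally show ?thesis .
  qed
  have theta_eq: "theta (U v) = (-1) powi (\<eta> v) * \<bar>theta (U v)\<bar>" for v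
  proof (cases "even (sv v)")
    case True
    hence "U v = pq powr (bv v)" by (simp add: U_def power_int_minus_left)
    hence "(-1) powi (\<eta> v) * theta (U v) \<ge> 0" using theta_sign_pos[of "bv v"] True by (simp add: \<eta>_def)
    thus ?thesis by (cases "even (\<eta> v)") (auto simp: power_int_minus_left)
  next
    case False
    hence "sv v \<noteq> 0" by auto
    hence "k > 0" unfolding sv_k by (cases k) auto
    hence "q > 0" using qpos by blast
    moreover have "U v < 0" using False pq by (simp add: U_def power_int_minus_left)
    ultimately have "theta (U v) > 0" by (rule theta_neg)
    thus ?thesis using False by (simp add: \<eta>_def)
  qed
  have T_xv: "T (xv v) = (-1) * ((- \<i>) powi (sv v) * (of_real (\<rho> v) * (-1) powi (\<eta> v)))" for v
  proof -
    have "exp (xv v) = exp (of_real (bv v * ln pq)) * exp (of_real pi * \<i>) powi (sv v)"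
      unfolding xv_eq exp_add exp_power_int by (simp add: mult_ac)
    also have "exp (of_real (bv v * ln pq)) = complex_of_real (pq powr (bv v))"
      using pq unfolding exp_of_real powr_def by simp
    also have "exp (of_real pi * \<i>) = -1" by (simp add: mult.commute)
    finally have e: "exp (xv v) = of_real (U v)" by (simp add: U_def of_real_power_int mult.commute)
    have U0: "U v \<noteq> 0" using pq by (simp add: U_def)
    \<comment> \<open>Each negative \<open>u i\<close> has logarithm with imaginary part pi and thus
      contributes \<open>- \<i>\<close> to the half power.\<close>
    have h: "exp (- xv v / 2) = of_real (exp (- (bv v * ln pq) / 2)) * (- \<i>) powi (sv v)"
    proof -
      have "- xv v / 2 = of_real (- (bv v * ln pq) / 2) + of_int (sv v) * (- (of_real pi / 2) * \<i>)"
        unfolding xv_eq by (simp add: field_simps)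
      hence "exp (- xv v / 2) = exp (of_real (- (bv v * ln pq) / 2)) * exp (- (of_real pi / 2) * \<i>) powi (sv v)"
        by (simp only: exp_add exp_power_int)
      also have "exp (- (of_real pi / 2) * \<i>) = - \<i>"
        using cis_conv_exp[of "- (pi / 2)"] by (simp add: cis.ctr complex_eq_iff mult.commute)
      finally show ?thesis by (simp only: exp_of_real)
    qed
    have "T (xv v) = - exp (- xv v / 2) * of_real (theta (U v))" by (rule T_of_real_exp[OF e U0])
    also have "complex_of_real (theta (U v)) = of_real \<bar>theta (U v)\<bar> * (-1) powi (\<eta> v)"
      by (subst theta_eq) (simp add: of_real_power_int mult.commute)
    finally show ?thesis unfolding h by (simp add: \<rho>_def mult_ac)
  qed
  \<comment> \<open>Independence keeps \<open>xv v\<close> off the zeros of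
    \<open>T\<close>.\<close>
  have \<rho>_pos: "\<rho> v > 0" if "\<exists>i<n. v i \<noteq> 0" for v
  proof -
    have "xv v \<notin> Lam" using indepZ[of v] zv_Lam[of v] that by auto
    hence "T (xv v) \<noteq> 0" using T_eq_0_iff by blast
    hence "\<rho> v \<noteq> 0" unfolding T_xv by auto
    moreover have "\<rho> v \<ge> 0" by (simp add: \<rho>_def)
    ultimately show ?thesis by simp
  qed
  define F where "F = (\<lambda>v. wsigma L (zv v))"
  define M where "M = mu * phir q ^ 2"
  have M: "m * phi Q ^ 2 = of_real M" "M \<noteq> 0"
  proof -
    show "m * phi Q ^ 2 = of_real M" by (simp add: M_def m_def phi_of_real)
    thus "M \<noteq> 0" using m0 phi_Q_nz by auto
  qed
  have FT: "of_real M * (exp (\<kappa> * (zv v * zv v)) * F v) =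
      (-1) powi (Av v + Bv v) * (exp ((-1) * (Bc v * xv v) + (- ell / 2) * (Bc v * Bc v)) *
        ((-1) * ((- \<i>) powi (sv v) * (of_real (\<rho> v) * (-1) powi (\<eta> v)))))" for v
  proof -
    have "of_real M * (exp (\<kappa> * (zv v * zv v)) * F v) = T (m * zv v)"
      unfolding \<kappa> M(1) F_def by (simp add: power2_eq_square)
    also have "\<dots> = (-1) powi (Av v + Bv v) * exp (- of_int (Bv v) * xv v - of_int (Bv v) ^ 2 * ell / 2) * T (xv v)"
      unfolding mzv T_shift ..
    also have "- of_int (Bv v) * xv v - of_int (Bv v) ^ 2 * ell / 2 = (-1) * (Bc v * xv v) + (- ell / 2) * (Bc v * Bc v)"
      unfolding Bc by (simp add: power2_eq_square)
    finally show ?thesis unfolding T_xv by (simp only: mult.assoc)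
  qed
  \<comment> \<open>\<open>M\<close> has the sign of \<open>mu\<close> and will appear to the power
    \<open>Nq n v\<close>; the factor \<open>(-1) powi (e * Nq n v)\<close> makes it
    positive.\<close>
  define e where "e = (if mu > 0 then 0 else 1 :: int)"
  have P3: "Parity ((-1) powi (e * Nq n v) * Re (netPsi L n z v)) mod 2 =
     ((\<Sum>i<k. \<Sum>j\<in>{i<..<k}. \<lfloor>\<beta> i + \<beta> j\<rfloor> * v i * v j)
      + (\<Sum>i\<in>{k..<n}. \<Sum>j\<in>{i<..<n}. \<lfloor>\<beta> i + \<beta> j\<rfloor> * v i * v j) + (\<Sum>i<k. v i div 2)
      + (if even (\<Sum>i<k. v i) then \<lfloor>\<Sum>i<n. of_int (v i) * \<beta> i\<rfloor> else 0)) mod 2"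
    if v: "\<exists>i<n. v i \<noteq> 0" for v
  proof -
    define N where "N = Nq n v"
    \<comment> \<open>The exponent of \<open>- \<i>\<close> becomes the even number
      \<open>2 * h\<close>, so the imaginary units combine to the sign
      \<open>(-1) powi h\<close>.\<close>
    define h where "h = (\<Sum>i<k. (v i - v i ^ 2) div 2)"
    have ev2: "even (y - y ^ 2)" for y :: int by simp
    have az: "anet n (\<lambda>v. \<kappa> * (zv v * zv v)) v = 0"
      unfolding anet_cmult zv_def anet_quadratic by simp
    have ab: "anet n (\<lambda>v. (-1) * (Bc v * xv v) + (- ell / 2) * (Bc v * Bc v)) v = 0"
      unfolding anet_add anet_cmult Bc_def xv_def anet_quadratic by simp
    \<comment> \<open>The choice of the logarithms \<open>z i\<close> modulo \<open>L\<close> does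
      not affect the sign.\<close>
    have aAB: "even (anet n (\<lambda>v. Av v + Bv v) v)"
      unfolding anet_add Av_def Bv_def anet_linear by (intro even_add[THEN iffD2]) (auto intro!: dvd_sum)
    have as: "anet n sv v = 2 * h"
    proof -
      have "anet n sv v = (\<Sum>i<n. (v i - v i ^ 2) * sg i)"
        unfolding sv_def anet_linear by simp
      also have "\<dots> = (\<Sum>i<n. if i < k then v i - v i ^ 2 else 0)" by (intro sum.cong) (auto simp: sg_def)
      also have "\<dots> = (\<Sum>i\<in>{..<n} \<inter> {..<k}. v i - v i ^ 2)" by (simp add: sum.inter_restrict)
      also have "{..<n} \<inter> {..<k} = {..<k}" using k(1) by auto
      also have "(\<Sum>i<k. v i - v i ^ 2) = (\<Sum>i<k. 2 * ((v i - v i ^ 2) div 2))"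
        by (intro sum.cong refl) (use ev2 in \<open>simp add: dvd_mult_div_cancel\<close>)
      finally show ?thesis by (simp add: h_def sum_distrib_left)
    qed
    obtain R where R: "R > 0" "net n (\<lambda>v. complex_of_real (\<rho> v)) v = of_real R"
    proof -
      have "\<rho> (unitv i) > 0" if "i < n" for i
        by (rule \<rho>_pos, rule exI[of _ i]) (use that in \<open>simp add: unitv_def\<close>)
      moreover have "\<rho> (pairv i j) > 0" if "i < j" "j < n" for i j
        by (rule \<rho>_pos, rule exI[of _ i]) (use that in \<open>simp add: unitv_def pairv_def\<close>)
      ultimately have "\<exists>R>0. net n (\<lambda>v. complex_of_real (\<rho> v)) v = of_real R"
        by (intro net_of_real_pos \<rho>_pos[OF v])
      thus ?thesis using that by blast
    qed
    have "net n (\<lambda>v. of_real M * (exp (\<kappa> * (zv v * zv v)) * F v)) v =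
       of_real M powi (- N) * net n F v"
      unfolding net_mult net_exp az using M(2) by (simp add: net_const N_def)
    moreover have "net n (\<lambda>v. of_real M * (exp (\<kappa> * (zv v * zv v)) * F v)) v =
       (-1) powi (- N) * ((-1) powi h * (of_real R * (-1) powi (anet n \<eta> v)))"
    proof -
      have "net n (\<lambda>v. of_real M * (exp (\<kappa> * (zv v * zv v)) * F v)) v =
         (-1) powi (anet n (\<lambda>v. Av v + Bv v) v) * (exp 0 * ((-1) powi (- N) * ((- \<i>) powi (2 * h) * (of_real R * (-1) powi (anet n \<eta> v)))))"
        unfolding FT net_mult net_exp ab R(2) by (simp add: net_powi net_const as N_def)
      moreover have "(-1) powi (anet n (\<lambda>v. Av v + Bv v) v) = (1 :: complex)"
        using aAB by (simp add: power_int_minus_left)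
      ultimately show ?thesis by (simp only: minus_i_powi_double exp_zero mult_1_left)
    qed
    moreover have Mcancel: "complex_of_real M powi N * of_real M powi (- N) = 1"
      using M(2) by (simp add: power_int_minus)
    ultimately have "of_real M powi (- N) * net n F v = (-1) powi (- N) * ((-1) powi h * (of_real R * (-1) powi (anet n \<eta> v)))"
      by simp
    hence "of_real M powi N * (of_real M powi (- N) * net n F v) =
       of_real M powi N * ((-1) powi (- N) * ((-1) powi h * (of_real R * (-1) powi (anet n \<eta> v))))" by (rule arg_cong)
    hence nF: "net n F v = of_real M powi N * ((-1) powi (- N) * ((-1) powi h * (of_real R * (-1) powi (anet n \<eta> v))))"
      using M(2) by (simp only: mult.assoc[symmetric] Mcancel mult_1_left)
    have "netPsi L n z v = (-1) powi N * net n F v"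
      unfolding netPsi_eq_net F_def zv_def N_def ..
    also have "\<dots> = ((-1) powi N * (-1) powi (- N)) * (of_real M powi N * of_real R * ((-1) powi h * (-1) powi (anet n \<eta> v)))"
      unfolding nF by (simp only: mult_ac)
    \<comment> \<open>The leading minus sign of \<open>T\<close> contributes
      \<open>(-1) powi (- N)\<close>, which cancels the sign in the definition of
      \<open>netPsi\<close>.\<close>
    also have "(-1) powi N * (-1) powi (- N) = (1::complex)" by (simp add: power_int_minus)
    also have "(-1) powi h * (-1) powi (anet n \<eta> v) = ((-1) powi (h + anet n \<eta> v) :: complex)" by (simp add: power_int_add)
    finally have "netPsi L n z v = of_real (M powi N * R * (-1) powi (h + anet n \<eta> v))"
      by (simp add: of_real_power_int)
    hence Psi: "Re (netPsi L n z v) = M powi N * R * (-1) powi (h + anet n \<eta> v)"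
      by (simp only: Re_complex_of_real)
    have pos: "(-1) powi (e * N) * M powi N > 0"
    proof -
      have "(-1) powi (e * N) * M powi N = ((-1) powi e * M) powi N"
        by (simp add: power_int_mult_distrib power_int_mult)
      moreover have "phir q \<noteq> 0" using M(2) by (auto simp: M_def)
      hence "(-1) powi e * M > 0" using mu0 by (auto simp: e_def M_def mult_neg_pos)
      ultimately show ?thesis by (simp add: zero_less_power_int)
    qed
    have "(-1) powi (e * Nq n v) * Re (netPsi L n z v) = (-1) powi (h + anet n \<eta> v) * ((-1) powi (e * N) * M powi N * R)"
      unfolding Psi N_def by (simp only: mult_ac)
    hence par: "Parity ((-1) powi (e * Nq n v) * Re (netPsi L n z v)) mod 2 = (h + anet n \<eta> v) mod 2"
      using Parity_sign[of "(-1) powi (e * N) * M powi N * R" "h + anet n \<eta> v"] pos R(1) by simp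
    \<comment> \<open>The normalization \<open>0 < \<beta> i < 1\<close> removes the single-index
      terms.\<close>
    have \<eta>1: "\<eta> (unitv i) = 0" if "i < n" for i
    proof -
      have "sv (unitv i) = sg i" "bv (unitv i) = \<beta> i"
        unfolding sv_def bv_def by (rule sum_unitv[OF that])+
      moreover have "\<lfloor>\<beta> i\<rfloor> = 0" using \<beta>01[OF that] by (simp add: floor_eq_iff)
      ultimately show ?thesis by (simp add: \<eta>_def)
    qed
    \<comment> \<open>A pair with one negative and one positive \<open>u\<close> has odd
      \<open>sg i + sg j\<close> and drops out; this is why the double sum falls into two
      blocks.\<close>
    have \<eta>2: "\<eta> (pairv i j) = (if even (sg i + sg j) then \<lfloor>\<beta> i + \<beta> j\<rfloor> else 0)" if "i < n" "j < n" for i j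
      unfolding \<eta>_def sv_def bv_def sum_pairv[OF that] ..
    define G where "G = (\<lambda>i j. \<lfloor>\<beta> i + \<beta> j\<rfloor> * v i * v j)"
    define W where "W = (\<Sum>i<k. \<Sum>j\<in>{i<..<k}. G i j) + (\<Sum>i\<in>{k..<n}. \<Sum>j\<in>{i<..<n}. G i j)"
    have W: "(\<Sum>i<n. \<Sum>j\<in>{i<..<n}. v i * v j * \<eta> (pairv i j)) = W"
    proof -
      have "{..<n} = {..<k} \<union> {k..<n}" using k(1) by auto
      hence "(\<Sum>i<n. \<Sum>j\<in>{i<..<n}. v i * v j * \<eta> (pairv i j)) =
         (\<Sum>i<k. \<Sum>j\<in>{i<..<n}. v i * v j * \<eta> (pairv i j)) + (\<Sum>i\<in>{k..<n}. \<Sum>j\<in>{i<..<n}. v i * v j * \<eta> (pairv i j))"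
        by (simp add: sum.union_disjoint ivl_disj_int)
      moreover have "(\<Sum>j\<in>{i<..<n}. v i * v j * \<eta> (pairv i j)) = (\<Sum>j\<in>{i<..<k}. G i j)" if i: "i < k" for i
      proof -
        have "(\<Sum>j\<in>{i<..<n}. v i * v j * \<eta> (pairv i j)) = (\<Sum>j\<in>{i<..<k}. v i * v j * \<eta> (pairv i j))"
        proof (rule sum.mono_neutral_right)
          show "\<forall>j\<in>{i<..<n} - {i<..<k}. v i * v j * \<eta> (pairv i j) = 0"
          proof
            fix j assume "j \<in> {i<..<n} - {i<..<k}"
            hence "j < n" "\<not> j < k" by auto
            thus "v i * v j * \<eta> (pairv i j) = 0" using \<eta>2[of i j] i k(1) by (simp add: sg_def)
          qed
        qed (use k(1) in auto)
        also have "\<dots> = (\<Sum>j\<in>{i<..<k}. G i j)"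
          by (intro sum.cong refl) (use \<eta>2 i k(1) in \<open>simp add: sg_def G_def\<close>)
        finally show ?thesis .
      qed
      moreover have "(\<Sum>i\<in>{k..<n}. \<Sum>j\<in>{i<..<n}. v i * v j * \<eta> (pairv i j)) = (\<Sum>i\<in>{k..<n}. \<Sum>j\<in>{i<..<n}. G i j)"
        by (intro sum.cong refl) (use \<eta>2 in \<open>simp add: sg_def G_def\<close>)
      ultimately show ?thesis by (simp add: W_def)
    qed
    have a\<eta>: "anet n \<eta> v = \<eta> v - W"
    proof -
      have "(\<Sum>i<n. (2 * v i ^ 2 - (\<Sum>j<n. v i * v j)) * \<eta> (unitv i)) = 0"
        by (intro sum.neutral) (use \<eta>1 in auto)
      thus ?thesis unfolding anet_def using W by simp
    qed
    \<comment> \<open>For \<open>y = 2 * c\<close> and \<open>y = 2 * c + 1\<close> the half of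
      \<open>y - y ^ 2\<close> is \<open>c - 2 * c ^ 2\<close> and \<open>- c - 2 * c ^ 2\<close>;
      both are congruent to \<open>c = y div 2\<close> modulo 2.\<close>
    have "even (h - (\<Sum>i<k. v i div 2))"
    proof -
      have "even ((y - y ^ 2) div 2 - y div 2)" for y :: int
      proof (cases "even y")
        case True
        then obtain c where c: "y = 2 * c" by blast
        have "y - y ^ 2 = 2 * (c - 2 * c ^ 2)" unfolding c by (simp add: power2_eq_square)
        thus ?thesis unfolding c by simp
      next
        case False
        then obtain c where c: "y = 2 * c + 1" by (rule oddE)
        have "y - y ^ 2 = 2 * (- c - 2 * c ^ 2)" unfolding c by (simp add: power2_eq_square algebra_simps)
        hence "(y - y ^ 2) div 2 = - c - 2 * c ^ 2"
          by (simp only: nonzero_mult_div_cancel_left[OF zero_neq_numeral[symmetric]])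
        moreover have "y div 2 = c" unfolding c by simp
        ultimately show ?thesis by simp
      qed
      thus ?thesis unfolding h_def sum_subtractf[symmetric] by (intro dvd_sum) auto
    qed
    hence "even ((h + (\<eta> v - W)) - (W + (\<Sum>i<k. v i div 2) + \<eta> v))" by presburger
    hence "(h + anet n \<eta> v) mod 2 = (W + (\<Sum>i<k. v i div 2) + \<eta> v) mod 2"
      unfolding a\<eta> by (simp only: mod_eq_dvd_iff)
    thus ?thesis unfolding par W_def G_def \<eta>_def sv_k bv_def .
  qed
  have e01: "e = 0 \<or> e = 1" by (simp add: e_def)
  show ?thesis
    unfolding Let_def \<beta>_def[symmetric]
  proof (intro conjI exI[of _ e])
    show "\<forall>i<n. \<beta> i \<notin> \<rat>" using P1 by blast
    show "\<forall>c :: nat \<Rightarrow> real. (\<forall>i<n. c i \<in> \<rat>) \<and> (\<Sum>i<n. c i * \<beta> i) = 0 \<longrightarrow> (\<forall>i<n. c i = 0)" using P2 by blast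
    show "e = 0 \<or> e = 1" by (rule e01)
  qed (use P3 in auto)
qed

end
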